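(* Let $k\ge2$, $\boldsymbol{\alpha}=(\alpha_1,\dots,\alpha_k)\in(0,+\infty)^k$, $\beta\in(0,+\infty)$, $\alpha_0=\sum_{i=1}^k\alpha_i$. Let $\mathbf{X}_n=(X_{1n},\dots,X_{kn})$, $n\in[N]$, be a random sample from the Multivariate Gamma distribution $\mathcal{MG}_k(\boldsymbol{\alpha},\beta)$ and $\mathbf{W}_n=(W_{1n},\dots,W_{kn}):=\Delta\mathbf{X}_n/X_{kn}$, $n\in[N]$, the corresponding Dirichlet $\mathcal{D}_k(\boldsymbol{\alpha})$ sample. Define the Dirichlet-based ME $(\tilde{\boldsymbol{\alpha}},\tilde\beta)$ by $$\tilde\alpha_i=\frac{\overline{W_i}\,(\overline{W_i}-\overline{W_i^2})}{\overline{W_i^2}-\overline{W_i}^2},\quad i\in[k],\qquad\tilde\beta=\frac{\overline{X_k}}{\sum_{i=1}^k\tilde\alpha_i},$$ and the Dirichlet-based SAME $(\breve{\boldsymbol{\alpha}},\breve\beta)$ by $$\breve\alpha_i=\frac{(k-1)\overline{W_i}}{\sum_{j=1}^k\left[\overline{W_j\log W_j}-\overline{W_j}\;\overline{\log W_j}\right]},\quad i\in[k],\qquad\breve\beta=\frac{\overline{X_k}}{\sum_{i=1}^k\breve\alpha_i}.$$ Then both are moment-type estimators of $(\boldsymbol{\alpha},\beta)$, and each has asymptotic variance-covariance matrix $\mathbf{G}\mathbf{V}\mathbf{G}^\top$ with $$\mathbf{G}=\begin{bmatrix}\mathbf{G}_D&\mathbf{O}_{k\times1}\\-\beta\alpha_0^{-1}\mathbf{1}_{1\times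 k}\mathbf{G}_D&\alpha_0^{-1}\end{bmatrix},\qquad\mathbf{V}=\begin{bmatrix}\mathbf{V}_D&\mathbf{O}_{m\times1}\\\mathbf{O}_{1\times m}&\alpha_0\beta^2\end{bmatrix},$$ where $\mathbf{G}_D=\nabla g_D(e_{h_D}(\boldsymbol{\alpha}))$ is the $k\times m$ Jacobian matrix and $\mathbf{V}_D=v_{h_D}(\boldsymbol{\alpha})$ is the $m\times m$ variance-covariance matrix of $h_D(\mathbf{W})$, $\mathbf{W}\sim\mathcal{D}_k(\boldsymbol{\alpha})$, with: for the Dirichlet-based ME, $m=2k$, $h_D(\mathbf{w})=(w_1,\dots,w_k,w_1^2,\dots,w_k^2)$ and $g_{D_i}(\mathbf{y})=\frac{y_i(y_i-y_{k+i})}{y_{k+i}-y_i^2}$, $i\in[k]$; for the Dirichlet-based SAME, $m=3k$, $h_D(\mathbf{w})=(w_1,\dots,w_k,\log w_1,\dots,\log w_k,w_1\log w_1,\dots,w_k\log w_k)$ and $g_{D_i}(\mathbf{y})=\frac{(k-1)y_i}{\sum_{j=1}^k(y_{2k+j}-y_jy_{k+j})}$, $i\in[k]$.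
   Context: Notation: $[k]=\{1,\dots,k\}$; a random sample is an i.i.d. sample; a bar denotes the sample mean over $n\in[N]$, e.g. $\overline{W_j\log W_j}=\frac1N\sum_{n=1}^N W_{jn}\log W_{jn}$. $\mathbf{1}_{a\times b}$ and $\mathbf{O}_{a\times b}$ are the all-ones and zero matrices. $\Delta\mathbf{x}:=(x_1,x_2-x_1,\dots,x_k-x_{k-1})$. $e_h(\boldsymbol{\theta})=\mathbb{E}_{\boldsymbol{\theta}}(h(\mathbf{X}))$ and $v_h(\boldsymbol{\theta})=\mathbb{V}_{\boldsymbol{\theta}}(h(\mathbf{X}))$ (variance-covariance matrix). Multivariate Gamma distribution: $\mathbf{X}\sim\mathcal{MG}_k(\boldsymbol{\alpha},\beta)$ has Lebesgue density on $\mathbb{R}^k$ $f(\mathbf{x};\boldsymbol{\alpha},\beta)=\frac{1}{\beta^{\alpha_0}\prod_{i=1}^k\Gamma(\alpha_i)}e^{-x_k/\beta}x_1^{\alpha_1-1}\prod_{i=2}^k(x_i-x_{i-1})^{\alpha_i-1}$ on $\{\mathbf{x}\in(0,+\infty)^k:x_1<x_2<\dots<x_k\}$. Dirichlet distribution: $\mathbf{W}\sim\mathcal{D}_k(\boldsymbol{\alpha})$ has density, with respect to Lebesgue measure on $\mathbb{R}^{k-1}$ (using the first $k-1$ coordinates), $f(\mathbf{w};\boldsymbol{\alpha})=\frac{\Gamma(\alpha_0)}{\prod_{i=1}^k\Gamma(\alpha_i)}\prod_{i=1}^k w_i^{\alpha_i-1}$ on the open simplex $\{\mathbf{w}\in(0,1)^k:\sum_i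 w_i=1\}$. It is well known that if $\mathbf{X}\sim\mathcal{MG}_k(\boldsymbol{\alpha},\beta)$ then $\Delta\mathbf{X}/X_k\sim\mathcal{D}_k(\boldsymbol{\alpha})$. Moment-type estimator: for a parametric family with support $\mathbf{S}\subset\mathbb{R}^k$ and parameter space $\boldsymbol{\Theta}\subset\mathbb{R}^d$, let $h:\mathbf{S}\to\mathbb{R}^m$ be such that $e_h:\boldsymbol{\Theta}\to\mathbb{R}^m$ is injective, and let $g:\mathbb{R}^m\to\mathbb{R}^d$ satisfy $g|_{e_h(\boldsymbol{\Theta})}=e_h^{-1}$. The estimator $\tilde{\boldsymbol{\theta}}_N=g(\overline{h(\mathbf{X})})$ is called a moment-type estimator of $\boldsymbol{\theta}$ (with functions $h,g$); it exists as long as $\tilde{\boldsymbol{\theta}}_N\in\boldsymbol{\Theta}$. A function $g$ given by a formula is understood to be defined arbitrarily where the formula is undefined. Here $\boldsymbol{\theta}=(\boldsymbol{\alpha},\beta)$, $\boldsymbol{\Theta}=(0,+\infty)^{k+1}$. An estimator $\tilde{\boldsymbol{\theta}}_N$ that exists with probability tending to 1 as $N\to\infty$ has asymptotic variance-covariance matrix $\boldsymbol{\Sigma}$ if $\sqrt{N}(\tilde{\boldsymbol{\theta}}_N-\boldsymbol{\theta})$ converges in law, under $\boldsymbol{\theta}$, to the centered normal distribution with covariance matrix $\boldsymbol{\Sigma}$ as $N\to\infty$. *)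

theory Defs
  imports "HOL-Probability.Probability"
begin

text \<open>
  \<open>\<real>\<^sup>k\<close> is \<open>real ^ 'k\<close> with \<open>'k\<close> a finite linearly ordered index type, the order playing the role of
  \<open>1 < 2 < \<dots> < k\<close>. Concatenated vectors are indexed by sum types, and a scalar block is an
  element of \<open>real ^ 1\<close>.
\<close>

section \<open>Vectors and block matrices\<close>

definition last_ix :: "'k::{finite,linorder}" where
  "last_ix = Max UNIV"

definition first_ix :: "'k::{finite,linorder}" where
  "first_ix = Min UNIV"

text \<open>Meaningful only for \<open>i \<noteq> first_ix\<close>.\<close>

definition pred_ix :: "'k::{finite,linorder} \<Rightarrow> 'k::{finite,linorder}" where
  "pred_ix i = Max {j. j < i}"

definition append_vec :: "'a ^ 'm \<Rightarrow> 'a ^ 'n \<Rightarrow> 'a ^ ('m::finite + 'n::finite)" where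
  "append_vec u v = (\<chi> i. case i of Inl a \<Rightarrow> u $ a | Inr b \<Rightarrow> v $ b)"

definition left_vec :: "'a ^ ('m::finite + 'n::finite) \<Rightarrow> 'a ^ 'm" where
  "left_vec v = (\<chi> i. v $ Inl i)"

definition right_vec :: "'a ^ ('m::finite + 'n::finite) \<Rightarrow> 'a ^ 'n" where
  "right_vec v = (\<chi> i. v $ Inr i)"

definition block_matrix ::
    "'a ^ 'm ^ 'p \<Rightarrow> 'a ^ 'n ^ 'p \<Rightarrow> 'a ^ 'm ^ 'q \<Rightarrow> 'a ^ 'n ^ 'q
      \<Rightarrow> 'a ^ ('m::finite + 'n::finite) ^ ('p::finite + 'q::finite)" where
  "block_matrix A B C D =
    (\<chi> i. case i of Inl p \<Rightarrow> append_vec (A $ p) (B $ p) | Inr q \<Rightarrow> append_vec (C $ q) (D $ q))"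

definition delta_vec :: "real ^ 'k::{finite,linorder} \<Rightarrow> real ^ 'k::{finite,linorder}" where
  "delta_vec x = (\<chi> i. if i = first_ix then x $ i else x $ i - x $ pred_ix i)"


section \<open>Multivariate Gamma and Dirichlet distributions\<close>

definition mg_support :: "(real ^ 'k::{finite,linorder}) set" where
  "mg_support = {x. (\<forall>i. 0 < x $ i) \<and> strict_mono (\<lambda>i. x $ i)}"

definition mg_density :: "real ^ 'k::{finite,linorder} \<Rightarrow> real \<Rightarrow> real ^ 'k::{finite,linorder} \<Rightarrow> real" where
  "mg_density \<alpha> \<beta> x =
    (if x \<in> mg_support then
       1 / (\<beta> powr (\<Sum>i\<in>UNIV. \<alpha> $ i) * (\<Prod>i\<in>UNIV. Gamma (\<alpha> $ i)))
         * exp (- (x $ last_ix) / \<beta>)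
         * (x $ first_ix) powr (\<alpha> $ first_ix - 1)
         * (\<Prod>i\<in>UNIV - {first_ix}. (x $ i - x $ pred_ix i) powr (\<alpha> $ i - 1))
     else 0)"

definition mg_distribution :: "real ^ 'k::{finite,linorder} \<Rightarrow> real \<Rightarrow> (real ^ 'k::{finite,linorder}) measure" where
  "mg_distribution \<alpha> \<beta> = density lborel (\<lambda>x. ennreal (mg_density \<alpha> \<beta> x))"

definition simplex_vec :: "('k \<Rightarrow> real) \<Rightarrow> real ^ 'k::{finite,linorder}" where
  "simplex_vec u = (\<chi> i. if i = last_ix then 1 - (\<Sum>j\<in>UNIV - {last_ix}. u j) else u i)"

definition dirichlet_density :: "real ^ 'k::{finite,linorder} \<Rightarrow> real ^ 'k::{finite,linorder} \<Rightarrow> real" where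
  "dirichlet_density \<alpha> w =
    (if (\<forall>i. 0 < w $ i \<and> w $ i < 1) \<and> (\<Sum>i\<in>UNIV. w $ i) = 1 then
       Gamma (\<Sum>i\<in>UNIV. \<alpha> $ i) / (\<Prod>i\<in>UNIV. Gamma (\<alpha> $ i))
         * (\<Prod>i\<in>UNIV. (w $ i) powr (\<alpha> $ i - 1))
     else 0)"

text \<open>
  The reference measure is Lebesgue measure in the coordinates other than the last one
  (a product measure over \<open>UNIV - {last_ix}\<close>), transported to the hyperplane
  \<open>(\<Sum>i\<in>UNIV. w $ i) = 1\<close> by \<open>simplex_vec\<close>.
\<close>

definition dirichlet_distribution :: "real ^ 'k::{finite,linorder} \<Rightarrow> (real ^ 'k::{finite,linorder}) measure" where
  "dirichlet_distribution \<alpha> =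
    distr
      (density (\<Pi>\<^sub>M i\<in>UNIV - {last_ix}. lborel)
        (\<lambda>u. ennreal (dirichlet_density \<alpha> (simplex_vec u))))
      borel simplex_vec"


section \<open>Estimators and their asymptotics\<close>

definition sample_mean :: "nat \<Rightarrow> (nat \<Rightarrow> 'v::real_vector) \<Rightarrow> 'v" where
  "sample_mean N f = (\<Sum>n = 1..N. f n) /\<^sub>R real N"

definition covariance_matrix :: "'a measure \<Rightarrow> ('a \<Rightarrow> real ^ 'm) \<Rightarrow> real ^ 'm ^ 'm::finite" where
  "covariance_matrix P h =
    (\<chi> i j. \<integral>x. (h x $ i - (\<integral>y. h y \<partial>P) $ i) * (h x $ j - (\<integral>y. h y \<partial>P) $ j) \<partial>P)"

text \<open>
  The statistic \<open>T N x\<close> is computed from the first \<open>N\<close> observations \<open>x 1, \<dots>, x N\<close>. Integrability of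
  \<open>h\<close> is what makes the map \<open>e\<^sub>h\<close>, here \<open>\<lambda>\<theta>. \<integral>x. h x \<partial>P \<theta>\<close>, well defined.
\<close>

definition moment_type_estimator ::
    "('t::euclidean_space \<Rightarrow> 's::euclidean_space measure) \<Rightarrow> 's set \<Rightarrow> 't set
      \<Rightarrow> ('s \<Rightarrow> 'm::euclidean_space) \<Rightarrow> ('m \<Rightarrow> 't) \<Rightarrow> (nat \<Rightarrow> (nat \<Rightarrow> 's) \<Rightarrow> 't) \<Rightarrow> bool" where
  "moment_type_estimator P S \<Theta> h g T \<longleftrightarrow>
    (\<forall>\<theta>\<in>\<Theta>. integrable (P \<theta>) h) \<and>
    inj_on (\<lambda>\<theta>. \<integral>x. h x \<partial>P \<theta>) \<Theta> \<and>
    (\<forall>y\<in>(\<lambda>\<theta>. \<integral>x. h x \<partial>P \<theta>) ` \<Theta>. g y = the_inv_into \<Theta> (\<lambda>\<theta>. \<integral>x. h x \<partial>P \<theta>) y) \<and>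
    (\<forall>N\<ge>1. \<forall>x. (\<forall>n\<in>{1..N}. x n \<in> S) \<longrightarrow> T N x = g (sample_mean N (\<lambda>n. h (x n))))"

definition weakly_converges :: "(nat \<Rightarrow> 'a::topological_space measure) \<Rightarrow> 'a measure \<Rightarrow> bool" where
  "weakly_converges \<mu>s \<mu> \<longleftrightarrow>
    (\<forall>f::'a \<Rightarrow> real. continuous_on UNIV f \<and> bounded (range f) \<longrightarrow>
      (\<lambda>N. \<integral>x. f x \<partial>\<mu>s N) \<longlonglongrightarrow> (\<integral>x. f x \<partial>\<mu>))"

text \<open>Defined by the characteristic function, so that singular covariance matrices are allowed.\<close>

definition centered_normal :: "real ^ 'd ^ 'd \<Rightarrow> (real ^ 'd::finite) measure \<Rightarrow> bool" where
  "centered_normal \<Sigma> \<mu> \<longleftrightarrow>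
    prob_space \<mu> \<and> sets \<mu> = sets borel \<and> transpose \<Sigma> = \<Sigma> \<and>
    (\<forall>t. (CLINT x|\<mu>. iexp (t \<bullet> x)) = complex_of_real (exp (- (t \<bullet> (\<Sigma> *v t)) / 2)))"

definition has_asymptotic_covariance ::
    "'a measure \<Rightarrow> (nat \<Rightarrow> 'a \<Rightarrow> real ^ 'd) \<Rightarrow> (real ^ 'd) set \<Rightarrow> real ^ 'd
      \<Rightarrow> real ^ 'd ^ 'd::finite \<Rightarrow> bool" where
  "has_asymptotic_covariance M T \<Theta> \<theta> \<Sigma> \<longleftrightarrow>
    (\<forall>N. T N \<in> borel_measurable M) \<and>
    (\<lambda>N. measure M {\<omega> \<in> space M. T N \<omega> \<in> \<Theta>}) \<longlonglongrightarrow> 1 \<and>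
    (\<exists>\<mu>. centered_normal \<Sigma> \<mu> \<and>
      weakly_converges (\<lambda>N. distr M borel (\<lambda>\<omega>. sqrt (real N) *\<^sub>R (T N \<omega> - \<theta>))) \<mu>)"


section \<open>The Multivariate Gamma family and its Dirichlet-based estimators\<close>

definition mg_param :: "real ^ 'k \<Rightarrow> real \<Rightarrow> real ^ ('k::finite + 1)" where
  "mg_param \<alpha> \<beta> = append_vec \<alpha> (vec \<beta>)"

definition mg_param_space :: "(real ^ ('k::finite + 1)) set" where
  "mg_param_space = {\<theta>. \<forall>i. 0 < \<theta> $ i}"

definition mg_family :: "real ^ ('k + 1) \<Rightarrow> (real ^ 'k::{finite,linorder}) measure" where
  "mg_family \<theta> = mg_distribution (left_vec \<theta>) (right_vec \<theta> $ 1)"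

definition dirichlet_part :: "real ^ 'k::{finite,linorder} \<Rightarrow> real ^ 'k::{finite,linorder}" where
  "dirichlet_part x = delta_vec x /\<^sub>R (x $ last_ix)"

text \<open>
  Where a denominator below vanishes, the value is the one given by \<open>a / 0 = 0\<close>; this is one
  admissible choice for a formula that is undefined there.
\<close>

definition me_alpha :: "nat \<Rightarrow> (nat \<Rightarrow> real ^ 'k) \<Rightarrow> real ^ 'k::finite" where
  "me_alpha N w =
    (\<chi> i. sample_mean N (\<lambda>n. w n $ i)
            * (sample_mean N (\<lambda>n. w n $ i) - sample_mean N (\<lambda>n. (w n $ i)\<^sup>2))
          / (sample_mean N (\<lambda>n. (w n $ i)\<^sup>2) - (sample_mean N (\<lambda>n. w n $ i))\<^sup>2))"

definition same_alpha :: "nat \<Rightarrow> (nat \<Rightarrow> real ^ 'k) \<Rightarrow> real ^ 'k::finite" where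
  "same_alpha N w =
    (\<chi> i. (real CARD('k) - 1) * sample_mean N (\<lambda>n. w n $ i)
          / (\<Sum>j\<in>UNIV. sample_mean N (\<lambda>n. w n $ j * ln (w n $ j))
                        - sample_mean N (\<lambda>n. w n $ j) * sample_mean N (\<lambda>n. ln (w n $ j))))"

definition dirichlet_me ::
    "nat \<Rightarrow> (nat \<Rightarrow> real ^ 'k::{finite,linorder}) \<Rightarrow> real ^ ('k + 1)" where
  "dirichlet_me N x =
    (let a = me_alpha N (\<lambda>n. dirichlet_part (x n))
     in mg_param a (sample_mean N (\<lambda>n. x n $ last_ix) / (\<Sum>i\<in>UNIV. a $ i)))"

definition dirichlet_same ::
    "nat \<Rightarrow> (nat \<Rightarrow> real ^ 'k::{finite,linorder}) \<Rightarrow> real ^ ('k + 1)" where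
  "dirichlet_same N x =
    (let a = same_alpha N (\<lambda>n. dirichlet_part (x n))
     in mg_param a (sample_mean N (\<lambda>n. x n $ last_ix) / (\<Sum>i\<in>UNIV. a $ i)))"

definition me_hD :: "real ^ 'k \<Rightarrow> real ^ ('k::finite + 'k)" where
  "me_hD w = append_vec w (\<chi> i. (w $ i)\<^sup>2)"

definition me_gD :: "real ^ ('k + 'k) \<Rightarrow> real ^ 'k::finite" where
  "me_gD y = (\<chi> i. y $ Inl i * (y $ Inl i - y $ Inr i) / (y $ Inr i - (y $ Inl i)\<^sup>2))"

definition same_hD :: "real ^ 'k \<Rightarrow> real ^ ('k::finite + ('k + 'k))" where
  "same_hD w = append_vec w (append_vec (\<chi> i. ln (w $ i)) (\<chi> i. w $ i * ln (w $ i)))"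

definition same_gD :: "real ^ ('k + ('k + 'k)) \<Rightarrow> real ^ 'k::finite" where
  "same_gD y =
    (\<chi> i. (real CARD('k) - 1) * y $ Inl i
          / (\<Sum>j\<in>UNIV. y $ Inr (Inr j) - y $ Inl j * y $ Inr (Inl j)))"

text \<open>
  A Dirichlet moment pair \<open>h\<^sub>D\<close>, \<open>g\<^sub>D\<close> becomes a pair for the Multivariate Gamma family by adjoining
  the last coordinate, whose mean is \<open>\<beta> * (\<Sum>i\<in>UNIV. \<alpha> $ i)\<close>.
\<close>

definition mg_h :: "(real ^ 'k::{finite,linorder} \<Rightarrow> real ^ 'm) \<Rightarrow> real ^ 'k::{finite,linorder}
    \<Rightarrow> real ^ ('m::finite + 1)" where
  "mg_h hD x = append_vec (hD (dirichlet_part x)) (vec (x $ last_ix))"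

definition mg_g :: "(real ^ 'm \<Rightarrow> real ^ 'k) \<Rightarrow> real ^ ('m::finite + 1)
    \<Rightarrow> real ^ ('k::finite + 1)" where
  "mg_g gD y =
    mg_param (gD (left_vec y)) ((right_vec y $ 1) / (\<Sum>i\<in>UNIV. gD (left_vec y) $ i))"

definition matrix_G :: "real ^ 'k \<Rightarrow> real \<Rightarrow> real ^ 'm ^ 'k
    \<Rightarrow> real ^ ('m::finite + 1) ^ ('k::finite + 1)" where
  "matrix_G \<alpha> \<beta> GD =
    (let \<alpha>0 = (\<Sum>i\<in>UNIV. \<alpha> $ i); ones = (\<chi> i j. 1) :: real ^ 'k ^ 1
     in block_matrix GD 0 ((- \<beta> / \<alpha>0) *\<^sub>R (ones ** GD)) (mat (1 / \<alpha>0)))"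

definition matrix_V :: "real ^ 'k \<Rightarrow> real \<Rightarrow> real ^ 'm ^ 'm
    \<Rightarrow> real ^ ('m::finite + 1) ^ ('m + 1)" where
  "matrix_V \<alpha> \<beta> VD = block_matrix VD 0 0 (mat ((\<Sum>i\<in>UNIV. \<alpha> $ i) * \<beta>\<^sup>2))"

definition dirichlet_mean ::
    "(real ^ 'k::{finite,linorder} \<Rightarrow> real ^ 'm) \<Rightarrow> real ^ 'k::{finite,linorder} \<Rightarrow> real ^ 'm::finite" where
  "dirichlet_mean hD \<alpha> = (\<integral>w. hD w \<partial>dirichlet_distribution \<alpha>)"

text \<open>Existence of the Jacobian and of the covariance matrix entering \<open>matrix_G\<close> and \<open>matrix_V\<close>.\<close>

definition dirichlet_regular ::
    "(real ^ 'k::{finite,linorder} \<Rightarrow> real ^ 'm) \<Rightarrow> (real ^ 'm::finite \<Rightarrow> real ^ 'k::{finite,linorder})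
      \<Rightarrow> real ^ 'k::{finite,linorder} \<Rightarrow> bool" where
  "dirichlet_regular hD gD \<alpha> \<longleftrightarrow>
    integrable (dirichlet_distribution \<alpha>) hD \<and>
    (\<forall>i. integrable (dirichlet_distribution \<alpha>) (\<lambda>w. (hD w $ i)\<^sup>2)) \<and>
    gD differentiable (at (dirichlet_mean hD \<alpha>))"

definition dirichlet_based_covariance ::
    "(real ^ 'k::{finite,linorder} \<Rightarrow> real ^ 'm) \<Rightarrow> (real ^ 'm::finite \<Rightarrow> real ^ 'k::{finite,linorder})
      \<Rightarrow> real ^ 'k::{finite,linorder} \<Rightarrow> real \<Rightarrow> real ^ ('k + 1) ^ ('k + 1)"
    where
  "dirichlet_based_covariance hD gD \<alpha> \<beta> =
    (let G = matrix_G \<alpha> \<beta> (jacobian gD (at (dirichlet_mean hD \<alpha>)));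
         V = matrix_V \<alpha> \<beta> (covariance_matrix (dirichlet_distribution \<alpha>) hD)
     in G ** V ** transpose G)"

end

theory Submission
  imports Defs
begin

text \<open>
  Both estimators are fixed functions of a sample mean of \<open>(h\<^sub>D(W), X\<^sub>k)\<close>, where \<open>W = \<Delta>X / X\<^sub>k\<close>, so
  the result is a delta method for this vector once its law and its moments are known.

  The law. Taking partial sums preserves Lebesgue measure, and dividing the first \<open>k - 1\<close>
  coordinates by the last one, \<open>s\<close>, costs the Jacobian \<open>s\<^sup>k\<^sup>-\<^sup>1\<close>. In these coordinates the Multivariate
  Gamma density is a product, so that \<open>W\<close> and \<open>X\<^sub>k\<close> are independent with a Dirichlet law and a Gamma law
  of shape \<open>\<alpha>\<^sub>0\<close> (\<open>distr_mg_polar\<close>). Independence makes the covariance matrix block diagonal, and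
  \<open>E X\<^sub>k = \<beta> \<alpha>\<^sub>0\<close> is the equation that determines \<open>\<beta>\<close> once \<open>\<alpha>\<close> is known.

  The moments. Weighting the Dirichlet density by \<open>w\<^sub>j\<close> to a power \<open>r\<close> gives a multiple of the Dirichlet
  density in which \<open>\<alpha>\<^sub>j\<close> is replaced by \<open>\<alpha>\<^sub>j + r\<close>, so every power moment is a quotient of Gamma values.
  Differentiating it at \<open>r = 0\<close> gives \<open>E log W\<^sub>j = \<psi>(\<alpha>\<^sub>j) - \<psi>(\<alpha>\<^sub>0)\<close>, and weighting by \<open>w\<^sub>j\<close> once more turns
  the recurrence \<open>\<psi>(x + 1) = \<psi>(x) + 1/x\<close> into \<open>Cov(W\<^sub>j, log W\<^sub>j) = (1 - \<alpha>\<^sub>j/\<alpha>\<^sub>0)/\<alpha>\<^sub>0\<close>. Its sum over \<open>j\<close> is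
  \<open>(k - 1)/\<alpha>\<^sub>0\<close>, which is why the SAME formula returns \<open>\<alpha>\<close>; for the ME the first two power moments do
  the same. A moment map with a left inverse is injective, so both are moment-type estimators
  (\<open>moment_type_estimator_mg\<close>).

  The asymptotics. The one-dimensional central limit theorem, applied to all projections, gives the
  limit of the characteristic functions; the remainder of the linearisation vanishes in probability
  by Chebyshev's inequality (\<open>delta_method\<close>). Characteristic functions determine weak limits of tight
  sequences, because trigonometric polynomials approximate bounded continuous functions on balls
  while staying bounded outside (\<open>weakly_converges_if_char_converges\<close>). The limit law exists because a
  positive semidefinite form is a sum of squares of linear forms (\<open>centered_normal_exists\<close>).
\<close>

section \<open>Vector-valued maps by components\<close>

lemma borel_measurable_vecI:
  fixes f :: "'a \<Rightarrow> real ^ 'n::finite"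
  assumes "\<And>i. (\<lambda>x. f x $ i) \<in> borel_measurable M"
  shows "f \<in> borel_measurable M"
  using assms by (subst borel_measurable_euclidean_space) (auto simp: Basis_vec_def inner_axis)

lemma borel_measurable_vec_nth [measurable (raw)]:
  fixes f :: "'a \<Rightarrow> real ^ 'n::finite"
  assumes "f \<in> borel_measurable M"
  shows "(\<lambda>x. f x $ i) \<in> borel_measurable M"
  using borel_measurable_inner[OF assms borel_measurable_const[of "axis i 1"]] by (simp add: inner_axis)

lemma integrable_vecI:
  fixes f :: "'a \<Rightarrow> real ^ 'n::finite"
  assumes "\<And>i. integrable M (\<lambda>x. f x $ i)"
  shows "integrable M f"
proof -
  have "integrable M (\<lambda>x. \<Sum>i\<in>UNIV. f x $ i *\<^sub>R (axis i 1 :: real ^ 'n))"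
    using assms by (intro Bochner_Integration.integrable_sum integrable_scaleR_left) auto
  moreover have "(\<lambda>x. \<Sum>i\<in>UNIV. f x $ i *\<^sub>R (axis i 1 :: real ^ 'n)) = f"
    using basis_expansion[of "f _"] by (simp add: scalar_mult_eq_scaleR)
  ultimately show ?thesis by (simp only:)
qed

lemma integral_vec_nth:
  fixes f :: "'a \<Rightarrow> real ^ 'n::finite"
  assumes "integrable M f"
  shows "(\<integral>x. f x \<partial>M) $ i = (\<integral>x. f x $ i \<partial>M)"
  by (rule integral_bounded_linear[OF bounded_linear_vec_nth assms, symmetric])

lemma has_derivative_vecI:
  fixes f :: "'b::real_normed_vector \<Rightarrow> real ^ 'n::finite"
  assumes "\<And>i. ((\<lambda>x. f x $ i) has_derivative (\<lambda>v. f' v $ i)) (at x)"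
  shows "(f has_derivative f') (at x)"
  using assms by (subst has_derivative_componentwise_within) (auto simp: Basis_vec_def inner_axis)

lemma differentiable_vecI:
  fixes f :: "'b::real_normed_vector \<Rightarrow> real ^ 'n::finite"
  assumes "\<And>i. (\<lambda>x. f x $ i) differentiable (at x)"
  shows "f differentiable (at x)"
proof -
  have "\<forall>i. \<exists>f'. ((\<lambda>x. f x $ i) has_derivative f') (at x)" using assms by (simp add: differentiable_def)
  then obtain f' where f': "\<And>i. ((\<lambda>x. f x $ i) has_derivative f' i) (at x)" by metis
  have "(f has_derivative (\<lambda>v. \<chi> i. f' i v)) (at x)" by (rule has_derivative_vecI) (simp add: f')
  then show ?thesis by (rule differentiableI)
qed

lemma differentiable_vec_nth: "(\<lambda>x :: real ^ 'n::finite. x $ i) differentiable (at x)"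
  by (rule differentiableI[OF bounded_linear_imp_has_derivative[OF bounded_linear_vec_nth]])

section \<open>Weak convergence from characteristic functions\<close>

text \<open>
  Frequencies are arbitrary vectors, so these are finite combinations of real and imaginary parts
  of \<open>x \<mapsto> exp (\<i> t \<bullet> x)\<close>: their integrals are determined by the characteristic function.
\<close>
inductive trig_polynomial :: "('a::real_inner \<Rightarrow> real) \<Rightarrow> bool" where
  cos: "trig_polynomial (\<lambda>x. c * cos (t \<bullet> x))"
| sin: "trig_polynomial (\<lambda>x. c * sin (t \<bullet> x))"
| add: "trig_polynomial p \<Longrightarrow> trig_polynomial q \<Longrightarrow> trig_polynomial (\<lambda>x. p x + q x)"

lemma trig_polynomial_const: "trig_polynomial (\<lambda>_. c)"
  using trig_polynomial.cos[of c 0] by simp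

text \<open>The product-to-sum formulas make the class an algebra, as Stone-Weierstrass requires.\<close>
lemma trig_polynomial_mult:
  assumes "trig_polynomial p" and "trig_polynomial q"
  shows "trig_polynomial (\<lambda>x. p x * q x)"
proof -
  have mono: "trig_polynomial (\<lambda>x. c * cos (t \<bullet> x) * q x) \<and> trig_polynomial (\<lambda>x. c * sin (t \<bullet> x) * q x)"
    for c t using assms(2)
  proof (induction q)
    case (cos d s)
    have c: "(\<lambda>x. c * cos (t \<bullet> x) * (d * cos (s \<bullet> x)))
        = (\<lambda>x. (c * d / 2) * cos ((t - s) \<bullet> x) + (c * d / 2) * cos ((t + s) \<bullet> x))"
      by (auto simp: inner_diff_left inner_add_left cos_add cos_diff algebra_simps)
    have s: "(\<lambda>x. c * sin (t \<bullet> x) * (d * cos (s \<bullet> x)))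
        = (\<lambda>x. (c * d / 2) * sin ((t - s) \<bullet> x) + (c * d / 2) * sin ((t + s) \<bullet> x))"
      by (auto simp: inner_diff_left inner_add_left sin_add sin_diff algebra_simps)
    show ?case unfolding c s by (intro conjI trig_polynomial.intros)
  next
    case (sin d s)
    have c: "(\<lambda>x. c * cos (t \<bullet> x) * (d * sin (s \<bullet> x)))
        = (\<lambda>x. (c * d / 2) * sin ((t + s) \<bullet> x) + (- c * d / 2) * sin ((t - s) \<bullet> x))"
      by (auto simp: inner_diff_left inner_add_left sin_add sin_diff algebra_simps)
    have s: "(\<lambda>x. c * sin (t \<bullet> x) * (d * sin (s \<bullet> x)))
        = (\<lambda>x. (c * d / 2) * cos ((t - s) \<bullet> x) + (- c * d / 2) * cos ((t + s) \<bullet> x))"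
      by (auto simp: inner_diff_left inner_add_left cos_add cos_diff algebra_simps)
    show ?case unfolding c s by (intro conjI trig_polynomial.intros)
  next
    case (add p q)
    have c: "(\<lambda>x. c * cos (t \<bullet> x) * (p x + q x))
        = (\<lambda>x. c * cos (t \<bullet> x) * p x + c * cos (t \<bullet> x) * q x)"
      and s: "(\<lambda>x. c * sin (t \<bullet> x) * (p x + q x))
        = (\<lambda>x. c * sin (t \<bullet> x) * p x + c * sin (t \<bullet> x) * q x)"
      by (simp_all add: ring_distribs)
    show ?case unfolding c s using add.IH by (intro conjI trig_polynomial.add) auto
  qed
  from assms(1) show ?thesis
  proof (induction p)
    case (add p r)
    have "(\<lambda>x. (p x + r x) * q x) = (\<lambda>x. p x * q x + r x * q x)" by (simp add: ring_distribs)
    then show ?case using trig_polynomial.add[OF add.IH] by simp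
  qed (simp_all add: mono)
qed

lemma trig_polynomial_continuous: "trig_polynomial p \<Longrightarrow> continuous_on S p"
  by (induction rule: trig_polynomial.induct) (auto intro!: continuous_intros)

lemma trig_polynomial_bounded: "trig_polynomial p \<Longrightarrow> \<exists>C. \<forall>x. \<bar>p x\<bar> \<le> C"
proof (induction rule: trig_polynomial.induct)
  case (cos c t)
  have "\<bar>c * cos (t \<bullet> x)\<bar> \<le> \<bar>c\<bar>" for x by (simp add: abs_mult mult_left_le)
  then show ?case by blast
next
  case (sin c t)
  have "\<bar>c * sin (t \<bullet> x)\<bar> \<le> \<bar>c\<bar>" for x by (simp add: abs_mult mult_left_le)
  then show ?case by blast
next
  case (add p q)
  then obtain C D where "\<And>x. \<bar>p x\<bar> \<le> C" "\<And>x. \<bar>q x\<bar> \<le> D" by blast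
  then have "\<bar>p x + q x\<bar> \<le> C + D" for x by (meson abs_triangle_ineq add_mono order_trans)
  then show ?case by blast
qed

lemma trig_polynomial_compose_polynomial:
  assumes "real_polynomial_function g" and p: "trig_polynomial p"
  shows "trig_polynomial (\<lambda>x. g (p x))"
  using assms(1)
proof (induction rule: real_polynomial_function.induct)
  case (linear g)
  then obtain c where "g = (\<lambda>y. y * c)" by (auto simp: real_bounded_linear)
  then show ?case
    using trig_polynomial_mult[OF p trig_polynomial_const[of c]] by simp
next
  case (const c)
  show ?case by (rule trig_polynomial_const)
next
  case (add g h)
  show ?case by (rule trig_polynomial.add[OF add.IH])
next
  case (mult g h)
  show ?case by (rule trig_polynomial_mult[OF mult.IH])
qed

text \<open>
  Stone-Weierstrass applies because distinct points \<open>x\<close>, \<open>y\<close> are separated: for a frequency \<open>t\<close> with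
  \<open>t \<bullet> (x - y) = \<pi>\<close> both the cosine and the sine change sign, and they do not both vanish.
\<close>
lemma trig_polynomial_approximates_on_ball:
  fixes f :: "'a::euclidean_space \<Rightarrow> real"
  assumes "continuous_on UNIV f" and "0 < e"
  obtains p where "trig_polynomial p" and "\<And>x. norm x \<le> R \<Longrightarrow> \<bar>f x - p x\<bar> < e"
proof -
  interpret function_ring_on "Collect trig_polynomial :: ('a \<Rightarrow> real) set" "cball 0 R"
  proof
    fix x y :: 'a assume ne: "x \<noteq> y"
    define t where "t = (pi / ((x - y) \<bullet> (x - y))) *\<^sub>R (x - y)"
    have "t \<bullet> (x - y) = pi" using ne by (simp add: t_def)
    then have tx: "t \<bullet> x = t \<bullet> y + pi" by (simp add: inner_diff_right)
    have "cos (t \<bullet> y) \<noteq> 0 \<or> sin (t \<bullet> y) \<noteq> 0" by (metis sin_zero_abs_cos_one abs_zero zero_neq_one)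
    then have "1 * cos (t \<bullet> x) \<noteq> 1 * cos (t \<bullet> y) \<or> 1 * sin (t \<bullet> x) \<noteq> 1 * sin (t \<bullet> y)" by (auto simp: tx)
    then show "\<exists>f\<in>Collect trig_polynomial. f x \<noteq> f y"
    proof
      assume "1 * cos (t \<bullet> x) \<noteq> 1 * cos (t \<bullet> y)"
      then show ?thesis
        by (intro bexI[of _ "\<lambda>x. 1 * cos (t \<bullet> x)"] CollectI trig_polynomial.cos)
    next
      assume "1 * sin (t \<bullet> x) \<noteq> 1 * sin (t \<bullet> y)"
      then show ?thesis
        by (intro bexI[of _ "\<lambda>x. 1 * sin (t \<bullet> x)"] CollectI trig_polynomial.sin)
    qed
  next
    fix f :: "'a \<Rightarrow> real" assume "f \<in> Collect trig_polynomial"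
    then show "continuous_on (cball 0 R) f" by (simp add: trig_polynomial_continuous)
  next
    fix f g :: "'a \<Rightarrow> real" assume "f \<in> Collect trig_polynomial" "g \<in> Collect trig_polynomial"
    then show "(\<lambda>x. f x + g x) \<in> Collect trig_polynomial" "(\<lambda>x. f x * g x) \<in> Collect trig_polynomial"
      by (simp_all only: mem_Collect_eq trig_polynomial.add trig_polynomial_mult)
  next
    fix c show "(\<lambda>_. c) \<in> Collect (trig_polynomial :: ('a \<Rightarrow> real) \<Rightarrow> bool)"
      by (simp only: mem_Collect_eq trig_polynomial_const)
  qed simp
  have "continuous_on (cball 0 R) f" using assms(1) continuous_on_subset by blast
  from Stone_Weierstrass_basic[OF this assms(2)] obtain p
    where "p \<in> Collect trig_polynomial" "\<forall>x\<in>cball 0 R. \<bar>f x - p x\<bar> < e" by blast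
  then show thesis by (intro that[of p]) (simp_all add: dist_norm)
qed

text \<open>
  Outside the ball the approximant may be much larger than \<open>f\<close>, which would spoil the estimate of
  integrals. Clipping it to \<open>[-B, B]\<close> cures this, and by Weierstrass the clipping function is
  close to a polynomial on the range of the approximant, so the result is again trigonometric.
\<close>
lemma bounded_trig_polynomial_approximates_on_ball:
  fixes f :: "'a::euclidean_space \<Rightarrow> real"
  assumes f: "continuous_on UNIV f" and B: "\<And>x. \<bar>f x\<bar> \<le> B" and e: "0 < e"
  obtains q where "trig_polynomial q" and "\<And>x. norm x \<le> R \<Longrightarrow> \<bar>f x - q x\<bar> < 2 * e"
    and "\<And>x. \<bar>f x - q x\<bar> < 2 * B + e"
proof -
  obtain p where p: "trig_polynomial p" and fp: "\<And>x. norm x \<le> R \<Longrightarrow> \<bar>f x - p x\<bar> < e"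
    using trig_polynomial_approximates_on_ball[OF f e] by metis
  obtain C where C: "\<And>x. \<bar>p x\<bar> \<le> C" using trig_polynomial_bounded[OF p] by blast
  \<comment> \<open>clipping does not move values of \<open>p\<close> away from those of \<open>f\<close>, because \<open>\<bar>f x\<bar> \<le> B\<close>\<close>
  define clip where "clip y = max (- B) (min B y)" for y
  have "continuous_on {-C..C} clip" unfolding clip_def by (intro continuous_intros)
  then obtain g where g: "real_polynomial_function g" and gc: "\<And>y. y \<in> {-C..C} \<Longrightarrow> \<bar>clip y - g y\<bar> < e"
    using Stone_Weierstrass_real_polynomial_function[of "{-C..C}" clip e] e by auto
  have B0: "0 \<le> B" using B[of 0] by simp
  have near: "\<bar>clip (p x) - g (p x)\<bar> < e" for x using gc C[of x] by (auto simp: abs_le_iff)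
  have clip: "\<bar>f x - clip (p x)\<bar> \<le> \<bar>f x - p x\<bar>" for x using B[of x] by (auto simp: clip_def)
  have "\<bar>f x - g (p x)\<bar> < 2 * e" if "norm x \<le> R" for x
    using clip[of x] near[of x] fp[OF that] by linarith
  moreover have "\<bar>f x - g (p x)\<bar> < 2 * B + e" for x
  proof -
    have "\<bar>clip (p x)\<bar> \<le> B" using B0 by (auto simp: clip_def)
    then show ?thesis using near[of x] B[of x] by linarith
  qed
  ultimately show thesis by (rule that[OF trig_polynomial_compose_polynomial[OF g p]])
qed

lemma integral_diff_le_tail:
  fixes f q :: "'a::euclidean_space \<Rightarrow> real"
  assumes "prob_space \<nu>" and sets[measurable_cong]: "sets \<nu> = sets borel"
    and [measurable]: "f \<in> borel_measurable borel" "q \<in> borel_measurable borel"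
    and "integrable \<nu> f" "integrable \<nu> q"
    and near: "\<And>x. norm x \<le> R \<Longrightarrow> \<bar>f x - q x\<bar> \<le> a" and all: "\<And>x. \<bar>f x - q x\<bar> \<le> b" and "0 \<le> a"
  shows "\<bar>(\<integral>x. f x \<partial>\<nu>) - (\<integral>x. q x \<partial>\<nu>)\<bar> \<le> a + b * measure \<nu> {x. R < norm x}"
proof -
  interpret prob_space \<nu> by fact
  have sp: "space \<nu> = UNIV" using sets_eq_imp_space_eq[OF sets] by simp
  have [measurable]: "{x. R < norm x} \<in> sets \<nu>" using sets by simp
  have "\<bar>(\<integral>x. f x \<partial>\<nu>) - (\<integral>x. q x \<partial>\<nu>)\<bar> = \<bar>\<integral>x. f x - q x \<partial>\<nu>\<bar>"
    using assms by simp
  also have "\<dots> \<le> (\<integral>x. \<bar>f x - q x\<bar> \<partial>\<nu>)" by (rule integral_abs_bound)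
  also have "\<dots> \<le> (\<integral>x. a + b * indicator {x. R < norm x} x \<partial>\<nu>)"
  proof (rule integral_mono)
    show "integrable \<nu> (\<lambda>x. \<bar>f x - q x\<bar>)" using assms by auto
    show "integrable \<nu> (\<lambda>x. a + b * indicator {x. R < norm x} x)"
      by (intro Bochner_Integration.integrable_add integrable_mult_right integrable_real_indicator)
        (auto simp: less_top[symmetric] sets)
    show "\<bar>f x - q x\<bar> \<le> a + b * indicator {x. R < norm x} x" for x
      using near[of x] all[of x] \<open>0 \<le> a\<close> by (auto simp: indicator_def not_less)
  qed
  also have "\<dots> = a + b * measure \<nu> {x. R < norm x}"
    by (subst Bochner_Integration.integral_add) (auto simp: sp prob_space[unfolded sp] sets less_top[symmetric])
  finally show ?thesis .
qed

lemma tight_single: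
  fixes \<mu> :: "'a::euclidean_space measure"
  assumes "prob_space \<mu>" and sets: "sets \<mu> = sets borel" and e: "0 < e"
  obtains R :: real where "measure \<mu> {x. R < norm x} < e"
proof -
  interpret prob_space \<mu> by fact
  have "(\<lambda>n. measure \<mu> {x. real n < norm x}) \<longlonglongrightarrow> measure \<mu> (\<Inter>n. {x. real n < norm x})"
    by (intro finite_Lim_measure_decseq) (auto simp: decseq_def sets)
  moreover have "(\<Inter>n. {x::'a. real n < norm x}) = {}"
  proof -
    have "\<not> (\<forall>n. real n < norm x)" for x :: 'a using reals_Archimedean2[of "norm x"] less_asym by blast
    then show ?thesis by auto
  qed
  ultimately have "(\<lambda>n. measure \<mu> {x. real n < norm x}) \<longlonglongrightarrow> 0" by simp
  then have "\<forall>\<^sub>F n in sequentially. measure \<mu> {x. real n < norm x} < e"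
    using e by (rule order_tendstoD)
  then show thesis using that by (meson eventually_happens' sequentially_bot)
qed

lemma trig_polynomial_integral_converges:
  fixes \<nu> :: "nat \<Rightarrow> 'a::euclidean_space measure"
  assumes prob: "\<And>N. prob_space (\<nu> N)" "prob_space \<mu>"
    and sets: "\<And>N. sets (\<nu> N) = sets borel" "sets \<mu> = sets borel"
    and char: "\<And>t. (\<lambda>N. CLINT x|\<nu> N. iexp (t \<bullet> x)) \<longlonglongrightarrow> (CLINT x|\<mu>. iexp (t \<bullet> x))"
    and p: "trig_polynomial p"
  shows "(\<lambda>N. \<integral>x. p x \<partial>\<nu> N) \<longlonglongrightarrow> (\<integral>x. p x \<partial>\<mu>)"
proof -
  have int: "integrable \<nu>' (\<lambda>x. iexp (t \<bullet> x))" "integrable \<nu>' r"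
    if "prob_space \<nu>'" "sets \<nu>' = sets borel" and r: "trig_polynomial r" for \<nu>' :: "'a measure" and t r
  proof -
    interpret prob_space \<nu>' by fact
    have [measurable_cong]: "sets \<nu>' = sets borel" by fact
    show "integrable \<nu>' (\<lambda>x. iexp (t \<bullet> x))"
      by (rule integrable_const_bound[where B=1]) auto
    obtain C where C: "\<And>x. \<bar>r x\<bar> \<le> C" using trig_polynomial_bounded[OF r] by blast
    have [measurable]: "r \<in> borel_measurable borel"
      using trig_polynomial_continuous[OF r] by (rule borel_measurable_continuous_onI)
    show "integrable \<nu>' r" by (rule integrable_const_bound[where B=C]) (use C in auto)
  qed
  from p show ?thesis
  proof (induction rule: trig_polynomial.induct)
    case (cos c t)
    have *: "(\<integral>x. c * cos (t \<bullet> x) \<partial>\<nu>') = c * Re (CLINT x|\<nu>'. iexp (t \<bullet> x))"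
      if "prob_space \<nu>'" "sets \<nu>' = sets borel" for \<nu>' :: "'a measure"
      using integral_Re[OF int(1)[OF that trig_polynomial_const], of t] by (simp add: Re_exp)
    show ?case unfolding *[OF prob(1) sets(1)] *[OF prob(2) sets(2)]
      by (intro tendsto_intros char)
  next
    case (sin c t)
    have *: "(\<integral>x. c * sin (t \<bullet> x) \<partial>\<nu>') = c * Im (CLINT x|\<nu>'. iexp (t \<bullet> x))"
      if "prob_space \<nu>'" "sets \<nu>' = sets borel" for \<nu>' :: "'a measure"
      using integral_Im[OF int(1)[OF that trig_polynomial_const], of t] by (simp add: Im_exp)
    show ?case unfolding *[OF prob(1) sets(1)] *[OF prob(2) sets(2)]
      by (intro tendsto_intros char)
  next
    case (add p q)
    then show ?case using int(2)[OF prob(1) sets(1)] int(2)[OF prob(2) sets(2)]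
      by (auto intro!: tendsto_intros)
  qed
qed

text \<open>
  A form of Levy's continuity theorem in any dimension: convergence of the integrals of
  trigonometric polynomials is immediate, and tightness controls the region where a bounded
  continuous function is not well approximated by one of them.
\<close>
theorem weakly_converges_if_char_converges:
  fixes \<nu> :: "nat \<Rightarrow> 'a::euclidean_space measure"
  assumes prob: "\<And>N. prob_space (\<nu> N)" "prob_space \<mu>"
    and sets: "\<And>N. sets (\<nu> N) = sets borel" "sets \<mu> = sets borel"
    and tight: "\<And>e. 0 < e \<Longrightarrow> \<exists>R. \<forall>\<^sub>F N in sequentially. measure (\<nu> N) {x. R < norm x} < e"
    and char: "\<And>t. (\<lambda>N. CLINT x|\<nu> N. iexp (t \<bullet> x)) \<longlonglongrightarrow> (CLINT x|\<mu>. iexp (t \<bullet> x))"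
  shows "weakly_converges \<nu> \<mu>"
  unfolding weakly_converges_def
proof (intro allI impI, elim conjE)
  fix f :: "'a \<Rightarrow> real" assume f: "continuous_on UNIV f" and "bounded (range f)"
  then obtain B where B: "\<And>x. \<bar>f x\<bar> \<le> B" by (auto simp: bounded_iff)
  have B0: "0 \<le> B" using B[of 0] by simp
  have tail_mono: "measure \<nu>' {x. R' < norm x} < e"
    if "prob_space \<nu>'" "sets \<nu>' = sets borel" "measure \<nu>' {x. R < norm x} < e" "R \<le> R'" for \<nu>' :: "'a measure" and R R' e
  proof -
    interpret prob_space \<nu>' by fact
    have "measure \<nu>' {x. R' < norm x} \<le> measure \<nu>' {x. R < norm x}"
      by (rule finite_measure_mono) (use that in auto)
    then show ?thesis using that by simp
  qed
  show "(\<lambda>N. \<integral>x. f x \<partial>\<nu> N) \<longlonglongrightarrow> (\<integral>x. f x \<partial>\<mu>)"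
  proof (rule tendstoI)
    fix \<eta> :: real assume \<eta>: "0 < \<eta>"
    \<comment> \<open>two replacements of \<open>f\<close> by \<open>q\<close> cost \<open>e * (3 + 2 * B)\<close> each, the convergence for \<open>q\<close> costs \<open>e\<close>\<close>
    define e where "e = min 1 (\<eta> / (2 * (3 + 2 * B) + 1))"
    have "e \<le> \<eta> / (2 * (3 + 2 * B) + 1)" by (simp add: e_def)
    then have e: "0 < e" "e \<le> 1" "e * (2 * (3 + 2 * B) + 1) \<le> \<eta>"
      using \<eta> B0 by (simp_all add: pos_le_divide_eq) (simp_all add: e_def)
    obtain R1 where R1: "\<forall>\<^sub>F N in sequentially. measure (\<nu> N) {x. R1 < norm x} < e" using tight e by blast
    obtain R2 where R2: "measure \<mu> {x. R2 < norm x} < e" using tight_single prob(2) sets(2) e by metis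
    define R where "R = max R1 R2"
    obtain q where q: "trig_polynomial q" and near: "\<And>x. norm x \<le> R \<Longrightarrow> \<bar>f x - q x\<bar> < 2 * e"
      and all: "\<And>x. \<bar>f x - q x\<bar> < 2 * B + e"
      using bounded_trig_polynomial_approximates_on_ball[OF f B e(1)] by metis
    have [measurable]: "f \<in> borel_measurable borel" "q \<in> borel_measurable borel"
      using f trig_polynomial_continuous[OF q] by (auto intro: borel_measurable_continuous_onI)
    have close: "\<bar>(\<integral>x. f x \<partial>\<nu>') - (\<integral>x. q x \<partial>\<nu>')\<bar> \<le> e * (3 + 2 * B)"
      if "prob_space \<nu>'" "sets \<nu>' = sets borel" "measure \<nu>' {x. R < norm x} < e" for \<nu>' :: "'a measure"
    proof -
      interpret prob_space \<nu>' by fact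
      have [measurable_cong]: "sets \<nu>' = sets borel" by fact
      have If: "integrable \<nu>' f" by (rule integrable_const_bound[where B=B]) (use B in auto)
      have "\<bar>q x\<bar> \<le> 3 * B + e" for x using all[of x] B[of x] by linarith
      then have Iq: "integrable \<nu>' q" by (intro integrable_const_bound[where B="3 * B + e"]) auto
      have "\<bar>(\<integral>x. f x \<partial>\<nu>') - (\<integral>x. q x \<partial>\<nu>')\<bar> \<le> 2 * e + (2 * B + e) * measure \<nu>' {x. R < norm x}"
        by (rule integral_diff_le_tail[OF that(1,2) _ _ If Iq]) (use near all e in \<open>auto intro: less_imp_le\<close>)
      also have "\<dots> \<le> 2 * e + (2 * B + 1) * e"
        using that(3) e B0 by (intro add_left_mono mult_mono) auto
      finally show ?thesis by (simp add: algebra_simps)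
    qed
    have "\<forall>\<^sub>F N in sequentially. measure (\<nu> N) {x. R < norm x} < e"
      using R1 by eventually_elim (rule tail_mono[OF prob(1) sets(1)], auto simp: R_def)
    moreover have "\<forall>\<^sub>F N in sequentially. dist (\<integral>x. q x \<partial>\<nu> N) (\<integral>x. q x \<partial>\<mu>) < e"
      using trig_polynomial_integral_converges[OF prob sets char q] e(1) by (rule tendstoD)
    ultimately show "\<forall>\<^sub>F N in sequentially. dist (\<integral>x. f x \<partial>\<nu> N) (\<integral>x. f x \<partial>\<mu>) < \<eta>"
    proof eventually_elim
      case (elim N)
      have "measure \<mu> {x. R < norm x} < e"
        by (rule tail_mono[OF prob(2) sets(2) R2]) (simp add: R_def)
      from close[OF prob(1) sets(1) elim(1)] close[OF prob(2) sets(2) this] elim(2) e(3)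
      show ?case unfolding dist_real_def by (simp add: algebra_simps)
    qed
  qed
qed

section \<open>Centered normal distributions with a given covariance matrix\<close>

definition positive_semidefinite :: "real ^ 'd ^ 'd::finite \<Rightarrow> bool" where
  "positive_semidefinite Q \<longleftrightarrow> transpose Q = Q \<and> (\<forall>t. 0 \<le> t \<bullet> (Q *v t))"

lemma symmetric_matrix_entry: "transpose Q = Q \<Longrightarrow> Q $ i $ j = Q $ j $ i"
  by (metis transpose_def vec_lambda_beta)

lemma quadratic_form_add_axis:
  fixes Q :: "real ^ 'd ^ 'd::finite"
  assumes "transpose Q = Q"
  shows "(t + l *\<^sub>R axis i 1) \<bullet> (Q *v (t + l *\<^sub>R axis i 1))
    = t \<bullet> (Q *v t) + 2 * l * (Q $ i \<bullet> t) + l\<^sup>2 * Q $ i $ i"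
proof -
  have row: "axis i 1 \<bullet> (Q *v s) = Q $ i \<bullet> s" for s
    by (simp add: inner_axis' matrix_vector_mul_component)
  have col: "s \<bullet> (Q *v axis i 1) = Q $ i \<bullet> s" for s
    using row[of s] assms by (metis dot_lmul_matrix inner_commute transpose_matrix_vector)
  have "Q $ i \<bullet> axis i 1 = Q $ i $ i" by (simp add: inner_axis)
  then show ?thesis
    by (simp add: matrix_vector_right_distrib matrix_vector_mult_scaleR inner_add_left
        inner_add_right row col power2_eq_square algebra_simps)
qed

lemma positive_semidefinite_diag_nonneg:
  assumes "positive_semidefinite Q"
  shows "0 \<le> Q $ i $ i"
  using quadratic_form_add_axis[of Q 0 1 i] assms
  by (simp add: positive_semidefinite_def) (metis scaleR_one)

text \<open>
  In direction \<open>i\<close> the form restricted to a line has no quadratic term; it stays nonnegative only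
  if it is constant along every such line, so that the whole row vanishes.
\<close>
lemma positive_semidefinite_zero_diag:
  assumes psd: "positive_semidefinite Q" and zero: "Q $ i $ i = 0"
  shows "Q $ i $ j = 0"
proof (rule ccontr)
  assume ne: "Q $ i $ j \<noteq> 0"
  \<comment> \<open>along the line through \<open>j\<close> in direction \<open>i\<close> the form is affine, and here it takes the value \<open>- 1\<close>\<close>
  define l where "l = - (Q $ j $ j + 1) / (2 * Q $ i $ j)"
  have "axis j 1 \<bullet> (Q *v axis j 1) = Q $ j $ j"
    by (simp only: inner_axis' inner_axis matrix_vector_mul_component) simp
  moreover have "Q $ i \<bullet> axis j 1 = Q $ i $ j" by (simp add: inner_axis)
  ultimately have "0 \<le> Q $ j $ j + 2 * l * Q $ i $ j"
    using quadratic_form_add_axis[of Q "axis j 1" l i] psd zero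
    by (metis (no_types, lifting) add.right_neutral mult_zero_right positive_semidefinite_def)
  also have "\<dots> = - 1" using ne by (simp add: l_def field_simps)
  finally show False by simp
qed

lemma quadratic_form_minus_square:
  fixes Q :: "real ^ 'd ^ 'd::finite"
  assumes "transpose Q = Q"
  shows "t \<bullet> ((\<chi> p q. Q $ p $ q - Q $ p $ i * Q $ i $ q / c) *v t)
    = t \<bullet> (Q *v t) - (Q $ i \<bullet> t)\<^sup>2 / c"
proof -
  have "(\<Sum>p\<in>UNIV. t $ p * (\<Sum>q\<in>UNIV. Q $ p $ i * Q $ i $ q / c * t $ q))
      = (\<Sum>p\<in>UNIV. Q $ i $ p * t $ p) * (\<Sum>q\<in>UNIV. Q $ i $ q * t $ q) / c"
    unfolding sum_product
    by (simp add: sum_distrib_left sum_divide_distrib symmetric_matrix_entry[OF assms, of _ i] ac_simps)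
  then show ?thesis
    by (simp add: inner_vec_def matrix_vector_mult_def left_diff_distrib sum_subtractf
        right_diff_distrib power2_eq_square)
qed

text \<open>
  Completing the square in coordinate \<open>i\<close> splits off one square and leaves a form that is still
  positive semidefinite, has a zero diagonal entry at \<open>i\<close> and keeps the earlier zeros. When the
  diagonal has vanished, so has the form.
\<close>
lemma positive_semidefinite_sum_squares_on:
  fixes Q :: "real ^ 'd ^ 'd::finite"
  assumes "finite Z" and "positive_semidefinite Q" and "\<And>i. i \<notin> Z \<Longrightarrow> Q $ i $ i = 0"
  shows "\<exists>a. \<forall>t. t \<bullet> (Q *v t) = (\<Sum>i\<in>Z. (a i \<bullet> t)\<^sup>2)"
  using assms
proof (induction Z arbitrary: Q)
  case empty
  then have "Q $ i $ j = 0" for i j using positive_semidefinite_zero_diag by blast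
  then have "Q = 0" by (simp add: vec_eq_iff)
  then show ?case by simp
next
  case (insert i Z)
  show ?case
  proof (cases "Q $ i $ i = 0")
    case True
    have "Q $ j $ j = 0" if "j \<notin> Z" for j
      using that True insert.prems(2)[of j] by (cases "j = i") auto
    from insert.IH[OF insert.prems(1) this] obtain a where a: "\<And>t. t \<bullet> (Q *v t) = (\<Sum>i\<in>Z. (a i \<bullet> t)\<^sup>2)" by blast
    have "(\<Sum>j\<in>insert i Z. ((a(i := 0)) j \<bullet> t)\<^sup>2) = (\<Sum>i\<in>Z. (a i \<bullet> t)\<^sup>2)" for t
      using insert.hyps by (auto intro!: sum.cong)
    with a show ?thesis by metis
  next
    case False
    define c where "c = Q $ i $ i"
    have c: "0 < c"
      using positive_semidefinite_diag_nonneg[OF insert.prems(1), of i] False by (simp add: c_def)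
    have sym: "transpose Q = Q" and nonneg: "\<And>t. 0 \<le> t \<bullet> (Q *v t)"
      using insert.prems(1) by (auto simp: positive_semidefinite_def)
    define Q' where "Q' = (\<chi> p q. Q $ p $ q - Q $ p $ i * Q $ i $ q / c)"
    have form: "t \<bullet> (Q' *v t) = t \<bullet> (Q *v t) - (Q $ i \<bullet> t)\<^sup>2 / c" for t
      unfolding Q'_def by (rule quadratic_form_minus_square[OF sym])
    have "0 \<le> t \<bullet> (Q' *v t)" for t
    proof -
      \<comment> \<open>the minimum of the form along the line through \<open>t\<close> in direction \<open>i\<close>\<close>
      have "0 \<le> t \<bullet> (Q *v t) + 2 * (- (Q $ i \<bullet> t) / c) * (Q $ i \<bullet> t) + (- (Q $ i \<bullet> t) / c)\<^sup>2 * c"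
        using nonneg quadratic_form_add_axis[OF sym] unfolding c_def by metis
      also have "\<dots> = t \<bullet> (Q' *v t)"
        using c by (simp add: form power2_eq_square)
      finally show ?thesis .
    qed
    moreover have "transpose Q' = Q'"
      using symmetric_matrix_entry[OF sym]
      by (auto simp: Q'_def transpose_def vec_eq_iff mult.commute)
    ultimately have "positive_semidefinite Q'" by (simp add: positive_semidefinite_def)
    moreover have "Q' $ j $ j = 0" if "j \<notin> Z" for j
    proof (cases "j = i")
      case True then show ?thesis using c by (simp add: Q'_def c_def)
    next
      case False
      then have "Q $ j $ j = 0" using insert.prems(2) that by simp
      then show ?thesis using positive_semidefinite_zero_diag[OF insert.prems(1)] by (simp add: Q'_def)
    qed
    ultimately obtain a where a: "\<And>t. t \<bullet> (Q' *v t) = (\<Sum>i\<in>Z. (a i \<bullet> t)\<^sup>2)"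
      using insert.IH by blast
    have "t \<bullet> (Q *v t) = (\<Sum>j\<in>insert i Z. ((a(i := Q $ i /\<^sub>R sqrt c)) j \<bullet> t)\<^sup>2)" for t
    proof -
      have "(\<Sum>j\<in>Z. ((a(i := Q $ i /\<^sub>R sqrt c)) j \<bullet> t)\<^sup>2) = t \<bullet> (Q' *v t)"
        unfolding a using insert.hyps by (intro sum.cong) auto
      then show ?thesis using insert.hyps c
        by (simp add: form power_mult_distrib field_simps)
    qed
    then show ?thesis by blast
  qed
qed

text \<open>
  With the form of \<open>\<Sigma>\<close> written as \<open>\<Sum>i. (a i \<bullet> t)\<^sup>2\<close>, the vector \<open>\<Sum>i. z i *\<^sub>R a i\<close> with independent standard
  normal coefficients has the required characteristic function. Singular \<open>\<Sigma>\<close> are included.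
\<close>
theorem centered_normal_exists:
  fixes \<Sigma> :: "real ^ 'd ^ 'd::finite"
  assumes "positive_semidefinite \<Sigma>"
  shows "\<exists>\<mu>. centered_normal \<Sigma> \<mu>"
proof -
  have "\<exists>a. \<forall>t. t \<bullet> (\<Sigma> *v t) = (\<Sum>i\<in>(UNIV :: 'd set). (a i \<bullet> t)\<^sup>2)"
    by (rule positive_semidefinite_sum_squares_on) (simp_all add: assms)
  then obtain a where a: "\<And>t. t \<bullet> (\<Sigma> *v t) = (\<Sum>i\<in>(UNIV :: 'd set). (a i \<bullet> t)\<^sup>2)" by blast
  let ?P = "\<Pi>\<^sub>M i\<in>(UNIV::'d set). std_normal_distribution"
  interpret N: prob_space std_normal_distribution by (rule prob_space_normal_density) simp
  interpret P: product_prob_space "\<lambda>_::'d. std_normal_distribution" UNIV ..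
  define L where "L z = (\<Sum>i\<in>UNIV. z i *\<^sub>R a i)" for z :: "'d \<Rightarrow> real"
  have L[measurable]: "L \<in> borel_measurable ?P" unfolding L_def by measurable
  have "(CLINT x|distr ?P borel L. iexp (t \<bullet> x)) = complex_of_real (exp (- (t \<bullet> (\<Sigma> *v t)) / 2))" for t
  proof -
    have "(CLINT x|distr ?P borel L. iexp (t \<bullet> x)) = (CLINT z|?P. iexp (t \<bullet> L z))"
      by (rule integral_distr) auto
    also have "\<dots> = (CLINT z|?P. (\<Prod>i\<in>UNIV. iexp ((a i \<bullet> t) * z i)))"
      by (simp add: L_def inner_sum_right exp_sum[symmetric] sum_distrib_left of_real_sum
          inner_commute mult.commute del: of_real_mult)
    also have "\<dots> = (\<Prod>i\<in>UNIV. CLINT x|std_normal_distribution. iexp ((a i \<bullet> t) * x))"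
      by (rule P.product_integral_prod) (auto intro!: N.integrable_iexp)
    also have "\<dots> = (\<Prod>i\<in>UNIV. complex_of_real (exp (- ((a i \<bullet> t)\<^sup>2) / 2)))"
      using char_std_normal_distribution by (simp add: char_def fun_eq_iff)
    also have "\<dots> = complex_of_real (exp (- (t \<bullet> (\<Sigma> *v t)) / 2))"
      unfolding a of_real_prod[symmetric] exp_sum[OF finite_class.finite_UNIV, symmetric]
      by (simp add: sum_divide_distrib sum_negf)
    finally show ?thesis .
  qed
  moreover have "prob_space (distr ?P borel L)" by (rule P.prob_space_distr) simp
  ultimately have "centered_normal \<Sigma> (distr ?P borel L)"
    using assms by (simp add: centered_normal_def positive_semidefinite_def)
  then show ?thesis ..
qed

section \<open>Change of variables\<close>

interpretation lborel_product: product_sigma_finite "\<lambda>_. lborel :: real measure" ..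

lemma prod_Basis_vec: "(\<Prod>b\<in>Basis. f b) = (\<Prod>i\<in>UNIV. f (axis i 1 :: real ^ 'n::finite))"
proof -
  have "bij_betw (\<lambda>i. axis i 1 :: real ^ 'n) UNIV Basis"
    by (auto simp: bij_betw_def inj_on_def axis_eq_axis Basis_vec_def)
  then show ?thesis by (rule prod.reindex_bij_betw[symmetric])
qed

lemma measurable_vec_lambda_PiM [measurable]:
  "vec_lambda \<in> borel_measurable (\<Pi>\<^sub>M i\<in>(UNIV::'n::finite set). (lborel :: real measure))"
  by (rule borel_measurable_vecI) simp

lemma lborel_vec_eq_PiM:
  "lborel = distr (\<Pi>\<^sub>M i\<in>(UNIV::'n::finite set). lborel) borel (vec_lambda :: _ \<Rightarrow> real ^ 'n)"
proof (rule lborel_eqI)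
  fix l u :: "real ^ 'n" assume lu: "\<And>b. b \<in> Basis \<Longrightarrow> l \<bullet> b \<le> u \<bullet> b"
  then have le: "l $ i \<le> u $ i" for i
    using lu[of "axis i 1"] by (simp add: inner_axis axis_in_Basis_iff)
  have "vec_lambda -` box l u \<inter> space (\<Pi>\<^sub>M i\<in>(UNIV::'n set). lborel) = (\<Pi>\<^sub>E i\<in>UNIV. {l $ i<..<u $ i})"
    by (auto simp: mem_box_cart space_PiM PiE_iff)
  then have "emeasure (distr (\<Pi>\<^sub>M i\<in>(UNIV::'n set). lborel) borel vec_lambda) (box l u)
      = (\<Prod>i\<in>UNIV. emeasure lborel {l $ i<..<u $ i})"
    by (simp add: emeasure_distr lborel_product.emeasure_PiM)
  also have "\<dots> = ennreal (\<Prod>b\<in>Basis. (u - l) \<bullet> b)"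
    using le by (simp add: prod_Basis_vec inner_axis prod_ennreal)
  finally show "emeasure (distr (\<Pi>\<^sub>M i\<in>(UNIV::'n set). lborel) borel vec_lambda) (box l u)
      = ennreal (\<Prod>b\<in>Basis. (u - l) \<bullet> b)" .
qed simp

definition partial_sums :: "'k::linorder set \<Rightarrow> ('k \<Rightarrow> real) \<Rightarrow> 'k \<Rightarrow> real" where
  "partial_sums I y = (\<lambda>i\<in>I. \<Sum>j\<in>{j\<in>I. j \<le> i}. y j)"

lemma measurable_partial_sums [measurable]:
  "partial_sums I \<in> measurable (\<Pi>\<^sub>M i\<in>I. lborel) (\<Pi>\<^sub>M i\<in>I. lborel)"
  unfolding partial_sums_def by measurable

text \<open>
  Adding the greatest index to the index set changes the map only in the new coordinate, and there
  by a translation for fixed values of the others; hence induction gives invariance of Lebesgue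
  measure.
\<close>
lemma nn_integral_partial_sums:
  assumes "finite I" and "f \<in> borel_measurable (\<Pi>\<^sub>M i\<in>I. lborel)"
  shows "(\<integral>\<^sup>+x. f x \<partial>(\<Pi>\<^sub>M i\<in>I. lborel)) = (\<integral>\<^sup>+y. f (partial_sums I y) \<partial>(\<Pi>\<^sub>M i\<in>I. lborel))"
  using assms
proof (induction I arbitrary: f rule: finite_linorder_max_induct)
  case empty
  have "partial_sums {} y = y" if "y \<in> space (\<Pi>\<^sub>M i\<in>({}::'a set). (lborel :: real measure))" for y
    using that by (auto simp: partial_sums_def space_PiM)
  then show ?case by (intro nn_integral_cong) simp
next
  case (insert b A)
  have b: "b \<notin> A" using insert.hyps by auto
  note [measurable] = insert.prems
  have upd: "partial_sums (insert b A) (y(b := t)) = (partial_sums A y)(b := sum y A + t)" for y t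
  proof
    fix i
    have "{j \<in> insert b A. j \<le> b} = insert b A" using insert.hyps by (auto intro: less_imp_le)
    moreover have "{j \<in> insert b A. j \<le> i} = {j \<in> A. j \<le> i}" if "i \<in> A"
      using insert.hyps that by (auto simp: not_le)
    moreover have "(\<Sum>j\<in>A'. (y(b := t)) j) = sum y A'" if "A' \<subseteq> A" for A'
      using b that by (intro sum.cong) auto
    ultimately show "partial_sums (insert b A) (y(b := t)) i = ((partial_sums A y)(b := sum y A + t)) i"
      using b insert.hyps(1) by (auto simp: partial_sums_def)
  qed
  have "(\<integral>\<^sup>+x. f x \<partial>(\<Pi>\<^sub>M i\<in>insert b A. lborel))
      = (\<integral>\<^sup>+x. (\<integral>\<^sup>+t. f (x(b := t)) \<partial>lborel) \<partial>(\<Pi>\<^sub>M i\<in>A. lborel))"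
    by (rule lborel_product.product_nn_integral_insert) (use insert.hyps b in auto)
  also have "\<dots> = (\<integral>\<^sup>+y. (\<integral>\<^sup>+t. f ((partial_sums A y)(b := t)) \<partial>lborel) \<partial>(\<Pi>\<^sub>M i\<in>A. lborel))"
    by (rule insert.IH) measurable
  also have "\<dots> = (\<integral>\<^sup>+y. (\<integral>\<^sup>+t. f ((partial_sums A y)(b := sum y A + t)) \<partial>lborel) \<partial>(\<Pi>\<^sub>M i\<in>A. lborel))"
  proof (rule nn_integral_cong)
    fix y assume y: "y \<in> space (\<Pi>\<^sub>M i\<in>A. (lborel :: real measure))"
    have "partial_sums A y \<in> space (\<Pi>\<^sub>M i\<in>A. (lborel :: real measure))"
      using measurable_space[OF measurable_partial_sums y] .
    then have [measurable]: "(\<lambda>t. f ((partial_sums A y)(b := t))) \<in> borel_measurable borel"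
      by measurable
    show "(\<integral>\<^sup>+t. f ((partial_sums A y)(b := t)) \<partial>lborel)
        = (\<integral>\<^sup>+t. f ((partial_sums A y)(b := sum y A + t)) \<partial>lborel)"
      using nn_integral_real_affine[of "\<lambda>t. f ((partial_sums A y)(b := t))" 1 "sum y A"] by simp
  qed
  also have "\<dots> = (\<integral>\<^sup>+y. f (partial_sums (insert b A) y) \<partial>(\<Pi>\<^sub>M i\<in>insert b A. lborel))"
    unfolding upd[symmetric]
    by (rule lborel_product.product_nn_integral_insert[symmetric]) (use insert.hyps b in auto)
  finally show ?case .
qed

lemma nn_integral_scale_PiM:
  assumes "finite I" and "f \<in> borel_measurable (\<Pi>\<^sub>M i\<in>I. lborel)" and c: "0 < c"
  shows "(\<integral>\<^sup>+x. f x \<partial>(\<Pi>\<^sub>M i\<in>I. lborel))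
    = ennreal (c ^ card I) * (\<integral>\<^sup>+y. f (\<lambda>i\<in>I. c * y i) \<partial>(\<Pi>\<^sub>M i\<in>I. lborel))"
  using assms(1,2)
proof (induction I arbitrary: f)
  case empty
  have "(\<lambda>i\<in>{}. c * y i) = y" if "y \<in> space (\<Pi>\<^sub>M i\<in>({}::'a set). (lborel :: real measure))" for y :: "'a \<Rightarrow> real"
    using that by (auto simp: space_PiM)
  then have "(\<integral>\<^sup>+y. f (\<lambda>i\<in>{}. c * y i) \<partial>(\<Pi>\<^sub>M i\<in>({}::'a set). lborel)) = (\<integral>\<^sup>+x. f x \<partial>(\<Pi>\<^sub>M i\<in>{}. lborel))"
    by (intro nn_integral_cong) simp
  then show ?case by (simp only: card.empty power_0 ennreal_1 mult_1)
next
  case (insert b A)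
  note [measurable] = insert.prems
  have upd: "(\<lambda>i\<in>insert b A. c * (y(b := t)) i) = (\<lambda>i\<in>A. c * y i)(b := c * t)" for y :: "'a \<Rightarrow> real" and t
    using insert.hyps by (auto simp: fun_eq_iff)
  have "(\<integral>\<^sup>+x. f x \<partial>(\<Pi>\<^sub>M i\<in>insert b A. lborel))
      = (\<integral>\<^sup>+x. (\<integral>\<^sup>+t. f (x(b := t)) \<partial>lborel) \<partial>(\<Pi>\<^sub>M i\<in>A. lborel))"
    by (rule lborel_product.product_nn_integral_insert) (use insert.hyps in auto)
  also have "\<dots> = ennreal (c ^ card A) *
      (\<integral>\<^sup>+y. (\<integral>\<^sup>+t. f ((\<lambda>i\<in>A. c * y i)(b := t)) \<partial>lborel) \<partial>(\<Pi>\<^sub>M i\<in>A. lborel))"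
    by (rule insert.IH) measurable
  also have "(\<integral>\<^sup>+y. (\<integral>\<^sup>+t. f ((\<lambda>i\<in>A. c * y i)(b := t)) \<partial>lborel) \<partial>(\<Pi>\<^sub>M i\<in>A. lborel))
      = (\<integral>\<^sup>+y. ennreal c * (\<integral>\<^sup>+t. f ((\<lambda>i\<in>A. c * y i)(b := c * t)) \<partial>lborel) \<partial>(\<Pi>\<^sub>M i\<in>A. lborel))"
  proof (rule nn_integral_cong)
    fix y assume y: "y \<in> space (\<Pi>\<^sub>M i\<in>A. (lborel :: real measure))"
    have "(\<lambda>i\<in>A. c * y i) \<in> space (\<Pi>\<^sub>M i\<in>A. (lborel :: real measure))"
      by (auto simp: space_PiM)
    then have [measurable]: "(\<lambda>t. f ((\<lambda>i\<in>A. c * y i)(b := t))) \<in> borel_measurable borel"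
      by measurable
    show "(\<integral>\<^sup>+t. f ((\<lambda>i\<in>A. c * y i)(b := t)) \<partial>lborel)
        = ennreal c * (\<integral>\<^sup>+t. f ((\<lambda>i\<in>A. c * y i)(b := c * t)) \<partial>lborel)"
      using nn_integral_real_affine[of "\<lambda>t. f ((\<lambda>i\<in>A. c * y i)(b := t))" c 0] c by simp
  qed
  also have "\<dots> = ennreal c * (\<integral>\<^sup>+y. (\<integral>\<^sup>+t. f ((\<lambda>i\<in>A. c * y i)(b := c * t)) \<partial>lborel) \<partial>(\<Pi>\<^sub>M i\<in>A. lborel))"
    by (rule nn_integral_cmult) measurable
  also have "(\<integral>\<^sup>+y. (\<integral>\<^sup>+t. f ((\<lambda>i\<in>A. c * y i)(b := c * t)) \<partial>lborel) \<partial>(\<Pi>\<^sub>M i\<in>A. lborel))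
      = (\<integral>\<^sup>+y. f (\<lambda>i\<in>insert b A. c * y i) \<partial>(\<Pi>\<^sub>M i\<in>insert b A. lborel))"
    unfolding upd[symmetric]
    by (rule lborel_product.product_nn_integral_insert[symmetric]) (use insert.hyps in auto)
  finally show ?case
    using insert.hyps c
    by (simp add: mult.assoc[symmetric] ennreal_mult[symmetric] mult.commute del: restrict_apply)
qed

section \<open>The law of \<open>\<Delta>X / X\<^sub>k\<close> and \<open>X\<^sub>k\<close>\<close>

definition cumsum_vec :: "real ^ 'k::{finite,linorder} \<Rightarrow> real ^ 'k::{finite,linorder}" where
  "cumsum_vec w = (\<chi> i. \<Sum>j\<in>{..i}. w $ j)"

lemma le_last_ix [simp]: "i \<le> (last_ix :: 'k::{finite,linorder})"
  by (simp add: last_ix_def)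

lemma first_ix_le [simp]: "(first_ix :: 'k::{finite,linorder}) \<le> i"
  by (simp add: first_ix_def)

lemma atMost_last_ix [simp]: "{..last_ix} = (UNIV :: 'k::{finite,linorder} set)"
  by auto

lemma atMost_first_ix [simp]: "{..first_ix} = {first_ix :: 'k::{finite,linorder}}"
  by (auto intro: antisym)

lemma atMost_pred_ix:
  assumes "(i :: 'k::{finite,linorder}) \<noteq> first_ix"
  shows "{..pred_ix i} = {..<i}"
proof -
  have "first_ix < i" using assms first_ix_le[of i] by (simp add: order.not_eq_order_implies_strict)
  then have ne: "{j. j < i} \<noteq> {}" by blast
  have "pred_ix i < i" using Max_in[OF _ ne] by (simp add: pred_ix_def)
  moreover have "j \<le> pred_ix i" if "j < i" for j using that by (simp add: pred_ix_def)
  ultimately show ?thesis by auto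
qed

lemma cumsum_vec_last: "cumsum_vec w $ last_ix = (\<Sum>i\<in>UNIV. w $ i)"
  by (simp add: cumsum_vec_def)

lemma delta_cumsum_vec: "delta_vec (cumsum_vec w) = w"
proof -
  have "delta_vec (cumsum_vec w) $ i = w $ i" for i
  proof (cases "i = first_ix")
    case True
    then show ?thesis by (simp add: delta_vec_def cumsum_vec_def)
  next
    case False
    have "{..i} = insert i {..<i}" by auto
    then show ?thesis using False by (simp add: delta_vec_def cumsum_vec_def atMost_pred_ix[OF False])
  qed
  then show ?thesis by (simp add: vec_eq_iff)
qed

text \<open>The sum telescopes; the induction runs along the order of the indices by the size of \<open>{..i}\<close>.\<close>
lemma cumsum_delta_vec: "cumsum_vec (delta_vec x) = x"
proof -
  have "(\<Sum>j\<in>{..i}. delta_vec x $ j) = x $ i" for i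
  proof (induction "card {..i}" arbitrary: i rule: less_induct)
    case less
    show ?case
    proof (cases "i = first_ix")
      case True
      then show ?thesis by (simp add: delta_vec_def)
    next
      case False
      have eq: "{..i} = insert i {..pred_ix i}" unfolding atMost_pred_ix[OF False] by auto
      have "i \<notin> {..pred_ix i}" unfolding atMost_pred_ix[OF False] by simp
      moreover from this have "(\<Sum>j\<in>{..pred_ix i}. delta_vec x $ j) = x $ pred_ix i"
        by (intro less.hyps) (simp add: eq)
      ultimately show ?thesis unfolding eq using False by (simp add: delta_vec_def)
    qed
  qed
  then show ?thesis by (simp add: cumsum_vec_def vec_eq_iff)
qed

lemma delta_vec_scaleR: "delta_vec (c *\<^sub>R x) = c *\<^sub>R delta_vec x"
  by (auto simp: delta_vec_def vec_eq_iff algebra_simps)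

lemma last_eq_sum_delta: "x $ last_ix = (\<Sum>i\<in>UNIV. delta_vec x $ i)"
  using cumsum_vec_last[of "delta_vec x"] by (simp add: cumsum_delta_vec)

lemma mg_support_iff_delta:
  fixes x :: "real ^ 'k::{finite,linorder}"
  shows "x \<in> mg_support \<longleftrightarrow> (\<forall>i. 0 < delta_vec x $ i)"
proof
  assume x: "x \<in> mg_support"
  show "\<forall>i. 0 < delta_vec x $ i"
  proof
    fix i :: 'k
    have "pred_ix i < i" if "i \<noteq> first_ix" using atMost_pred_ix[OF that] by auto
    then show "0 < delta_vec x $ i" using x by (auto simp: delta_vec_def mg_support_def strict_mono_def)
  qed
next
  assume d: "\<forall>i. 0 < delta_vec x $ i"
  have x: "x $ i = (\<Sum>j\<in>{..i}. delta_vec x $ j)" for i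
    using cumsum_delta_vec[of x] by (metis cumsum_vec_def vec_lambda_beta)
  have "x $ i < x $ j" if "i < j" for i j :: 'k
    unfolding x using that d by (intro sum_strict_mono2[where b=j]) (auto intro: less_imp_le)
  moreover have "0 < x $ i" for i
    unfolding x using d by (intro sum_pos) auto
  ultimately show "x \<in> mg_support" by (simp add: mg_support_def strict_mono_def)
qed

lemma mg_density_delta:
  "mg_density \<alpha> \<beta> x =
    (if \<forall>i. 0 < delta_vec x $ i then
      exp (- (x $ last_ix) / \<beta>) * (\<Prod>i\<in>UNIV. (delta_vec x $ i) powr (\<alpha> $ i - 1))
        / (\<beta> powr (\<Sum>i\<in>UNIV. \<alpha> $ i) * (\<Prod>i\<in>UNIV. Gamma (\<alpha> $ i)))
     else 0)"
proof -
  have "(\<Prod>i\<in>UNIV. (delta_vec x $ i) powr (\<alpha> $ i - 1))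
      = (x $ first_ix) powr (\<alpha> $ first_ix - 1)
        * (\<Prod>i\<in>UNIV - {first_ix}. (x $ i - x $ pred_ix i) powr (\<alpha> $ i - 1))"
    by (subst prod.remove[of UNIV first_ix]) (auto simp: delta_vec_def intro!: prod.cong)
  then show ?thesis by (simp add: mg_density_def mg_support_iff_delta)
qed

lemma measurable_delta_vec [measurable]: "delta_vec \<in> borel_measurable borel"
  by (rule borel_measurable_vecI) (simp add: delta_vec_def)

lemma measurable_cumsum_vec [measurable]: "cumsum_vec \<in> borel_measurable borel"
  by (rule borel_measurable_vecI) (simp add: cumsum_vec_def)

lemma measurable_dirichlet_part [measurable]: "dirichlet_part \<in> borel_measurable borel"
  unfolding dirichlet_part_def by measurable

lemma measurable_mg_density [measurable]: "mg_density \<alpha> \<beta> \<in> borel_measurable borel"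
  unfolding mg_density_delta[abs_def] by measurable

lemma measurable_dirichlet_density [measurable]: "dirichlet_density \<alpha> \<in> borel_measurable borel"
  unfolding dirichlet_density_def[abs_def] by measurable

lemma measurable_simplex_vec [measurable]:
  "simplex_vec \<in> borel_measurable (\<Pi>\<^sub>M i\<in>UNIV - {last_ix :: 'k::{finite,linorder}}. (lborel :: real measure))"
proof (rule borel_measurable_vecI)
  fix i :: 'k
  show "(\<lambda>u. simplex_vec u $ i) \<in> borel_measurable (\<Pi>\<^sub>M i\<in>UNIV - {last_ix :: 'k}. (lborel :: real measure))"
    by (cases "i = last_ix") (simp_all add: simplex_vec_def)
qed

lemma sum_simplex_vec: "(\<Sum>i\<in>UNIV. simplex_vec u $ i) = 1"
  by (subst sum.remove[of UNIV last_ix]) (auto simp: simplex_vec_def)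

lemma cumsum_simplex_vec:
  "cumsum_vec (simplex_vec u) $ i = (if i = last_ix then 1 else partial_sums (UNIV - {last_ix}) u i)"
proof (cases "i = last_ix")
  case True
  then show ?thesis by (simp add: cumsum_vec_last sum_simplex_vec)
next
  case False
  then have "{j \<in> UNIV - {last_ix}. j \<le> i} = {..i}"
    using le_last_ix[of i] by (auto simp: order.antisym)
  moreover have "simplex_vec u $ j = u j" if "j \<le> i" for j
    using that False antisym[OF le_last_ix[of i]] by (auto simp: simplex_vec_def)
  ultimately show ?thesis using False by (simp add: cumsum_vec_def partial_sums_def)
qed

text \<open>
  Coordinates adapted to \<open>\<Delta>x / x\<^sub>k\<close>: the last coordinate \<open>s\<close> is kept, the others are divided by \<open>s\<close>,
  which gives the power of \<open>s\<close>, and are then written as partial sums of simplex coordinates.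
\<close>
lemma nn_integral_lborel_simplex:
  fixes f :: "real ^ 'k::{finite,linorder} \<Rightarrow> ennreal"
  assumes [measurable]: "f \<in> borel_measurable borel" and pos: "\<And>x. x $ last_ix \<le> 0 \<Longrightarrow> f x = 0"
  shows "(\<integral>\<^sup>+x. f x \<partial>lborel) =
    (\<integral>\<^sup>+u. (\<integral>\<^sup>+s. indicator {0<..} s * ennreal (s ^ (CARD('k) - 1)) * f (s *\<^sub>R cumsum_vec (simplex_vec u)) \<partial>lborel)
      \<partial>(\<Pi>\<^sub>M i\<in>UNIV - {last_ix :: 'k}. lborel))"
proof -
  let ?J = "UNIV - {last_ix :: 'k}"
  let ?P = "\<Pi>\<^sub>M i\<in>?J. (lborel :: real measure)"
  interpret P: sigma_finite_measure ?P by (rule lborel_product.sigma_finite) simp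
  interpret Q: pair_sigma_finite lborel ?P ..
  have U: "insert last_ix ?J = UNIV" by auto
  have c: "card ?J = CARD('k) - 1" by (simp add: card_Diff_singleton)
  have [measurable]: "(\<lambda>x. f (vec_lambda x)) \<in> borel_measurable (\<Pi>\<^sub>M i\<in>insert last_ix ?J. (lborel :: real measure))"
    unfolding U by measurable
  have upd[measurable]: "(\<lambda>x. f (vec_lambda (x(last_ix := s)))) \<in> borel_measurable ?P" for s
    by measurable
  have "(\<integral>\<^sup>+x. f x \<partial>lborel) = (\<integral>\<^sup>+x. f (vec_lambda x) \<partial>(\<Pi>\<^sub>M i\<in>insert last_ix ?J. lborel))"
    unfolding U lborel_vec_eq_PiM by (rule nn_integral_distr) auto
  also have "\<dots> = (\<integral>\<^sup>+s. (\<integral>\<^sup>+x. f (vec_lambda (x(last_ix := s))) \<partial>?P) \<partial>lborel)"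
    by (rule lborel_product.product_nn_integral_insert_rev) auto
  also have "\<dots> = (\<integral>\<^sup>+s. (\<integral>\<^sup>+u. indicator {0<..} s * ennreal (s ^ (CARD('k) - 1)) *
      f (s *\<^sub>R cumsum_vec (simplex_vec u)) \<partial>?P) \<partial>lborel)"
  proof (rule nn_integral_cong)
    fix s :: real
    show "(\<integral>\<^sup>+x. f (vec_lambda (x(last_ix := s))) \<partial>?P) = (\<integral>\<^sup>+u. indicator {0<..} s *
      ennreal (s ^ (CARD('k) - 1)) * f (s *\<^sub>R cumsum_vec (simplex_vec u)) \<partial>?P)"
    proof (cases "0 < s")
      case False
      then show ?thesis by (simp add: pos)
    next
      case True
      have eq: "vec_lambda ((\<lambda>i\<in>?J. s * partial_sums ?J u i)(last_ix := s)) = s *\<^sub>R cumsum_vec (simplex_vec u)"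
        for u by (auto simp: vec_eq_iff cumsum_simplex_vec)
      have "(\<integral>\<^sup>+x. f (vec_lambda (x(last_ix := s))) \<partial>?P)
          = ennreal (s ^ card ?J) * (\<integral>\<^sup>+x. f (vec_lambda ((\<lambda>i\<in>?J. s * x i)(last_ix := s))) \<partial>?P)"
        by (rule nn_integral_scale_PiM) (use True in auto)
      also have "(\<integral>\<^sup>+x. f (vec_lambda ((\<lambda>i\<in>?J. s * x i)(last_ix := s))) \<partial>?P)
          = (\<integral>\<^sup>+u. f (vec_lambda ((\<lambda>i\<in>?J. s * partial_sums ?J u i)(last_ix := s))) \<partial>?P)"
      proof (rule nn_integral_partial_sums)
        have "(\<lambda>x. \<lambda>i\<in>?J. s * x i) \<in> measurable ?P ?P" by measurable
        from measurable_compose[OF this upd]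
        show "(\<lambda>x. f (vec_lambda ((\<lambda>i\<in>?J. s * x i)(last_ix := s)))) \<in> borel_measurable ?P" .
      qed simp
      also have "\<dots> = (\<integral>\<^sup>+u. f (s *\<^sub>R cumsum_vec (simplex_vec u)) \<partial>?P)"
        unfolding eq ..
      finally show ?thesis using True by (simp add: c nn_integral_cmult del: fun_upd_apply)
    qed
  qed
  also have "\<dots> = (\<integral>\<^sup>+u. (\<integral>\<^sup>+s. indicator {0<..} s * ennreal (s ^ (CARD('k) - 1)) *
      f (s *\<^sub>R cumsum_vec (simplex_vec u)) \<partial>lborel) \<partial>?P)"
    by (rule Q.Fubini'[symmetric]) measurable
  finally show ?thesis .
qed

text \<open>Shape \<open>a\<close> and scale \<open>b\<close>.\<close>
definition gamma_density :: "real \<Rightarrow> real \<Rightarrow> real \<Rightarrow> real" where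
  "gamma_density a b s = (if 0 < s then s powr (a - 1) * exp (- s / b) / (b powr a * Gamma a) else 0)"

lemma measurable_gamma_density [measurable]: "gamma_density a b \<in> borel_measurable borel"
  unfolding gamma_density_def[abs_def] by measurable

lemma gamma_density_nonneg: "0 < a \<Longrightarrow> 0 \<le> gamma_density a b s"
  by (simp add: gamma_density_def Gamma_real_pos less_imp_le)

lemma nn_integral_gamma_density:
  assumes a: "0 < a" and b: "0 < b"
  shows "(\<integral>\<^sup>+s. ennreal (gamma_density a b s) \<partial>lborel) = 1"
proof -
  have "(\<integral>\<^sup>+s. ennreal (gamma_density a b s) \<partial>lborel)
      = ennreal b * (\<integral>\<^sup>+t. ennreal (gamma_density a b (b * t)) \<partial>lborel)"
    using nn_integral_real_affine[of "\<lambda>s. ennreal (gamma_density a b s)" b 0] b by simp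
  also have "\<dots> = (\<integral>\<^sup>+t. ennreal b * ennreal (gamma_density a b (b * t)) \<partial>lborel)"
    by (rule nn_integral_cmult[symmetric]) measurable
  also have "\<dots> = (\<integral>\<^sup>+t. ennreal (1 / Gamma a) * ennreal (indicator {0..} t * t powr (a - 1) / exp t) \<partial>lborel)"
  proof (rule nn_integral_cong)
    fix t :: real
    have "b * gamma_density a b (b * t) = 1 / Gamma a * (indicator {0..} t * t powr (a - 1) / exp t)"
    proof (cases "0 < t")
      case True
      have "b * b powr (a - 1) = b powr a" using b by (simp add: powr_mult_base)
      then show ?thesis using True b Gamma_real_pos[OF a]
        by (simp add: gamma_density_def powr_mult exp_minus field_simps)
    qed (use b in \<open>auto simp: gamma_density_def zero_less_mult_iff indicator_def\<close>)
    then show "ennreal b * ennreal (gamma_density a b (b * t))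
        = ennreal (1 / Gamma a) * ennreal (indicator {0..} t * t powr (a - 1) / exp t)"
      using a b Gamma_real_pos[OF a] gamma_density_nonneg[OF a] by (simp add: ennreal_mult[symmetric])
  qed
  also have "\<dots> = ennreal (1 / Gamma a) * ennreal (Gamma a)"
    unfolding Gamma_conv_nn_integral_real[OF a] by (rule nn_integral_cmult) measurable
  also have "\<dots> = 1" using Gamma_real_pos[OF a] by (simp add: ennreal_mult[symmetric])
  finally show ?thesis .
qed

lemma mg_density_nonneg:
  assumes "\<And>i. 0 < \<alpha> $ i"
  shows "0 \<le> mg_density \<alpha> \<beta> x"
  using assms by (auto simp: mg_density_delta intro!: divide_nonneg_nonneg mult_nonneg_nonneg prod_nonneg)

text \<open>The increments of a Multivariate Gamma vector are independent Gamma variables with common scale.\<close>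
lemma mg_density_prod:
  assumes "0 < \<beta>"
  shows "mg_density \<alpha> \<beta> x = (\<Prod>i\<in>UNIV. gamma_density (\<alpha> $ i) \<beta> (delta_vec x $ i))"
proof (cases "\<forall>i. 0 < delta_vec x $ i")
  case True
  have "exp (- (x $ last_ix) / \<beta>) = (\<Prod>i\<in>UNIV. exp (- (delta_vec x $ i) / \<beta>))"
    by (simp add: last_eq_sum_delta exp_sum[symmetric] sum_divide_distrib sum_negf)
  moreover have "\<beta> powr (\<Sum>i\<in>UNIV. \<alpha> $ i) = (\<Prod>i\<in>UNIV. \<beta> powr (\<alpha> $ i))"
    using assms by (simp add: powr_sum)
  ultimately show ?thesis using True
    by (simp add: mg_density_delta gamma_density_def prod.distrib prod_dividef mult_ac)
next
  case False
  then obtain i where "\<not> 0 < delta_vec x $ i" by blast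
  then have "gamma_density (\<alpha> $ i) \<beta> (delta_vec x $ i) = 0" by (simp add: gamma_density_def)
  then have "(\<Prod>i\<in>UNIV. gamma_density (\<alpha> $ i) \<beta> (delta_vec x $ i)) = 0" by (auto intro: prod_zero)
  with False show ?thesis unfolding mg_density_delta by (simp only: if_False)
qed

lemma nn_integral_mg_density:
  fixes \<alpha> :: "real ^ 'k::{finite,linorder}"
  assumes \<alpha>: "\<And>i. 0 < \<alpha> $ i" and \<beta>: "0 < \<beta>"
  shows "(\<integral>\<^sup>+x. ennreal (mg_density \<alpha> \<beta> x) \<partial>lborel) = 1"
proof -
  have eq: "vec_lambda (partial_sums UNIV y) = cumsum_vec (vec_lambda y)" for y :: "'k \<Rightarrow> real"
    by (simp add: vec_eq_iff partial_sums_def cumsum_vec_def atMost_def)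
  have "(\<integral>\<^sup>+x. ennreal (mg_density \<alpha> \<beta> x) \<partial>lborel)
      = (\<integral>\<^sup>+y. ennreal (mg_density \<alpha> \<beta> (vec_lambda y)) \<partial>(\<Pi>\<^sub>M i\<in>(UNIV::'k set). lborel))"
    unfolding lborel_vec_eq_PiM by (rule nn_integral_distr) auto
  also have "\<dots> = (\<integral>\<^sup>+y. ennreal (mg_density \<alpha> \<beta> (vec_lambda (partial_sums UNIV y))) \<partial>(\<Pi>\<^sub>M i\<in>(UNIV::'k set). lborel))"
    by (rule nn_integral_partial_sums) auto
  also have "\<dots> = (\<integral>\<^sup>+y. (\<Prod>i\<in>UNIV. ennreal (gamma_density (\<alpha> $ i) \<beta> (y i))) \<partial>(\<Pi>\<^sub>M i\<in>(UNIV::'k set). lborel))"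
    unfolding eq mg_density_prod[OF \<beta>] delta_cumsum_vec
    using gamma_density_nonneg[OF \<alpha>] by (simp add: prod_ennreal)
  also have "\<dots> = (\<Prod>i\<in>UNIV. (\<integral>\<^sup>+s. ennreal (gamma_density (\<alpha> $ i) \<beta> s) \<partial>lborel))"
    by (rule lborel_product.product_nn_integral_prod) auto
  also have "\<dots> = 1" by (simp add: nn_integral_gamma_density[OF \<alpha> \<beta>])
  finally show ?thesis .
qed

lemma dirichlet_density_nonneg:
  assumes "\<And>i. 0 < \<alpha> $ i"
  shows "0 \<le> dirichlet_density \<alpha> w"
  using assms
  by (auto simp: dirichlet_density_def sum_pos intro!: mult_nonneg_nonneg divide_nonneg_nonneg prod_nonneg
      less_imp_le[OF Gamma_real_pos])

lemma positive_simplex_lt_1: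
  fixes w :: "real ^ 'k::{finite,linorder}"
  assumes k: "2 \<le> CARD('k)" and w: "\<And>i. 0 < w $ i" "(\<Sum>i\<in>UNIV. w $ i) = 1"
  shows "w $ i < 1"
proof -
  have "UNIV - {i} \<noteq> {}"
  proof
    assume "UNIV - {i} = {}"
    then have "(UNIV :: 'k set) = {i}" by auto
    then have "CARD('k) = card {i}" by (simp only:)
    with k show False by simp
  qed
  then have "0 < (\<Sum>j\<in>UNIV - {i}. w $ j)" using w by (intro sum_pos) auto
  then show ?thesis using w(2) by (simp add: sum.remove[of UNIV i])
qed

text \<open>
  The factorisation behind the independence of \<open>\<Delta>X / X\<^sub>k\<close> and \<open>X\<^sub>k\<close>: the Jacobian raises the power of
  \<open>s\<close> from \<open>\<alpha>\<^sub>0 - k\<close> to \<open>\<alpha>\<^sub>0 - 1\<close>. At least two coordinates are required, since the support of the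
  Dirichlet density demands \<open>w\<^sub>i < 1\<close>.
\<close>
lemma mg_density_polar:
  fixes \<alpha> :: "real ^ 'k::{finite,linorder}"
  assumes k: "2 \<le> CARD('k)" and \<alpha>: "\<And>i. 0 < \<alpha> $ i" and \<beta>: "0 < \<beta>" and s: "0 < s"
    and w: "(\<Sum>i\<in>UNIV. w $ i) = 1"
  shows "s ^ (CARD('k) - 1) * mg_density \<alpha> \<beta> (s *\<^sub>R cumsum_vec w)
    = gamma_density (\<Sum>i\<in>UNIV. \<alpha> $ i) \<beta> s * dirichlet_density \<alpha> w"
proof (cases "\<forall>i. 0 < w $ i")
  case False
  then show ?thesis using s
    by (auto simp: mg_density_delta dirichlet_density_def delta_vec_scaleR delta_cumsum_vec zero_less_mult_iff)
next
  case True
  let ?A = "\<Sum>i\<in>UNIV. \<alpha> $ i"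
  have "(\<Prod>i\<in>UNIV. (s * w $ i) powr (\<alpha> $ i - 1)) = s powr (?A - real CARD('k)) * (\<Prod>i\<in>UNIV. (w $ i) powr (\<alpha> $ i - 1))"
    using s True by (simp add: powr_mult less_imp_le prod.distrib powr_sum[symmetric] sum_subtractf)
  moreover have "s ^ (CARD('k) - 1) * s powr (?A - real CARD('k)) = s powr (?A - 1)"
    using s by (simp add: powr_realpow[symmetric] powr_add[symmetric] of_nat_diff Suc_leI)
  moreover have "(s *\<^sub>R cumsum_vec w) $ last_ix = s" by (simp add: cumsum_vec_last w)
  moreover have "0 < Gamma ?A" using \<alpha> by (intro Gamma_real_pos sum_pos) auto
  moreover have "w $ i < 1" for i using positive_simplex_lt_1[OF k] True w by blast
  ultimately show ?thesis using True s w
    by (simp add: mg_density_delta delta_vec_scaleR delta_cumsum_vec gamma_density_def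
        dirichlet_density_def field_simps)
qed

lemma nn_integral_mg_polar:
  fixes \<alpha> :: "real ^ 'k::{finite,linorder}"
  assumes k: "2 \<le> CARD('k)" and \<alpha>: "\<And>i. 0 < \<alpha> $ i" and \<beta>: "0 < \<beta>"
    and [measurable]: "f \<in> borel_measurable (borel \<Otimes>\<^sub>M borel)"
  shows "(\<integral>\<^sup>+x. f (dirichlet_part x, x $ last_ix) \<partial>mg_distribution \<alpha> \<beta>)
    = (\<integral>\<^sup>+w. (\<integral>\<^sup>+s. f (w, s) \<partial>density lborel (gamma_density (\<Sum>i\<in>UNIV. \<alpha> $ i) \<beta>)) \<partial>dirichlet_distribution \<alpha>)"
proof -
  let ?P = "\<Pi>\<^sub>M i\<in>UNIV - {last_ix :: 'k}. (lborel :: real measure)"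
  let ?A = "\<Sum>i\<in>UNIV. \<alpha> $ i"
  let ?g = "gamma_density ?A \<beta>"
  have A: "0 < ?A" using \<alpha> by (intro sum_pos) auto
  have [measurable]: "(\<lambda>w. \<integral>\<^sup>+s. f (w, s) \<partial>density lborel ?g) \<in> borel_measurable borel"
    by (subst nn_integral_density) (auto intro!: lborel.borel_measurable_nn_integral)
  have "(\<integral>\<^sup>+x. f (dirichlet_part x, x $ last_ix) \<partial>mg_distribution \<alpha> \<beta>)
      = (\<integral>\<^sup>+x. ennreal (mg_density \<alpha> \<beta> x) * f (dirichlet_part x, x $ last_ix) \<partial>lborel)"
    unfolding mg_distribution_def by (subst nn_integral_density) auto
  also have "\<dots> = (\<integral>\<^sup>+u. (\<integral>\<^sup>+s. indicator {0<..} s * ennreal (s ^ (CARD('k) - 1)) *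
      (ennreal (mg_density \<alpha> \<beta> (s *\<^sub>R cumsum_vec (simplex_vec u))) *
        f (dirichlet_part (s *\<^sub>R cumsum_vec (simplex_vec u)), (s *\<^sub>R cumsum_vec (simplex_vec u)) $ last_ix)) \<partial>lborel) \<partial>?P)"
  proof (rule nn_integral_lborel_simplex)
    fix x :: "(real, 'k) vec" assume "x $ last_ix \<le> 0"
    then have "x \<notin> mg_support" by (auto simp: mg_support_def not_less)
    then show "ennreal (mg_density \<alpha> \<beta> x) * f (dirichlet_part x, x $ last_ix) = 0"
      by (simp add: mg_density_def)
  qed measurable
  also have "\<dots> = (\<integral>\<^sup>+u. (\<integral>\<^sup>+s. ennreal (dirichlet_density \<alpha> (simplex_vec u)) * (ennreal (?g s) * f (simplex_vec u, s)) \<partial>lborel) \<partial>?P)"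
  proof (intro nn_integral_cong)
    fix u :: "'k \<Rightarrow> real" and s :: real
    let ?w = "simplex_vec u"
    show "indicator {0<..} s * ennreal (s ^ (CARD('k) - 1)) *
      (ennreal (mg_density \<alpha> \<beta> (s *\<^sub>R cumsum_vec ?w)) *
        f (dirichlet_part (s *\<^sub>R cumsum_vec ?w), (s *\<^sub>R cumsum_vec ?w) $ last_ix))
      = ennreal (dirichlet_density \<alpha> ?w) * (ennreal (?g s) * f (?w, s))"
    proof (cases "0 < s")
      case False
      then show ?thesis by (simp add: gamma_density_def)
    next
      case True
      have last: "(s *\<^sub>R cumsum_vec ?w) $ last_ix = s" by (simp add: cumsum_vec_last sum_simplex_vec)
      then have part: "dirichlet_part (s *\<^sub>R cumsum_vec ?w) = ?w"
        using True by (simp add: dirichlet_part_def delta_vec_scaleR delta_cumsum_vec)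
      have "ennreal (s ^ (CARD('k) - 1)) * ennreal (mg_density \<alpha> \<beta> (s *\<^sub>R cumsum_vec ?w))
          = ennreal (?g s) * ennreal (dirichlet_density \<alpha> ?w)"
        using mg_density_polar[OF k \<alpha> \<beta> True sum_simplex_vec] True mg_density_nonneg[OF \<alpha>]
          dirichlet_density_nonneg[OF \<alpha>] gamma_density_nonneg[OF A]
        by (simp add: ennreal_mult[symmetric])
      then show ?thesis using True unfolding last part
        by (simp add: mult.assoc[symmetric]) (simp add: mult_ac)
    qed
  qed
  also have "\<dots> = (\<integral>\<^sup>+u. ennreal (dirichlet_density \<alpha> (simplex_vec u)) * (\<integral>\<^sup>+s. f (simplex_vec u, s) \<partial>density lborel ?g) \<partial>?P)"
    by (subst nn_integral_density) (auto intro!: nn_integral_cong nn_integral_cmult)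
  also have "\<dots> = (\<integral>\<^sup>+w. (\<integral>\<^sup>+s. f (w, s) \<partial>density lborel ?g) \<partial>dirichlet_distribution \<alpha>)"
    unfolding dirichlet_distribution_def by (subst nn_integral_distr) (auto simp: nn_integral_density)
  finally show ?thesis .
qed

lemma sets_mg_distribution [measurable_cong, simp]: "sets (mg_distribution \<alpha> \<beta>) = sets borel"
  by (simp add: mg_distribution_def)

lemma sets_dirichlet_distribution [measurable_cong, simp]: "sets (dirichlet_distribution \<alpha>) = sets borel"
  by (simp add: dirichlet_distribution_def)

lemma prob_space_gamma:
  assumes "0 < a" and "0 < b"
  shows "prob_space (density lborel (gamma_density a b))"
  by (rule prob_spaceI) (simp add: emeasure_density nn_integral_gamma_density[OF assms])

lemma prob_space_mg:
  assumes "\<And>i. 0 < \<alpha> $ i" and "0 < \<beta>"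
  shows "prob_space (mg_distribution \<alpha> \<beta>)"
  by (rule prob_spaceI) (simp add: mg_distribution_def emeasure_density nn_integral_mg_density[OF assms])

text \<open>
  Comparing total masses on both sides of the change of variables gives the normalising constant
  of the Dirichlet density from those of the Gamma densities.
\<close>
lemma prob_space_dirichlet:
  fixes \<alpha> :: "real ^ 'k::{finite,linorder}"
  assumes k: "2 \<le> CARD('k)" and \<alpha>: "\<And>i. 0 < \<alpha> $ i"
  shows "prob_space (dirichlet_distribution \<alpha>)"
proof -
  have A: "0 < (\<Sum>i\<in>UNIV. \<alpha> $ i)" using \<alpha> by (intro sum_pos) auto
  interpret G: prob_space "density lborel (gamma_density (\<Sum>i\<in>UNIV. \<alpha> $ i) 1)"
    by (rule prob_space_gamma[OF A]) simp
  interpret M: prob_space "mg_distribution \<alpha> 1" by (rule prob_space_mg[OF \<alpha>]) simp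
  show ?thesis
    using nn_integral_mg_polar[OF k \<alpha>, of 1 "\<lambda>_. 1"] M.emeasure_space_1 G.emeasure_space_1
    by (intro prob_spaceI) simp
qed

theorem distr_mg_polar:
  fixes \<alpha> :: "real ^ 'k::{finite,linorder}"
  assumes k: "2 \<le> CARD('k)" and \<alpha>: "\<And>i. 0 < \<alpha> $ i" and \<beta>: "0 < \<beta>"
  shows "distr (mg_distribution \<alpha> \<beta>) (borel \<Otimes>\<^sub>M borel) (\<lambda>x. (dirichlet_part x, x $ last_ix))
    = dirichlet_distribution \<alpha> \<Otimes>\<^sub>M density lborel (gamma_density (\<Sum>i\<in>UNIV. \<alpha> $ i) \<beta>)"
proof (rule measure_eqI)
  have A: "0 < (\<Sum>i\<in>UNIV. \<alpha> $ i)" using \<alpha> by (intro sum_pos) auto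
  interpret G: prob_space "density lborel (gamma_density (\<Sum>i\<in>UNIV. \<alpha> $ i) \<beta>)"
    by (rule prob_space_gamma[OF A \<beta>])
  show "sets (distr (mg_distribution \<alpha> \<beta>) (borel \<Otimes>\<^sub>M borel) (\<lambda>x. (dirichlet_part x, x $ last_ix)))
    = sets (dirichlet_distribution \<alpha> \<Otimes>\<^sub>M density lborel (gamma_density (\<Sum>i\<in>UNIV. \<alpha> $ i) \<beta>))"
    by (simp cong: sets_pair_measure_cong)
  fix A assume "A \<in> sets (distr (mg_distribution \<alpha> \<beta>) (borel \<Otimes>\<^sub>M borel) (\<lambda>x. (dirichlet_part x, x $ last_ix)))"
  then have A[measurable]: "A \<in> sets (borel \<Otimes>\<^sub>M borel)" by simp
  then have A': "A \<in> sets (dirichlet_distribution \<alpha> \<Otimes>\<^sub>M density lborel (gamma_density (\<Sum>i\<in>UNIV. \<alpha> $ i) \<beta>))"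
    by (simp cong: sets_pair_measure_cong)
  have "emeasure (distr (mg_distribution \<alpha> \<beta>) (borel \<Otimes>\<^sub>M borel) (\<lambda>x. (dirichlet_part x, x $ last_ix))) A
      = (\<integral>\<^sup>+p. indicator A p \<partial>distr (mg_distribution \<alpha> \<beta>) (borel \<Otimes>\<^sub>M borel) (\<lambda>x. (dirichlet_part x, x $ last_ix)))"
    by simp
  also have "\<dots> = (\<integral>\<^sup>+x. indicator A (dirichlet_part x, x $ last_ix) \<partial>mg_distribution \<alpha> \<beta>)"
    by (rule nn_integral_distr) auto
  also have "\<dots> = emeasure (dirichlet_distribution \<alpha> \<Otimes>\<^sub>M density lborel (gamma_density (\<Sum>i\<in>UNIV. \<alpha> $ i) \<beta>)) A"
    unfolding G.emeasure_pair_measure[OF A'] by (rule nn_integral_mg_polar[OF k \<alpha> \<beta>]) auto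
  finally show "emeasure (distr (mg_distribution \<alpha> \<beta>) (borel \<Otimes>\<^sub>M borel) (\<lambda>x. (dirichlet_part x, x $ last_ix))) A
      = emeasure (dirichlet_distribution \<alpha> \<Otimes>\<^sub>M density lborel (gamma_density (\<Sum>i\<in>UNIV. \<alpha> $ i) \<beta>)) A" .
qed

section \<open>The delta method for vector-valued samples\<close>

lemma integrable_mult_of_squares:
  fixes f g :: "'a \<Rightarrow> real"
  assumes [measurable]: "f \<in> borel_measurable M" "g \<in> borel_measurable M"
    and "integrable M (\<lambda>x. (f x)\<^sup>2)" "integrable M (\<lambda>x. (g x)\<^sup>2)"
  shows "integrable M (\<lambda>x. f x * g x)"
proof (rule Bochner_Integration.integrable_bound)
  show "integrable M (\<lambda>x. (f x)\<^sup>2 + (g x)\<^sup>2)" using assms by simp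
  have "\<bar>f x * g x\<bar> \<le> \<bar>(f x)\<^sup>2 + (g x)\<^sup>2\<bar>" for x
  proof -
    have "0 \<le> \<bar>f x * g x\<bar>" by simp
    moreover have "2 * \<bar>f x * g x\<bar> \<le> (f x)\<^sup>2 + (g x)\<^sup>2"
      using sum_squares_bound[of "\<bar>f x\<bar>" "\<bar>g x\<bar>"] by (simp add: abs_mult)
    ultimately show ?thesis by linarith
  qed
  then show "AE x in M. norm (f x * g x) \<le> norm ((f x)\<^sup>2 + (g x)\<^sup>2)" by simp
qed simp

lemma (in prob_space) integrable_of_square:
  fixes f :: "'a \<Rightarrow> real"
  assumes "f \<in> borel_measurable M" and "integrable M (\<lambda>x. (f x)\<^sup>2)"
  shows "integrable M f"
  using integrable_mult_of_squares[of f M "\<lambda>_. 1"] assms by simp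

lemma norm_iexp_diff_le: "cmod (iexp a - iexp b) \<le> \<bar>a - b\<bar>"
proof -
  have "iexp a - iexp b = iexp b * (iexp (a - b) - 1)"
    by (simp add: algebra_simps exp_add[symmetric])
  moreover have "cmod (iexp (a - b) - 1) \<le> \<bar>a - b\<bar>" using iexp_approx1[of "a - b" 0] by simp
  ultimately show ?thesis by (simp add: norm_mult)
qed

text \<open>Transfers statements on the limit covariance \<open>G V G\<^sup>T\<close> to statements on \<open>V\<close>.\<close>
lemma quadratic_form_congruence:
  fixes G :: "real ^ 'm::finite ^ 'd::finite"
  shows "t \<bullet> ((G ** V ** transpose G) *v t) = (transpose G *v t) \<bullet> (V *v (transpose G *v t))"
  by (simp add: matrix_vector_mul_assoc[symmetric] dot_lmul_matrix[symmetric] transpose_matrix_vector)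

locale iid_sample = prob_space M for M :: "'a measure" +
  fixes \<xi> :: "nat \<Rightarrow> 'a \<Rightarrow> real ^ 'm::finite" and P :: "(real ^ 'm) measure"
  assumes indep: "indep_vars (\<lambda>_. borel) \<xi> {1..}"
    and law: "n \<ge> 1 \<Longrightarrow> distr M borel (\<xi> n) = P"
    and square_integrable: "integrable P (\<lambda>y. (y $ i)\<^sup>2)"
begin

definition mean :: "real ^ 'm" where
  "mean = (\<integral>y. y \<partial>P)"

definition cov :: "real ^ 'm ^ 'm" where
  "cov = covariance_matrix P (\<lambda>y. y)"

definition scaled_error :: "nat \<Rightarrow> 'a \<Rightarrow> real ^ 'm" where
  "scaled_error N \<omega> = sqrt (real N) *\<^sub>R (sample_mean N (\<lambda>n. \<xi> n \<omega>) - mean)"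

lemma measurable_sample [measurable]: "n \<ge> 1 \<Longrightarrow> \<xi> n \<in> borel_measurable M"
  using indep by (auto simp: indep_vars_def)

lemma sets_P [measurable_cong, simp]: "sets P = sets borel"
  using law[of 1] by (metis le_refl sets_distr)

lemma prob_space_P: "prob_space P"
  using law[of 1] prob_space_distr[OF measurable_sample[of 1]] by simp

lemma measurable_sample_mean [measurable]: "(\<lambda>\<omega>. sample_mean N (\<lambda>n. \<xi> n \<omega>)) \<in> borel_measurable M"
  unfolding sample_mean_def by (intro borel_measurable_scaleR borel_measurable_sum) auto

lemma measurable_scaled_error [measurable]: "scaled_error N \<in> borel_measurable M"
  unfolding scaled_error_def[abs_def] by measurable

lemma integrable_entry: "integrable P (\<lambda>y. y $ i)"
proof -
  interpret P: prob_space P by (rule prob_space_P)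
  show ?thesis by (rule P.integrable_of_square) (simp_all add: square_integrable)
qed

lemma integrable_identity: "integrable P (\<lambda>y. y)"
  by (rule integrable_vecI) (rule integrable_entry)

lemma integrable_centered_product: "integrable P (\<lambda>y. (y $ i - mean $ i) * (y $ j - mean $ j))"
proof -
  interpret P: prob_space P by (rule prob_space_P)
  have "integrable P (\<lambda>y. (y $ i - mean $ i)\<^sup>2)" for i
    by (simp add: power2_diff integrable_entry square_integrable)
  then show ?thesis by (intro integrable_mult_of_squares) auto
qed

lemma cov_entry: "cov $ i $ j = (\<integral>y. (y $ i - mean $ i) * (y $ j - mean $ j) \<partial>P)"
  by (simp add: cov_def covariance_matrix_def mean_def)

lemma cov_form_integrand:
  "(s \<bullet> (y - mean))\<^sup>2 = (\<Sum>i\<in>UNIV. \<Sum>j\<in>UNIV. s $ i * s $ j * ((y $ i - mean $ i) * (y $ j - mean $ j)))"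
  by (simp add: inner_vec_def power2_eq_square sum_product mult_ac)

lemma integrable_cov_form: "integrable P (\<lambda>y. (s \<bullet> (y - mean))\<^sup>2)"
  unfolding cov_form_integrand
  by (intro Bochner_Integration.integrable_sum integrable_mult_right integrable_centered_product)

lemma cov_form: "s \<bullet> (cov *v s) = (\<integral>y. (s \<bullet> (y - mean))\<^sup>2 \<partial>P)"
proof -
  have "(\<integral>y. (s \<bullet> (y - mean))\<^sup>2 \<partial>P) = (\<Sum>i\<in>UNIV. \<Sum>j\<in>UNIV. s $ i * s $ j * cov $ i $ j)"
    unfolding cov_form_integrand cov_entry
    by (subst Bochner_Integration.integral_sum,
        (intro Bochner_Integration.integrable_sum integrable_mult_right integrable_centered_product),
        subst Bochner_Integration.integral_sum)
      (simp_all add: integrable_centered_product)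
  also have "\<dots> = s \<bullet> (cov *v s)"
    by (simp add: inner_vec_def matrix_vector_mult_def sum_distrib_left mult_ac)
  finally show ?thesis ..
qed

lemma cov_positive_semidefinite: "positive_semidefinite cov"
  unfolding positive_semidefinite_def cov_form
  by (auto simp: transpose_def vec_eq_iff cov_entry mult.commute)

text \<open>The sample starts at index 1, the sequences of the central limit theorem at 0; hence the shift.\<close>
definition deviation :: "real ^ 'm \<Rightarrow> nat \<Rightarrow> 'a \<Rightarrow> real" where
  "deviation s n \<omega> = s \<bullet> (\<xi> (Suc n) \<omega> - mean)"

lemma measurable_deviation [measurable]: "deviation s n \<in> borel_measurable M"
  unfolding deviation_def[abs_def] by measurable

lemma integral_sample:
  fixes f :: "real ^ 'm \<Rightarrow> real"
  assumes "f \<in> borel_measurable borel"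
  shows "(\<integral>\<omega>. f (\<xi> (Suc n) \<omega>) \<partial>M) = (\<integral>y. f y \<partial>P)"
    and "integrable M (\<lambda>\<omega>. f (\<xi> (Suc n) \<omega>)) \<longleftrightarrow> integrable P f"
  using assms unfolding law[of "Suc n", symmetric, simplified]
  by (simp_all add: integral_distr integrable_distr_eq)

text \<open>Grouping the sample into the singleton blocks \<open>{Suc j}\<close> performs the shift of indices.\<close>
lemma deviation_indep: "indep_vars (\<lambda>_. borel) (deviation s) UNIV"
proof -
  have "indep_vars (\<lambda>j. \<Pi>\<^sub>M i\<in>{Suc j}. borel) (\<lambda>j \<omega>. \<lambda>i\<in>{Suc j}. \<xi> i \<omega>) UNIV"
    by (rule indep_vars_restrict[OF indep]) (auto simp: disjoint_family_on_def)
  then have "indep_vars (\<lambda>_. borel) (\<lambda>j \<omega>. s \<bullet> ((\<lambda>i\<in>{Suc j}. \<xi> i \<omega>) (Suc j) - mean)) UNIV"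
    by (rule indep_vars_compose2) measurable
  then show ?thesis by (simp add: deviation_def[abs_def])
qed

lemma integrable_deviation_square: "integrable M (\<lambda>\<omega>. (deviation s n \<omega>)\<^sup>2)"
  unfolding deviation_def using integral_sample(2)[of "\<lambda>y. (s \<bullet> (y - mean))\<^sup>2" n] integrable_cov_form by simp

lemma integrable_deviation: "integrable M (deviation s n)"
  by (rule integrable_of_square[OF measurable_deviation integrable_deviation_square])

lemma expectation_deviation_square: "expectation (\<lambda>\<omega>. (deviation s n \<omega>)\<^sup>2) = s \<bullet> (cov *v s)"
  unfolding deviation_def cov_form using integral_sample(1)[of "\<lambda>y. (s \<bullet> (y - mean))\<^sup>2" n] by simp

lemma expectation_deviation: "expectation (deviation s n) = 0"
proof -
  interpret P: prob_space P by (rule prob_space_P)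
  have "expectation (deviation s n) = (\<integral>y. s \<bullet> (y - mean) \<partial>P)"
    unfolding deviation_def using integral_sample(1)[of "\<lambda>y. s \<bullet> (y - mean)" n] by simp
  also have "\<dots> = s \<bullet> (\<integral>y. y - mean \<partial>P)"
    by (rule integral_inner_right) (simp add: integrable_identity)
  also have "\<dots> = 0" using P.prob_space by (simp add: integrable_identity mean_def)
  finally show ?thesis .
qed

lemma inner_scaled_error:
  assumes "N \<ge> 1"
  shows "s \<bullet> scaled_error N \<omega> = (\<Sum>n<N. deviation s n \<omega>) / sqrt (real N)"
proof -
  have "(\<Sum>n = 1..N. \<xi> n \<omega>) = (\<Sum>n<N. \<xi> (Suc n) \<omega>)"
    by (rule sum.reindex_bij_witness[of _ Suc "\<lambda>n. n - 1"]) auto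
  then have "s \<bullet> (sample_mean N (\<lambda>n. \<xi> n \<omega>) - mean) = (\<Sum>n<N. deviation s n \<omega>) / real N"
    using assms
    by (simp add: sample_mean_def deviation_def inner_diff_right inner_sum_right sum_subtractf field_simps)
  moreover have "sqrt (real N) * (S / real N) = S / sqrt (real N)" for S
    using assms real_div_sqrt[of "real N"] by (simp add: divide_simps)
  ultimately show ?thesis unfolding scaled_error_def inner_scaleR_right by simp
qed

lemma expectation_deviation_product:
  assumes "i \<noteq> j"
  shows "expectation (\<lambda>\<omega>. deviation s i \<omega> * deviation s j \<omega>) = 0"
proof -
  have "expectation (\<lambda>\<omega>. \<Prod>n\<in>{i, j}. deviation s n \<omega>) = (\<Prod>n\<in>{i, j}. expectation (deviation s n))"
    by (rule indep_vars_lebesgue_integral)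
      (auto intro: indep_vars_subset[OF deviation_indep] integrable_deviation)
  then show ?thesis using assms by (simp add: expectation_deviation)
qed

text \<open>The mixed terms vanish by independence, so the second moment does not depend on \<open>N\<close>.\<close>
lemma expectation_scaled_error_square:
  assumes "N \<ge> 1"
  shows "expectation (\<lambda>\<omega>. (s \<bullet> scaled_error N \<omega>)\<^sup>2) = s \<bullet> (cov *v s)"
    and "integrable M (\<lambda>\<omega>. (s \<bullet> scaled_error N \<omega>)\<^sup>2)"
proof -
  have int: "integrable M (\<lambda>\<omega>. deviation s i \<omega> * deviation s j \<omega>)" for i j
    by (intro integrable_mult_of_squares integrable_deviation_square) auto
  have eq: "(s \<bullet> scaled_error N \<omega>)\<^sup>2 = (\<Sum>i<N. \<Sum>j<N. deviation s i \<omega> * deviation s j \<omega>) / real N" for \<omega>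
    using assms by (simp add: inner_scaled_error power_divide power2_eq_square sum_product)
  show "integrable M (\<lambda>\<omega>. (s \<bullet> scaled_error N \<omega>)\<^sup>2)"
    unfolding eq by (intro integrable_divide Bochner_Integration.integrable_sum int)
  have "expectation (\<lambda>\<omega>. (s \<bullet> scaled_error N \<omega>)\<^sup>2)
      = (\<Sum>i<N. \<Sum>j<N. expectation (\<lambda>\<omega>. deviation s i \<omega> * deviation s j \<omega>)) / real N"
    unfolding eq by (simp add: int Bochner_Integration.integral_sum)
  also have "\<dots> = (\<Sum>i<N. \<Sum>j<N. if j = i then s \<bullet> (cov *v s) else 0) / real N"
    using expectation_deviation_product expectation_deviation_square
    by (intro arg_cong2[where f="(/)"] sum.cong refl) (auto simp: power2_eq_square)
  also have "\<dots> = s \<bullet> (cov *v s)" using assms by (simp add: sum.delta)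
  finally show "expectation (\<lambda>\<omega>. (s \<bullet> scaled_error N \<omega>)\<^sup>2) = s \<bullet> (cov *v s)" .
qed

lemma scaled_error_tail:
  assumes "N \<ge> 1" and "0 < R"
  shows "prob {\<omega> \<in> space M. R < norm (scaled_error N \<omega>)} \<le> (\<Sum>i\<in>UNIV. cov $ i $ i) / R\<^sup>2"
proof -
  have sq: "(norm (scaled_error N \<omega>))\<^sup>2 = (\<Sum>i\<in>UNIV. (axis i 1 \<bullet> scaled_error N \<omega>)\<^sup>2)" for \<omega>
    unfolding inner_axis' unfolding power2_norm_eq_inner inner_vec_def by (simp add: power2_eq_square)
  have diag: "axis i 1 \<bullet> (cov *v axis i 1) = cov $ i $ i" for i
    by (simp only: inner_axis' inner_axis matrix_vector_mul_component) simp
  have int: "integrable M (\<lambda>\<omega>. (norm (scaled_error N \<omega>))\<^sup>2)"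
    unfolding sq by (intro Bochner_Integration.integrable_sum expectation_scaled_error_square assms)
  have E: "expectation (\<lambda>\<omega>. (norm (scaled_error N \<omega>))\<^sup>2) = (\<Sum>i\<in>UNIV. cov $ i $ i)"
    unfolding sq using expectation_scaled_error_square[OF assms(1)] by (simp add: diag)
  have "prob {\<omega> \<in> space M. R < norm (scaled_error N \<omega>)}
      \<le> prob {\<omega> \<in> space M. R\<^sup>2 \<le> (norm (scaled_error N \<omega>))\<^sup>2}"
    using assms(2) by (intro finite_measure_mono) (auto intro: power_mono)
  also have "\<dots> \<le> expectation (\<lambda>\<omega>. (norm (scaled_error N \<omega>))\<^sup>2) / R\<^sup>2"
    using assms(2) int by (intro integral_Markov_inequality_measure[where A="{}"]) auto
  finally show ?thesis unfolding E .
qed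

lemma scaled_error_char:
  "(\<lambda>N. CLINT \<omega>|M. iexp (s \<bullet> scaled_error N \<omega>)) \<longlonglongrightarrow> complex_of_real (exp (- (s \<bullet> (cov *v s)) / 2))"
proof (cases "s \<bullet> (cov *v s) = 0")
  case True
  \<comment> \<open>the projected sample is almost surely constant, a case that the central limit theorem excludes\<close>
  have "(CLINT \<omega>|M. iexp (s \<bullet> scaled_error N \<omega>)) = 1" if "N \<ge> 1" for N
  proof -
    have "AE \<omega> in M. (s \<bullet> scaled_error N \<omega>)\<^sup>2 = 0"
      using integral_nonneg_eq_0_iff_AE[OF expectation_scaled_error_square(2)[OF that, of s]]
        expectation_scaled_error_square(1)[OF that, of s] True by simp
    then have "(CLINT \<omega>|M. iexp (s \<bullet> scaled_error N \<omega>)) = (CLINT \<omega>|M. 1)"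
      by (intro integral_cong_AE) auto
    then show ?thesis by (simp add: prob_space)
  qed
  then have "\<forall>\<^sub>F N in sequentially. (CLINT \<omega>|M. iexp (s \<bullet> scaled_error N \<omega>)) = 1"
    by (auto simp: eventually_sequentially)
  then show ?thesis unfolding True by (simp add: tendsto_eventually)
next
  case False
  define \<sigma> where "\<sigma> = sqrt (s \<bullet> (cov *v s))"
  have pos: "0 < s \<bullet> (cov *v s)"
    using False cov_positive_semidefinite by (simp add: positive_semidefinite_def order_less_le)
  then have \<sigma>: "0 < \<sigma>" "\<sigma>\<^sup>2 = s \<bullet> (cov *v s)" by (simp_all add: \<sigma>_def)
  have same: "distr M borel (deviation s n) = distr M borel (deviation s 0)" for n
  proof -
    have "distr M borel (deviation s n) = distr (distr M borel (\<xi> (Suc n))) borel (\<lambda>y. s \<bullet> (y - mean))" for n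
      by (subst distr_distr) (auto simp: deviation_def[abs_def] comp_def)
    then show ?thesis by (simp add: law)
  qed
  have "weak_conv_m (\<lambda>N. distr M borel (\<lambda>\<omega>. (\<Sum>n<N. deviation s n \<omega>) / sqrt (N * \<sigma>\<^sup>2))) std_normal_distribution"
    by (rule central_limit_theorem_zero_mean[OF deviation_indep expectation_deviation \<sigma>(1)
          integrable_deviation_square _ same])
      (simp add: expectation_deviation expectation_deviation_square \<sigma>(2))
  then have "(\<lambda>N. char (distr M borel (\<lambda>\<omega>. (\<Sum>n<N. deviation s n \<omega>) / sqrt (N * \<sigma>\<^sup>2))) \<sigma>)
      \<longlonglongrightarrow> char std_normal_distribution \<sigma>"
    by (intro levy_continuity1) (auto intro!: real_distribution_distr real_dist_normal_dist)
  moreover have "char (distr M borel (\<lambda>\<omega>. (\<Sum>n<N. deviation s n \<omega>) / sqrt (N * \<sigma>\<^sup>2))) \<sigma>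
      = (CLINT \<omega>|M. iexp (s \<bullet> scaled_error N \<omega>))" if "N \<ge> 1" for N
  proof -
    have "\<sigma> * ((\<Sum>n<N. deviation s n \<omega>) / sqrt (N * \<sigma>\<^sup>2)) = s \<bullet> scaled_error N \<omega>" for \<omega>
      using \<sigma>(1) that by (simp add: inner_scaled_error real_sqrt_mult)
    then show ?thesis unfolding char_def
      by (subst integral_distr) (simp_all del: of_real_mult of_real_divide)
  qed
  then have "\<forall>\<^sub>F N in sequentially. char (distr M borel (\<lambda>\<omega>. (\<Sum>n<N. deviation s n \<omega>) / sqrt (N * \<sigma>\<^sup>2))) \<sigma>
      = (CLINT \<omega>|M. iexp (s \<bullet> scaled_error N \<omega>))"
    by (auto simp: eventually_sequentially)
  ultimately have "(\<lambda>N. CLINT \<omega>|M. iexp (s \<bullet> scaled_error N \<omega>)) \<longlonglongrightarrow> char std_normal_distribution \<sigma>"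
    by (rule Lim_transform_eventually)
  then show ?thesis by (simp add: char_std_normal_distribution \<sigma>(2)[symmetric])
qed

lemma scaled_error_tight:
  assumes "0 < \<epsilon>"
  obtains R where "0 < R" and "\<And>N. N \<ge> 1 \<Longrightarrow> prob {\<omega> \<in> space M. R < norm (scaled_error N \<omega>)} < \<epsilon>"
proof -
  define C where "C = (\<Sum>i\<in>UNIV. cov $ i $ i)"
  have C: "0 \<le> C"
    unfolding C_def by (intro sum_nonneg positive_semidefinite_diag_nonneg cov_positive_semidefinite)
  define R where "R = sqrt ((C + 1) / \<epsilon>)"
  have R: "0 < R" "R\<^sup>2 = (C + 1) / \<epsilon>" using C assms by (simp_all add: R_def)
  have "C / R\<^sup>2 < \<epsilon>" using C assms by (simp add: R(2) field_simps)
  then show thesis using that[OF R(1)] scaled_error_tail[OF _ R(1)] unfolding C_def[symmetric]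
    by (meson le_less_trans)
qed

text \<open>
  The scaled estimation error is \<open>G\<close> applied to the scaled error of the mean plus a remainder. The
  former is tight by a second moment bound. Where the scaled error of the mean is at most \<open>R\<close>, the sample
  mean is within \<open>R / \<surd>N\<close> of the true mean, and differentiability makes the remainder small. So the remainder
  vanishes in probability, changes neither tightness nor the limit of the characteristic functions,
  and the estimator itself converges in probability, hence lies in the open
  set \<open>\<Theta>\<close> with probability tending to one.
\<close>
theorem delta_method:
  fixes g :: "real ^ 'm \<Rightarrow> real ^ 'd::finite" and G :: "real ^ 'm ^ 'd"
  assumes der: "(g has_derivative (\<lambda>v. G *v v)) (at mean)"
    and T: "\<And>N \<omega>. T N \<omega> = g (sample_mean N (\<lambda>n. \<xi> n \<omega>))"
    and Tmeas[measurable]: "\<And>N. T N \<in> borel_measurable M"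
    and \<Theta>: "open \<Theta>" "g mean \<in> \<Theta>"
  shows "has_asymptotic_covariance M T \<Theta> (g mean) (G ** cov ** transpose G)"
proof -
  define W where "W N \<omega> = sqrt (real N) *\<^sub>R (T N \<omega> - g mean)" for N \<omega>
  define D where "D N \<omega> = W N \<omega> - G *v scaled_error N \<omega>" for N \<omega>
  have lin: "bounded_linear (\<lambda>v. G *v v)" using der by (rule has_derivative_bounded_linear)
  have [measurable]: "(\<lambda>v. G *v v) \<in> borel_measurable borel"
    by (rule borel_measurable_continuous_onI) (intro linear_continuous_on lin)
  have [measurable]: "W N \<in> borel_measurable M" "D N \<in> borel_measurable M" for N
    unfolding W_def[abs_def] D_def[abs_def] by measurable
  have remainder: "\<forall>\<^sub>F N in sequentially. prob {\<omega> \<in> space M. \<eta> < norm (D N \<omega>)} < \<epsilon>"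
    if \<eta>: "0 < \<eta>" and \<epsilon>: "0 < \<epsilon>" for \<eta> \<epsilon>
  proof -
    obtain R where R: "0 < R" "\<And>N. N \<ge> 1 \<Longrightarrow> prob {\<omega> \<in> space M. R < norm (scaled_error N \<omega>)} < \<epsilon>"
      using scaled_error_tight[OF \<epsilon>] by metis
    obtain \<delta> where \<delta>: "0 < \<delta>" and approx: "\<And>y. norm (y - mean) < \<delta> \<Longrightarrow>
        norm (g y - g mean - G *v (y - mean)) \<le> \<eta> / R * norm (y - mean)"
      using der \<eta> R(1) unfolding has_derivative_at_alt by (meson divide_pos_pos)
    have "\<forall>\<^sub>F N in sequentially. (R / \<delta>)\<^sup>2 < real N"
      using filterlim_real_sequentially by (simp add: filterlim_at_top_dense)
    then show ?thesis using eventually_ge_at_top[of 1]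
    proof eventually_elim
      case (elim N)
      have "R / \<delta> < sqrt (real N)" using elim by (simp add: real_less_rsqrt)
      then have small: "R < \<delta> * sqrt (real N)" using \<delta> by (simp add: field_simps)
      have "norm (D N \<omega>) \<le> \<eta>" if "norm (scaled_error N \<omega>) \<le> R" for \<omega>
      proof -
        define y where "y = sample_mean N (\<lambda>n. \<xi> n \<omega>)"
        have N0: "0 < sqrt (real N)" using elim by simp
        have se: "norm (scaled_error N \<omega>) = sqrt (real N) * norm (y - mean)"
          by (simp add: scaled_error_def y_def)
        then have "sqrt (real N) * norm (y - mean) < sqrt (real N) * \<delta>"
          using that small by (simp add: mult.commute)
        then have "norm (y - mean) < \<delta>" using N0 by simp
        then have a: "norm (g y - g mean - G *v (y - mean)) \<le> \<eta> / R * norm (y - mean)" by (rule approx)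
        have "G *v scaled_error N \<omega> = sqrt (real N) *\<^sub>R (G *v (y - mean))"
          by (simp only: scaled_error_def y_def matrix_vector_mult_scaleR)
        then have "D N \<omega> = sqrt (real N) *\<^sub>R (g y - g mean - G *v (y - mean))"
          by (simp only: D_def W_def T y_def scaleR_diff_right)
        then have "norm (D N \<omega>) = sqrt (real N) * norm (g y - g mean - G *v (y - mean))" by simp
        also have "\<dots> \<le> sqrt (real N) * (\<eta> / R * norm (y - mean))"
          using a N0 by (intro mult_left_mono) auto
        also have "\<dots> = \<eta> / R * norm (scaled_error N \<omega>)" by (simp add: se)
        also have "\<dots> \<le> \<eta> / R * R" using that \<eta> R(1) by (intro mult_left_mono) auto
        finally show ?thesis using R(1) by simp
      qed
      then have "prob {\<omega> \<in> space M. \<eta> < norm (D N \<omega>)} \<le> prob {\<omega> \<in> space M. R < norm (scaled_error N \<omega>)}"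
        by (intro finite_measure_mono) (auto simp: not_le[symmetric])
      then show ?case using R(2)[OF elim(2)] by simp
    qed
  qed
  have tight: "\<exists>R. \<forall>\<^sub>F N in sequentially. prob {\<omega> \<in> space M. R < norm (W N \<omega>)} < \<epsilon>" if \<epsilon>: "0 < \<epsilon>" for \<epsilon>
  proof -
    obtain K where K: "0 < K" "\<And>v. norm (G *v v) \<le> norm v * K"
      using bounded_linear.pos_bounded[OF lin] by blast
    obtain R where R: "\<And>N. N \<ge> 1 \<Longrightarrow> prob {\<omega> \<in> space M. R < norm (scaled_error N \<omega>)} < \<epsilon> / 2"
      using scaled_error_tight[of "\<epsilon> / 2"] \<epsilon> by (metis half_gt_zero)
    have "\<forall>\<^sub>F N in sequentially. prob {\<omega> \<in> space M. R * K + 1 < norm (W N \<omega>)} < \<epsilon>"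
      using remainder[of 1 "\<epsilon> / 2", simplified, OF \<epsilon>] eventually_ge_at_top[of 1]
    proof eventually_elim
      case (elim N)
      have "norm (W N \<omega>) \<le> R * K + 1" if "norm (scaled_error N \<omega>) \<le> R" "norm (D N \<omega>) \<le> 1" for \<omega>
      proof -
        have "W N \<omega> = G *v scaled_error N \<omega> + D N \<omega>" by (simp add: D_def)
        then have "norm (W N \<omega>) \<le> norm (G *v scaled_error N \<omega>) + norm (D N \<omega>)"
          by (simp add: norm_triangle_ineq)
        also have "\<dots> \<le> R * K + 1"
          using K(2)[of "scaled_error N \<omega>"] mult_right_mono[OF that(1), of K] K(1) that(2) by linarith
        finally show ?thesis .
      qed
      then have "prob {\<omega> \<in> space M. R * K + 1 < norm (W N \<omega>)}
          \<le> prob ({\<omega> \<in> space M. R < norm (scaled_error N \<omega>)} \<union> {\<omega> \<in> space M. 1 < norm (D N \<omega>)})"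
        by (intro finite_measure_mono) (auto simp: not_le[symmetric])
      also have "\<dots> \<le> prob {\<omega> \<in> space M. R < norm (scaled_error N \<omega>)} + prob {\<omega> \<in> space M. 1 < norm (D N \<omega>)}"
        by (rule measure_Un_le) auto
      finally show ?case using elim R[of N] by simp
    qed
    then show ?thesis by blast
  qed
  have in_\<Theta>: "(\<lambda>N. prob {\<omega> \<in> space M. T N \<omega> \<in> \<Theta>}) \<longlonglongrightarrow> 1"
  proof (rule tendstoI)
    fix \<epsilon> :: real assume \<epsilon>: "0 < \<epsilon>"
    obtain r where r: "0 < r" "ball (g mean) r \<subseteq> \<Theta>" using \<Theta> openE by blast
    obtain R where R: "\<forall>\<^sub>F N in sequentially. prob {\<omega> \<in> space M. R < norm (W N \<omega>)} < \<epsilon>" using tight[OF \<epsilon>] by blast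
    have "\<forall>\<^sub>F N in sequentially. (\<bar>R\<bar> / r)\<^sup>2 < real N"
      using filterlim_real_sequentially by (simp add: filterlim_at_top_dense)
    then show "\<forall>\<^sub>F N in sequentially. dist (prob {\<omega> \<in> space M. T N \<omega> \<in> \<Theta>}) 1 < \<epsilon>" using R
    proof eventually_elim
      case (elim N)
      have [measurable]: "\<Theta> \<in> sets borel" using \<Theta> by simp
      have "\<bar>R\<bar> / r < sqrt (real N)" using elim by (simp add: real_less_rsqrt)
      then have big: "R < sqrt (real N) * r" using r by (simp add: field_simps)
      have "R < norm (W N \<omega>)" if "T N \<omega> \<notin> \<Theta>" for \<omega>
      proof -
        have "r \<le> norm (T N \<omega> - g mean)"
          using that r(2) by (auto simp: dist_norm norm_minus_commute not_less[symmetric])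
        then have "sqrt (real N) * r \<le> norm (W N \<omega>)" by (simp add: W_def mult_left_mono)
        with big show ?thesis by simp
      qed
      then have "prob {\<omega> \<in> space M. \<not> T N \<omega> \<in> \<Theta>} \<le> prob {\<omega> \<in> space M. R < norm (W N \<omega>)}"
        by (intro finite_measure_mono) auto
      moreover have "prob {\<omega> \<in> space M. \<not> T N \<omega> \<in> \<Theta>} = 1 - prob {\<omega> \<in> space M. T N \<omega> \<in> \<Theta>}"
        by (rule prob_neg) measurable
      ultimately show ?case using elim prob_le_1[of "{\<omega> \<in> space M. T N \<omega> \<in> \<Theta>}"]
        by (simp add: dist_real_def)
    qed
  qed
  have char: "(\<lambda>N. CLINT \<omega>|M. iexp (t \<bullet> W N \<omega>))
      \<longlonglongrightarrow> complex_of_real (exp (- (t \<bullet> ((G ** cov ** transpose G) *v t)) / 2))" for t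
  proof -
    have tG: "t \<bullet> (G *v v) = (transpose G *v t) \<bullet> v" for v
      by (simp add: dot_lmul_matrix[symmetric] transpose_matrix_vector)
    have int: "integrable M (\<lambda>\<omega>. iexp (f \<omega>))" if "f \<in> borel_measurable M" for f :: "'a \<Rightarrow> real"
      using that by (intro integrable_const_bound[where B=1]) auto
    have "(\<lambda>N. (CLINT \<omega>|M. iexp (t \<bullet> W N \<omega>)) - (CLINT \<omega>|M. iexp ((transpose G *v t) \<bullet> scaled_error N \<omega>))) \<longlonglongrightarrow> 0"
    proof (rule tendstoI)
      fix \<epsilon> :: real assume \<epsilon>: "0 < \<epsilon>"
      \<comment> \<open>the difference is at most \<open>norm t * \<eta>\<close> where the remainder is below \<open>\<eta>\<close>, and at most \<open>2\<close> elsewhere\<close>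
      define \<eta> where "\<eta> = \<epsilon> / (2 * (norm t + 1))"
      have t1: "0 < norm t + 1" by (simp add: add_nonneg_pos)
      have \<eta>: "0 < \<eta>" "norm t * \<eta> \<le> \<epsilon> / 2"
        using \<epsilon> t1 by (simp_all add: \<eta>_def field_simps)
      show "\<forall>\<^sub>F N in sequentially. dist ((CLINT \<omega>|M. iexp (t \<bullet> W N \<omega>)) -
          (CLINT \<omega>|M. iexp ((transpose G *v t) \<bullet> scaled_error N \<omega>))) 0 < \<epsilon>"
        unfolding dist_norm diff_zero
      proof (rule eventually_mono[OF remainder[of \<eta> "\<epsilon> / 4"]])
        show "0 < \<eta>" "0 < \<epsilon> / 4" using \<eta>(1) \<epsilon> by simp_all
        fix N assume N: "prob {\<omega> \<in> space M. \<eta> < norm (D N \<omega>)} < \<epsilon> / 4"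
        let ?d = "\<lambda>\<omega>. iexp (t \<bullet> W N \<omega>) - iexp ((transpose G *v t) \<bullet> scaled_error N \<omega>)"
        have bound: "cmod (?d \<omega>) \<le> norm t * \<eta> + 2 * indicator {\<omega> \<in> space M. \<eta> < norm (D N \<omega>)} \<omega>"
          if "\<omega> \<in> space M" for \<omega>
        proof (cases "\<eta> < norm (D N \<omega>)")
          case True
          have "cmod (?d \<omega>) \<le> 1 + 1" by (rule order_trans[OF norm_triangle_ineq4]) simp
          moreover have "0 \<le> norm t * \<eta>" using \<eta>(1) by simp
          ultimately show ?thesis using True that by simp
        next
          case False
          have "cmod (?d \<omega>) \<le> \<bar>t \<bullet> W N \<omega> - (transpose G *v t) \<bullet> scaled_error N \<omega>\<bar>"
            by (rule norm_iexp_diff_le)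
          also have "\<dots> = \<bar>t \<bullet> D N \<omega>\<bar>" by (simp add: D_def inner_diff_right tG)
          also have "\<dots> \<le> norm t * norm (D N \<omega>)" by (rule Cauchy_Schwarz_ineq2)
          also have "\<dots> \<le> norm t * \<eta>" using False by (intro mult_left_mono) auto
          finally show ?thesis using False by simp
        qed
        have "cmod ((CLINT \<omega>|M. iexp (t \<bullet> W N \<omega>)) - (CLINT \<omega>|M. iexp ((transpose G *v t) \<bullet> scaled_error N \<omega>)))
            = cmod (CLINT \<omega>|M. ?d \<omega>)"
          by (subst Bochner_Integration.integral_diff) (auto intro!: int)
        also have "\<dots> \<le> expectation (\<lambda>\<omega>. cmod (?d \<omega>))" by (rule integral_norm_bound)
        also have "\<dots> \<le> expectation (\<lambda>\<omega>. norm t * \<eta> + 2 * indicator {\<omega> \<in> space M. \<eta> < norm (D N \<omega>)} \<omega>)"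
        proof (rule integral_mono)
          show "integrable M (\<lambda>\<omega>. cmod (?d \<omega>))"
            by (intro integrable_norm Bochner_Integration.integrable_diff int) auto
          show "integrable M (\<lambda>\<omega>. norm t * \<eta> + 2 * indicator {\<omega> \<in> space M. \<eta> < norm (D N \<omega>)} \<omega>)"
            by (intro Bochner_Integration.integrable_add integrable_mult_right integrable_real_indicator)
              (auto simp: less_top[symmetric])
        qed (rule bound)
        also have "\<dots> = norm t * \<eta> + 2 * prob {\<omega> \<in> space M. \<eta> < norm (D N \<omega>)}"
          by (subst Bochner_Integration.integral_add) (auto simp: prob_space less_top[symmetric])
        also have "\<dots> < \<epsilon>" using N \<eta>(2) by simp
        finally show "cmod ((CLINT \<omega>|M. iexp (t \<bullet> W N \<omega>)) - (CLINT \<omega>|M. iexp ((transpose G *v t) \<bullet> scaled_error N \<omega>))) < \<epsilon>" .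
      qed
    qed
    from tendsto_add[OF this scaled_error_char[of "transpose G *v t"]]
    show ?thesis by (simp only: diff_add_cancel add_0 quadratic_form_congruence)
  qed
  have psd: "positive_semidefinite (G ** cov ** transpose G)"
    using cov_positive_semidefinite
    by (simp add: positive_semidefinite_def quadratic_form_congruence matrix_transpose_mul matrix_mul_assoc)
  then obtain \<mu> where \<mu>: "centered_normal (G ** cov ** transpose G) \<mu>" using centered_normal_exists by blast
  have "weakly_converges (\<lambda>N. distr M borel (W N)) \<mu>"
  proof (rule weakly_converges_if_char_converges)
    show "prob_space (distr M borel (W N))" for N by (rule prob_space_distr) simp
    show "prob_space \<mu>" "sets \<mu> = sets borel" using \<mu> by (simp_all add: centered_normal_def)
    show "\<exists>R. \<forall>\<^sub>F N in sequentially. measure (distr M borel (W N)) {x. R < norm x} < \<epsilon>" if "0 < \<epsilon>" for \<epsilon>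
    proof -
      have "measure (distr M borel (W N)) {x. R < norm x} = prob {\<omega> \<in> space M. R < norm (W N \<omega>)}" for N R
        by (subst measure_distr) (auto simp: vimage_def Int_def conj_commute)
      then show ?thesis using tight[OF that] by simp
    qed
    show "(\<lambda>N. CLINT x|distr M borel (W N). iexp (t \<bullet> x)) \<longlonglongrightarrow> (CLINT x|\<mu>. iexp (t \<bullet> x))" for t
    proof -
      have "(CLINT x|distr M borel (W N). iexp (t \<bullet> x)) = (CLINT \<omega>|M. iexp (t \<bullet> W N \<omega>))" for N
        by (rule integral_distr) auto
      then show ?thesis using char[of t] \<mu> by (simp add: centered_normal_def)
    qed
  qed simp
  then show ?thesis
    using in_\<Theta> \<mu> unfolding has_asymptotic_covariance_def W_def by auto
qed

end

section \<open>Moments of the Dirichlet and Gamma distributions\<close>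

lemma AE_dirichlet_simplex:
  fixes \<alpha> :: "real ^ 'k::{finite,linorder}"
  shows "AE w in dirichlet_distribution \<alpha>. (\<forall>i. 0 < w $ i \<and> w $ i < 1) \<and> (\<Sum>i\<in>UNIV. w $ i) = 1"
proof -
  let ?P = "\<lambda>w :: (real, 'k) vec. (\<forall>i. 0 < w $ i \<and> w $ i < 1) \<and> (\<Sum>i\<in>UNIV. w $ i) = 1"
  have "{w \<in> space borel. ?P w} \<in> sets borel" by measurable
  then show ?thesis unfolding dirichlet_distribution_def
    by (subst AE_distr_iff) (auto simp: AE_density dirichlet_density_def)
qed

lemma Gamma_real_nonzero: "0 < x \<Longrightarrow> Gamma (x :: real) \<noteq> 0"
  using less_imp_neq[OF Gamma_real_pos[of x]] by metis

lemma AE_dirichlet_entry: "AE w in dirichlet_distribution \<alpha>. 0 < w $ j \<and> w $ j < 1"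
  using AE_dirichlet_simplex[of \<alpha>] by eventually_elim simp

text \<open>The value of \<open>E(W\<^sub>j\<^sup>r)\<close>; negative \<open>r > - \<alpha>\<^sub>j\<close> are allowed.\<close>
definition dirichlet_moment :: "real ^ 'k::finite \<Rightarrow> 'k \<Rightarrow> real \<Rightarrow> real" where
  "dirichlet_moment \<alpha> j r =
    Gamma (\<alpha> $ j + r) * Gamma (\<Sum>i\<in>UNIV. \<alpha> $ i) / (Gamma (\<alpha> $ j) * Gamma ((\<Sum>i\<in>UNIV. \<alpha> $ i) + r))"

definition shift_param :: "real ^ 'k::finite \<Rightarrow> 'k \<Rightarrow> real \<Rightarrow> real ^ 'k::finite" where
  "shift_param \<alpha> j r = (\<chi> i. if i = j then \<alpha> $ j + r else \<alpha> $ i)"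

lemma sum_shift_param: "(\<Sum>i\<in>UNIV. shift_param \<alpha> j r $ i) = (\<Sum>i\<in>UNIV. \<alpha> $ i) + r"
proof -
  have "shift_param \<alpha> j r $ i = \<alpha> $ i + (if i = j then r else 0)" for i by (simp add: shift_param_def)
  then show ?thesis by (simp add: sum.distrib)
qed

context
  fixes \<alpha> :: "real ^ 'k::{finite,linorder}"
  assumes card: "2 \<le> CARD('k)" and pos: "\<And>i. 0 < \<alpha> $ i"
begin

lemma sum_param_gt: "\<alpha> $ j < (\<Sum>i\<in>UNIV. \<alpha> $ i)"
proof -
  have "UNIV - {j} \<noteq> {}"
  proof
    assume "UNIV - {j} = {}"
    then have "(UNIV :: 'k set) = {j}" by auto
    then have "CARD('k) = card {j}" by (simp only:)
    with card show False by simp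
  qed
  then have "0 < (\<Sum>i\<in>UNIV - {j}. \<alpha> $ i)" using pos by (intro sum_pos) auto
  then show ?thesis by (simp add: sum.remove[of UNIV j])
qed

lemma sum_param_pos: "0 < (\<Sum>i\<in>UNIV. \<alpha> $ i)"
  using sum_param_gt[of undefined] pos[of undefined] by simp

lemma dirichlet_moment_pos:
  assumes "0 < \<alpha> $ j + r"
  shows "0 < dirichlet_moment \<alpha> j r"
  using assms sum_param_gt[of j] sum_param_pos pos
  by (simp add: dirichlet_moment_def Gamma_real_pos)

lemma dirichlet_density_size_bias:
  assumes r: "0 < \<alpha> $ j + r"
  shows "(w $ j) powr r * dirichlet_density \<alpha> w
    = dirichlet_moment \<alpha> j r * dirichlet_density (shift_param \<alpha> j r) w"
proof (cases "(\<forall>i. 0 < w $ i \<and> w $ i < 1) \<and> (\<Sum>i\<in>UNIV. w $ i) = 1")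
  case True
  define A where "A = (\<Sum>i\<in>UNIV. \<alpha> $ i)"
  have prod: "(\<Prod>i\<in>UNIV. f i (shift_param \<alpha> j r $ i)) = f j (\<alpha> $ j + r) * (\<Prod>i\<in>UNIV - {j}. f i (\<alpha> $ i))"
    for f :: "'k \<Rightarrow> real \<Rightarrow> real"
    by (subst prod.remove[of UNIV j]) (auto simp: shift_param_def intro!: prod.cong)
  have split: "(\<Prod>i\<in>UNIV. f i (\<alpha> $ i)) = f j (\<alpha> $ j) * (\<Prod>i\<in>UNIV - {j}. f i (\<alpha> $ i))"
    for f :: "'k \<Rightarrow> real \<Rightarrow> real"
    by (subst prod.remove[of UNIV j]) auto
  have "(w $ j) powr (\<alpha> $ j + r - 1) = (w $ j) powr r * (w $ j) powr (\<alpha> $ j - 1)"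
    by (simp add: powr_add[symmetric] algebra_simps)
  moreover have "0 < Gamma (A + r)" "0 < Gamma (\<alpha> $ j)" "0 < Gamma (\<alpha> $ j + r)"
    using r pos sum_param_gt[of j] by (auto intro!: Gamma_real_pos simp: A_def)
  moreover have "0 < (\<Prod>i\<in>UNIV - {j}. Gamma (\<alpha> $ i))" using pos by (intro prod_pos) (simp add: Gamma_real_pos)
  ultimately show ?thesis using True
    unfolding dirichlet_density_def dirichlet_moment_def sum_shift_param
      prod[of "\<lambda>_. Gamma"] prod[of "\<lambda>i a. (w $ i) powr (a - 1)"]
      split[of "\<lambda>_. Gamma"] split[of "\<lambda>i a. (w $ i) powr (a - 1)"] A_def[symmetric]
    by (simp add: field_simps)
next
  case False
  show ?thesis unfolding dirichlet_density_def if_not_P[OF False] by simp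
qed

lemma shift_param_pos: "0 < \<alpha> $ j + r \<Longrightarrow> 0 < shift_param \<alpha> j r $ i"
  using pos by (simp add: shift_param_def)

text \<open>
  Size biasing stays within the Dirichlet family. Every moment below comes from this identity and
  the fact that Dirichlet measures have mass one.
\<close>
lemma dirichlet_size_bias:
  assumes r: "0 < \<alpha> $ j + r"
  shows "density (dirichlet_distribution \<alpha>) (\<lambda>w. ennreal ((w $ j) powr r))
    = density (dirichlet_distribution (shift_param \<alpha> j r)) (\<lambda>w. ennreal (dirichlet_moment \<alpha> j r))"
proof (rule measure_eqI)
  fix A assume "A \<in> sets (density (dirichlet_distribution \<alpha>) (\<lambda>w. ennreal ((w $ j) powr r)))"
  then have [measurable]: "A \<in> sets borel" by simp
  have eq: "ennreal (dirichlet_density \<alpha> w) * (ennreal ((w $ j) powr r) * indicator A w)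
      = ennreal (dirichlet_density (shift_param \<alpha> j r) w) * (ennreal (dirichlet_moment \<alpha> j r) * indicator A w)" for w
  proof -
    have "ennreal (dirichlet_density \<alpha> w) * ennreal ((w $ j) powr r)
        = ennreal (dirichlet_density (shift_param \<alpha> j r) w) * ennreal (dirichlet_moment \<alpha> j r)"
      using dirichlet_density_size_bias[OF r, of w] dirichlet_density_nonneg[OF pos, of w]
        dirichlet_density_nonneg[OF shift_param_pos[OF r], of w] dirichlet_moment_pos[OF r]
      by (simp add: ennreal_mult[symmetric] mult.commute)
    then show ?thesis by (simp add: mult.assoc[symmetric])
  qed
  show "emeasure (density (dirichlet_distribution \<alpha>) (\<lambda>w. ennreal ((w $ j) powr r))) A
      = emeasure (density (dirichlet_distribution (shift_param \<alpha> j r)) (\<lambda>w. ennreal (dirichlet_moment \<alpha> j r))) A"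
    by (simp add: emeasure_density dirichlet_distribution_def nn_integral_distr nn_integral_density eq)
qed simp

lemma
  fixes f :: "real ^ 'k::{finite,linorder} \<Rightarrow> real"
  assumes r: "0 < \<alpha> $ j + r" and f[measurable]: "f \<in> borel_measurable borel"
  shows integral_dirichlet_size_bias: "(\<integral>w. (w $ j) powr r * f w \<partial>dirichlet_distribution \<alpha>)
      = dirichlet_moment \<alpha> j r * (\<integral>w. f w \<partial>dirichlet_distribution (shift_param \<alpha> j r))"
    and integrable_dirichlet_size_bias: "integrable (dirichlet_distribution (shift_param \<alpha> j r)) f
      \<Longrightarrow> integrable (dirichlet_distribution \<alpha>) (\<lambda>w. (w $ j) powr r * f w)"
proof -
  let ?D = "dirichlet_distribution \<alpha>" and ?D' = "dirichlet_distribution (shift_param \<alpha> j r)"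
  have "(\<integral>w. (w $ j) powr r * f w \<partial>?D) = (\<integral>w. f w \<partial>density ?D (\<lambda>w. ennreal ((w $ j) powr r)))"
    by (subst integral_density) auto
  also have "\<dots> = (\<integral>w. dirichlet_moment \<alpha> j r * f w \<partial>?D')"
    unfolding dirichlet_size_bias[OF r] using dirichlet_moment_pos[OF r] by (subst integral_density) auto
  finally show "(\<integral>w. (w $ j) powr r * f w \<partial>?D) = dirichlet_moment \<alpha> j r * (\<integral>w. f w \<partial>?D')" by simp
  assume "integrable ?D' f"
  then have "integrable (density ?D' (\<lambda>w. ennreal (dirichlet_moment \<alpha> j r))) f"
    using dirichlet_moment_pos[OF r] by (subst integrable_density) auto
  then have "integrable (density ?D (\<lambda>w. ennreal ((w $ j) powr r))) f"
    unfolding dirichlet_size_bias[OF r] .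
  then show "integrable ?D (\<lambda>w. (w $ j) powr r * f w)"
    by (subst (asm) integrable_density) auto
qed

lemma
  assumes r: "0 < \<alpha> $ j + r"
  shows dirichlet_powr_moment: "(\<integral>w. (w $ j) powr r \<partial>dirichlet_distribution \<alpha>) = dirichlet_moment \<alpha> j r"
    and integrable_dirichlet_powr: "integrable (dirichlet_distribution \<alpha>) (\<lambda>w. (w $ j) powr r)"
proof -
  interpret D': prob_space "dirichlet_distribution (shift_param \<alpha> j r)"
    by (rule prob_space_dirichlet[OF card shift_param_pos[OF r]])
  show "(\<integral>w. (w $ j) powr r \<partial>dirichlet_distribution \<alpha>) = dirichlet_moment \<alpha> j r"
  proof -
    have "(\<integral>w. (w $ j) powr r * 1 \<partial>dirichlet_distribution \<alpha>)
        = dirichlet_moment \<alpha> j r * (\<integral>w. 1 \<partial>dirichlet_distribution (shift_param \<alpha> j r))"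
      by (rule integral_dirichlet_size_bias[OF r]) simp
    also have "(\<integral>w. (1::real) \<partial>dirichlet_distribution (shift_param \<alpha> j r)) = 1"
      by (simp add: D'.prob_space)
    finally show ?thesis by (simp only: mult_1_right)
  qed
  show "integrable (dirichlet_distribution \<alpha>) (\<lambda>w. (w $ j) powr r)"
  proof -
    have "integrable (dirichlet_distribution \<alpha>) (\<lambda>w. (w $ j) powr r * 1)"
      by (rule integrable_dirichlet_size_bias[OF r]) simp_all
    then show ?thesis by (simp only: mult_1_right)
  qed
qed

lemma integrable_dirichlet_power: "integrable (dirichlet_distribution \<alpha>) (\<lambda>w. (w $ j) ^ n)"
proof -
  interpret prob_space "dirichlet_distribution \<alpha>" by (rule prob_space_dirichlet[OF card pos])
  have "AE w in dirichlet_distribution \<alpha>. norm ((w $ j) ^ n) \<le> 1"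
    using AE_dirichlet_entry[where \<alpha>=\<alpha> and j=j] by eventually_elim (simp add: power_le_one)
  then show ?thesis by (rule integrable_const_bound) simp
qed

lemma dirichlet_mean_entry:
  "(\<integral>w. w $ j \<partial>dirichlet_distribution \<alpha>) = \<alpha> $ j / (\<Sum>i\<in>UNIV. \<alpha> $ i)"
proof -
  have "(\<integral>w. w $ j \<partial>dirichlet_distribution \<alpha>) = (\<integral>w. (w $ j) powr 1 \<partial>dirichlet_distribution \<alpha>)"
    using AE_dirichlet_entry[where \<alpha>=\<alpha> and j=j] by (intro integral_cong_AE) (auto elim!: eventually_mono)
  also have "\<dots> = dirichlet_moment \<alpha> j 1" using pos[of j] by (intro dirichlet_powr_moment) simp
  also have "\<dots> = \<alpha> $ j / (\<Sum>i\<in>UNIV. \<alpha> $ i)"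
    using Gamma_real_nonzero[OF pos[of j]] Gamma_real_nonzero[OF sum_param_pos] pos[of j] sum_param_pos
    by (simp add: dirichlet_moment_def Gamma_plus1 nonpos_Ints_def)
  finally show ?thesis .
qed

lemma dirichlet_second_moment:
  defines "A \<equiv> \<Sum>i\<in>UNIV. \<alpha> $ i"
  shows "(\<integral>w. (w $ j)\<^sup>2 \<partial>dirichlet_distribution \<alpha>) = \<alpha> $ j * (\<alpha> $ j + 1) / (A * (A + 1))"
proof -
  have G2: "Gamma (a + 2) = (a + 1) * a * Gamma a" if "0 < a" for a :: real
  proof -
    have "a \<notin> \<int>\<^sub>\<le>\<^sub>0" "a + 1 \<notin> \<int>\<^sub>\<le>\<^sub>0" using that by (auto dest: nonpos_Ints_nonpos)
    then show ?thesis using Gamma_plus1[of a] Gamma_plus1[of "a + 1"] by (simp add: add.assoc)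
  qed
  have "(\<integral>w. (w $ j)\<^sup>2 \<partial>dirichlet_distribution \<alpha>) = (\<integral>w. (w $ j) powr 2 \<partial>dirichlet_distribution \<alpha>)"
    using AE_dirichlet_entry[where \<alpha>=\<alpha> and j=j] by (intro integral_cong_AE) (auto elim!: eventually_mono)
  also have "\<dots> = dirichlet_moment \<alpha> j 2" using pos[of j] by (intro dirichlet_powr_moment) simp
  also have "\<dots> = \<alpha> $ j * (\<alpha> $ j + 1) / (A * (A + 1))"
    using Gamma_real_nonzero[OF pos[of j]] Gamma_real_nonzero[OF sum_param_pos] pos[of j] sum_param_pos
    by (simp add: dirichlet_moment_def G2 A_def[symmetric] mult.commute)
  finally show ?thesis .
qed

text \<open>
  Since \<open>- ln w \<le> w\<^sup>-\<^sup>s / s\<close> for \<open>s > 0\<close>, the logarithm is dominated by a negative power, whose square is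
  integrable for \<open>2 s < \<alpha>\<^sub>j\<close>.
\<close>
lemma integrable_dirichlet_ln_square: "integrable (dirichlet_distribution \<alpha>) (\<lambda>w. (ln (w $ j))\<^sup>2)"
proof (rule Bochner_Integration.integrable_bound)
  \<comment> \<open>any \<open>s\<close> with \<open>0 < 2 * s < \<alpha> $ j\<close> will do\<close>
  define s where "s = \<alpha> $ j / 4"
  have s: "0 < s" using pos by (simp add: s_def)
  show "integrable (dirichlet_distribution \<alpha>) (\<lambda>w. (w $ j) powr (- 2 * s) / s\<^sup>2)"
    using pos[of j] by (intro integrable_divide integrable_dirichlet_powr) (simp add: s_def)
  show "AE w in dirichlet_distribution \<alpha>. norm ((ln (w $ j))\<^sup>2) \<le> norm ((w $ j) powr (- 2 * s) / s\<^sup>2)"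
    using AE_dirichlet_simplex[of \<alpha>]
  proof eventually_elim
    case (elim w)
    then have w: "0 < w $ j" "w $ j < 1" by auto
    then have "0 \<le> - ln (w $ j)" by simp
    moreover have "s * (- ln (w $ j)) \<le> (w $ j) powr (- s)"
      using ln_le_minus_one[of "(w $ j) powr (- s)"] w by (simp add: ln_powr)
    ultimately have "(s * (- ln (w $ j)))\<^sup>2 \<le> ((w $ j) powr (- s))\<^sup>2"
      using s by (intro power_mono) (auto simp: mult_le_0_iff)
    also have "\<dots> = (w $ j) powr (- 2 * s)"
      using w by (simp add: power2_eq_square powr_add[symmetric])
    finally show ?case using s by (simp add: power_mult_distrib field_simps)
  qed
qed simp

lemma integrable_dirichlet_ln: "integrable (dirichlet_distribution \<alpha>) (\<lambda>w. ln (w $ j))"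
proof -
  interpret prob_space "dirichlet_distribution \<alpha>" by (rule prob_space_dirichlet[OF card pos])
  show ?thesis by (rule integrable_of_square[OF _ integrable_dirichlet_ln_square]) simp
qed

lemma dirichlet_moment_deriv:
  "((\<lambda>r. dirichlet_moment \<alpha> j r) has_real_derivative Digamma (\<alpha> $ j) - Digamma (\<Sum>i\<in>UNIV. \<alpha> $ i)) (at 0)"
proof -
  define A where "A = (\<Sum>i\<in>UNIV. \<alpha> $ i)"
  have not: "\<alpha> $ j \<notin> \<int>\<^sub>\<le>\<^sub>0" "A \<notin> \<int>\<^sub>\<le>\<^sub>0"
    using pos[of j] sum_param_pos nonpos_Ints_nonpos by (force simp: A_def)+
  have ne: "Gamma (\<alpha> $ j) \<noteq> 0" "Gamma A \<noteq> 0"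
    using Gamma_real_nonzero[OF pos[of j]] Gamma_real_nonzero[OF sum_param_pos] by (simp_all add: A_def)
  show ?thesis
    unfolding dirichlet_moment_def A_def[symmetric]
    using not ne by (auto intro!: derivative_eq_intros simp: field_simps)
qed

text \<open>
  Differentiation of \<open>E(W\<^sub>j\<^sup>r)\<close> at \<open>r = 0\<close> under the integral. For \<open>0 < w < 1\<close> and \<open>r > 0\<close> the difference
  quotient \<open>(w\<^sup>r - 1) / r\<close> lies between \<open>ln w\<close> and \<open>0\<close>, so \<open>\<bar>ln w\<bar>\<close> dominates.
\<close>
lemma dirichlet_mean_ln:
  "(\<integral>w. ln (w $ j) \<partial>dirichlet_distribution \<alpha>) = Digamma (\<alpha> $ j) - Digamma (\<Sum>i\<in>UNIV. \<alpha> $ i)"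
proof -
  let ?D = "dirichlet_distribution \<alpha>"
  interpret prob_space ?D by (rule prob_space_dirichlet[OF card pos])
  define r where "r n = 1 / real (Suc n)" for n
  have r0: "0 < r n" for n by (simp add: r_def)
  have lim_r: "filterlim r (at 0) sequentially"
    unfolding filterlim_at using LIMSEQ_Suc[OF lim_1_over_n] r0
    by (auto simp: r_def[abs_def] intro!: always_eventually)
  have lim: "(\<lambda>n. \<integral>w. ((w $ j) powr r n - 1) / r n \<partial>?D) \<longlonglongrightarrow> (\<integral>w. ln (w $ j) \<partial>?D)"
  proof (rule integral_dominated_convergence[where w="\<lambda>w. \<bar>ln (w $ j)\<bar>"])
    show "integrable ?D (\<lambda>w. \<bar>ln (w $ j)\<bar>)" using integrable_dirichlet_ln by (rule integrable_abs)
    show "AE w in ?D. (\<lambda>n. ((w $ j) powr r n - 1) / r n) \<longlonglongrightarrow> ln (w $ j)"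
      using AE_dirichlet_simplex[of \<alpha>]
    proof eventually_elim
      case (elim w)
      then have w: "0 < w $ j" by auto
      have "((\<lambda>r. (w $ j) powr r) has_real_derivative ln (w $ j)) (at 0)"
        using w by (auto intro!: derivative_eq_intros)
      then have "((\<lambda>h. ((w $ j) powr h - 1) / h) \<longlongrightarrow> ln (w $ j)) (at 0)" using w by (simp add: DERIV_def)
      then show ?case by (rule filterlim_compose[OF _ lim_r])
    qed
    show "AE w in ?D. norm (((w $ j) powr r n - 1) / r n) \<le> \<bar>ln (w $ j)\<bar>" for n
      using AE_dirichlet_simplex[of \<alpha>]
    proof eventually_elim
      case (elim w)
      then have w: "0 < w $ j" "w $ j < 1" by auto
      have "(w $ j) powr r n \<le> 1" using w r0[of n] by (intro powr_le1) auto
      moreover have "r n * ln (w $ j) \<le> (w $ j) powr r n - 1"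
      proof -
        have "(w $ j) powr r n = exp (r n * ln (w $ j))" using w by (simp add: powr_def)
        then show ?thesis using exp_ge_add_one_self[of "r n * ln (w $ j)"] by linarith
      qed
      moreover have "ln (w $ j) < 0" using w by simp
      ultimately show ?case using r0[of n] by (simp add: abs_if field_simps)
    qed
  qed auto
  have eq: "(\<integral>w. ((w $ j) powr r n - 1) / r n \<partial>?D) = (dirichlet_moment \<alpha> j (r n) - dirichlet_moment \<alpha> j 0) / r n" for n
  proof -
    have "0 < \<alpha> $ j + r n" using pos[of j] r0[of n] by simp
    moreover have "dirichlet_moment \<alpha> j 0 = 1"
      using Gamma_real_nonzero[OF pos[of j]] Gamma_real_nonzero[OF sum_param_pos] by (simp add: dirichlet_moment_def)
    ultimately show ?thesis
      using dirichlet_powr_moment[of j "r n"] integrable_dirichlet_powr[of j "r n"] prob_space by simp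
  qed
  have "(\<lambda>n. (dirichlet_moment \<alpha> j (r n) - dirichlet_moment \<alpha> j 0) / r n)
      \<longlonglongrightarrow> Digamma (\<alpha> $ j) - Digamma (\<Sum>i\<in>UNIV. \<alpha> $ i)"
    by (rule filterlim_compose[OF _ lim_r]) (use dirichlet_moment_deriv[of j] in \<open>simp add: DERIV_def\<close>)
  with lim[unfolded eq] show ?thesis by (rule LIMSEQ_unique)
qed

lemma integrable_dirichlet_mult_ln_square: "integrable (dirichlet_distribution \<alpha>) (\<lambda>w. (w $ j * ln (w $ j))\<^sup>2)"
proof (rule Bochner_Integration.integrable_bound[OF integrable_dirichlet_ln_square[of j]])
  show "AE w in dirichlet_distribution \<alpha>. norm ((w $ j * ln (w $ j))\<^sup>2) \<le> norm ((ln (w $ j))\<^sup>2)"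
    using AE_dirichlet_simplex[of \<alpha>]
  proof eventually_elim
    case (elim w)
    then have "0 < w $ j" "w $ j < 1" by auto
    then have "(w $ j)\<^sup>2 \<le> 1" by (intro power_le_one) auto
    then show ?case by (simp add: power_mult_distrib mult_left_le_one_le)
  qed
qed simp

end

lemma dirichlet_mean_mult_ln:
  fixes \<alpha> :: "real ^ 'k::{finite,linorder}"
  assumes card: "2 \<le> CARD('k)" and pos: "\<And>i. 0 < \<alpha> $ i"
  defines "A \<equiv> \<Sum>i\<in>UNIV. \<alpha> $ i"
  shows "(\<integral>w. w $ j * ln (w $ j) \<partial>dirichlet_distribution \<alpha>)
    = \<alpha> $ j / A * (Digamma (\<alpha> $ j + 1) - Digamma (A + 1))"
proof -
  have r: "0 < \<alpha> $ j + 1" using pos[of j] by simp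
  have "(\<integral>w. w $ j * ln (w $ j) \<partial>dirichlet_distribution \<alpha>)
      = (\<integral>w. (w $ j) powr 1 * ln (w $ j) \<partial>dirichlet_distribution \<alpha>)"
    using AE_dirichlet_entry[where \<alpha>=\<alpha> and j=j] by (intro integral_cong_AE) (auto elim!: eventually_mono)
  also have "\<dots> = dirichlet_moment \<alpha> j 1 * (\<integral>w. ln (w $ j) \<partial>dirichlet_distribution (shift_param \<alpha> j 1))"
    by (rule integral_dirichlet_size_bias[OF card pos r]) simp
  also have "\<dots> = \<alpha> $ j / A * (Digamma (\<alpha> $ j + 1) - Digamma (A + 1))"
  proof -
    have "(\<integral>w. w $ j \<partial>dirichlet_distribution \<alpha>) = (\<integral>w. (w $ j) powr 1 \<partial>dirichlet_distribution \<alpha>)"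
      using AE_dirichlet_entry[where \<alpha>=\<alpha> and j=j] by (intro integral_cong_AE) (auto elim!: eventually_mono)
    then have "dirichlet_moment \<alpha> j 1 = \<alpha> $ j / A"
      using dirichlet_mean_entry[OF card pos, of j] dirichlet_powr_moment[OF card pos r] by (simp add: A_def)
    then show ?thesis
      using dirichlet_mean_ln[OF card shift_param_pos[OF card pos r], of j]
      by (simp add: sum_shift_param A_def[symmetric]) (simp add: shift_param_def)
  qed
  finally show ?thesis .
qed

text \<open>
  The Digamma values cancel by their recurrence. This is the elementary covariance that makes the
  SAME formula explicit.
\<close>
lemma dirichlet_covariance_ln:
  fixes \<alpha> :: "real ^ 'k::{finite,linorder}"
  assumes card: "2 \<le> CARD('k)" and pos: "\<And>i. 0 < \<alpha> $ i"
  defines "A \<equiv> \<Sum>i\<in>UNIV. \<alpha> $ i"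
  shows "(\<integral>w. w $ j * ln (w $ j) \<partial>dirichlet_distribution \<alpha>)
      - (\<integral>w. w $ j \<partial>dirichlet_distribution \<alpha>) * (\<integral>w. ln (w $ j) \<partial>dirichlet_distribution \<alpha>)
    = (1 - \<alpha> $ j / A) / A"
proof -
  have p: "0 < \<alpha> $ j" "0 < A" using pos[of j] sum_param_pos[OF card pos] by (simp_all add: A_def)
  have "(\<integral>w. w $ j * ln (w $ j) \<partial>dirichlet_distribution \<alpha>)
      - (\<integral>w. w $ j \<partial>dirichlet_distribution \<alpha>) * (\<integral>w. ln (w $ j) \<partial>dirichlet_distribution \<alpha>)
    = \<alpha> $ j / A * (1 / \<alpha> $ j - 1 / A)"
    using p unfolding dirichlet_mean_mult_ln[OF card pos] dirichlet_mean_entry[OF card pos]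
      dirichlet_mean_ln[OF card pos] A_def[symmetric]
    by (subst Digamma_plus1, simp, subst Digamma_plus1, simp) (simp add: field_simps)
  also have "\<dots> = (1 - \<alpha> $ j / A) / A" using p by (simp add: field_simps)
  finally show ?thesis .
qed

lemma gamma_density_size_bias:
  assumes "0 < a" and "0 < b"
  shows "s * gamma_density a b s = a * b * gamma_density (a + 1) b s"
proof (cases "0 < s")
  case True
  have "s * s powr (a - 1) = s powr a" using True by (simp add: powr_mult_base)
  moreover have "b powr (a + 1) = b * b powr a" using assms by (simp add: powr_add)
  moreover have "Gamma (a + 1) = a * Gamma a" using assms by (intro Gamma_plus1) (auto dest: nonpos_Ints_nonpos)
  moreover have "0 < Gamma a" using assms by (simp add: Gamma_real_pos)
  ultimately show ?thesis using True assms by (simp add: gamma_density_def field_simps)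
qed (simp add: gamma_density_def)

lemma gamma_density_integral:
  assumes "0 < a" and "0 < b"
  shows "integrable lborel (gamma_density a b)" and "(\<integral>s. gamma_density a b s \<partial>lborel) = 1"
  using nn_integral_gamma_density[OF assms] gamma_density_nonneg[OF assms(1)]
  by (auto intro!: integrableI_nonneg integral_eq_nn_integral simp: integral_eq_nn_integral)

lemma gamma_moments:
  assumes a: "0 < a" and b: "0 < b"
  defines "Q \<equiv> density lborel (\<lambda>s. ennreal (gamma_density a b s))"
  shows "integrable Q (\<lambda>s. s)" and "(\<integral>s. s \<partial>Q) = a * b"
    and "integrable Q (\<lambda>s. s\<^sup>2)" and "(\<integral>s. s\<^sup>2 \<partial>Q) = a * (a + 1) * b\<^sup>2"
proof -
  have one: "gamma_density a b s * s = a * b * gamma_density (a + 1) b s" for s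
    using gamma_density_size_bias[OF a b, of s] by (simp add: mult.commute)
  have two: "gamma_density a b s * s\<^sup>2 = a * (a + 1) * b\<^sup>2 * gamma_density (a + 2) b s" for s
  proof -
    have "gamma_density a b s * s\<^sup>2 = (gamma_density a b s * s) * s" by (simp add: power2_eq_square)
    also have "\<dots> = a * b * (s * gamma_density (a + 1) b s)" by (simp only: one) (simp only: mult_ac)
    also have "s * gamma_density (a + 1) b s = (a + 1) * b * gamma_density (a + 2) b s"
      using gamma_density_size_bias[of "a + 1" b s] a b by (simp add: add.assoc)
    finally show ?thesis by (simp add: power2_eq_square mult_ac)
  qed
  note simps = integrable_density integral_density gamma_density_nonneg[OF a] one two
  show "integrable Q (\<lambda>s. s)" "integrable Q (\<lambda>s. s\<^sup>2)"
    using gamma_density_integral(1)[of "a + 1" b] gamma_density_integral(1)[of "a + 2" b] a b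
    unfolding Q_def by (simp_all add: simps)
  show "(\<integral>s. s \<partial>Q) = a * b" "(\<integral>s. s\<^sup>2 \<partial>Q) = a * (a + 1) * b\<^sup>2"
    using gamma_density_integral(2)[of "a + 1" b] gamma_density_integral(2)[of "a + 2" b] a b
    unfolding Q_def by (simp_all add: simps)
qed

section \<open>From Dirichlet moments to the Multivariate Gamma family\<close>

lemma append_vec_Inl [simp]: "append_vec u v $ Inl i = u $ i"
  and append_vec_Inr [simp]: "append_vec u v $ Inr j = v $ j"
  by (simp_all add: append_vec_def)

lemma left_vec_append [simp]: "left_vec (append_vec u v) = u"
  and right_vec_append [simp]: "right_vec (append_vec u v) = v"
  by (simp_all add: left_vec_def right_vec_def vec_eq_iff)

lemma append_left_right [simp]: "append_vec (left_vec v) (right_vec v) = v"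
proof -
  have "append_vec (left_vec v) (right_vec v) $ i = v $ i" for i
    by (cases i) (simp_all add: left_vec_def right_vec_def)
  then show ?thesis by (simp add: vec_eq_iff)
qed

lemma vec_sum_eqI:
  assumes "\<And>i. u $ Inl i = v $ Inl i" and "\<And>j. u $ Inr j = v $ Inr j"
  shows "u = (v :: 'a ^ ('m::finite + 'n::finite))"
  using assms by (simp add: vec_eq_iff split_sum_all)

lemma vec_one_eta: "vec (v $ 1) = (v :: 'a ^ 1)"
  by (simp add: vec_eq_iff)

lemma mg_param_cases:
  fixes \<theta> :: "real ^ ('k::{finite,linorder} + 1)"
  assumes "\<theta> \<in> mg_param_space"
  obtains \<alpha> \<beta> where "\<theta> = mg_param \<alpha> \<beta>" and "\<And>i. 0 < \<alpha> $ i" and "0 < \<beta>"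
proof
  show "\<theta> = mg_param (left_vec \<theta>) (right_vec \<theta> $ 1)" by (simp add: mg_param_def vec_one_eta)
  show "0 < left_vec \<theta> $ i" for i using assms by (simp add: mg_param_space_def left_vec_def)
  show "0 < right_vec \<theta> $ 1" using assms by (simp add: mg_param_space_def right_vec_def)
qed

lemma mg_family_mg_param: "mg_family (mg_param \<alpha> \<beta>) = mg_distribution \<alpha> \<beta>"
  by (simp add: mg_family_def mg_param_def)

context
  fixes \<alpha> :: "real ^ 'k::{finite,linorder}" and \<beta> :: real
  assumes card: "2 \<le> CARD('k)" and pos: "\<And>i. 0 < \<alpha> $ i" and beta: "0 < \<beta>"
begin

abbreviation "alpha_sum \<equiv> \<Sum>i\<in>UNIV. \<alpha> $ i"
abbreviation "gamma_law \<equiv> density lborel (\<lambda>s. ennreal (gamma_density alpha_sum \<beta> s))"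

lemma distr_dirichlet_part: "distr (mg_distribution \<alpha> \<beta>) borel dirichlet_part = dirichlet_distribution \<alpha>"
proof -
  interpret G: prob_space gamma_law by (rule prob_space_gamma[OF sum_param_pos[OF card pos] beta])
  have "distr (mg_distribution \<alpha> \<beta>) borel dirichlet_part
      = distr (distr (mg_distribution \<alpha> \<beta>) (borel \<Otimes>\<^sub>M borel) (\<lambda>x. (dirichlet_part x, x $ last_ix))) borel fst"
    by (subst distr_distr) (auto simp: comp_def)
  also have "\<dots> = distr (dirichlet_distribution \<alpha> \<Otimes>\<^sub>M gamma_law) (dirichlet_distribution \<alpha>) fst"
    unfolding distr_mg_polar[OF card pos beta] by (rule distr_cong) auto
  also have "\<dots> = dirichlet_distribution \<alpha>" by (rule G.distr_pair_fst)
  finally show ?thesis .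
qed

lemma distr_last: "distr (mg_distribution \<alpha> \<beta>) borel (\<lambda>x. x $ last_ix) = gamma_law"
proof -
  interpret D: prob_space "dirichlet_distribution \<alpha>" by (rule prob_space_dirichlet[OF card pos])
  interpret G: prob_space gamma_law by (rule prob_space_gamma[OF sum_param_pos[OF card pos] beta])
  interpret pair_sigma_finite "dirichlet_distribution \<alpha>" gamma_law ..
  have "distr (mg_distribution \<alpha> \<beta>) borel (\<lambda>x. x $ last_ix)
      = distr (distr (mg_distribution \<alpha> \<beta>) (borel \<Otimes>\<^sub>M borel) (\<lambda>x. (dirichlet_part x, x $ last_ix))) borel snd"
    by (subst distr_distr) (auto simp: comp_def)
  also have "\<dots> = distr (dirichlet_distribution \<alpha> \<Otimes>\<^sub>M gamma_law) borel snd"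
    unfolding distr_mg_polar[OF card pos beta] ..
  also have "\<dots> = gamma_law"
  proof (rule measure_eqI)
    fix A assume "A \<in> sets (distr (dirichlet_distribution \<alpha> \<Otimes>\<^sub>M gamma_law) borel snd)"
    then have A: "A \<in> sets borel" by simp
    have "snd -` A \<inter> space (dirichlet_distribution \<alpha> \<Otimes>\<^sub>M gamma_law) = space (dirichlet_distribution \<alpha>) \<times> A"
      using sets.sets_into_space[OF A] by (auto simp: space_pair_measure)
    moreover have "emeasure (dirichlet_distribution \<alpha> \<Otimes>\<^sub>M gamma_law) (space (dirichlet_distribution \<alpha>) \<times> A)
        = emeasure (dirichlet_distribution \<alpha>) (space (dirichlet_distribution \<alpha>)) * emeasure gamma_law A"
      by (rule G.emeasure_pair_measure_Times) (use A sets.top[of "dirichlet_distribution \<alpha>"] in auto)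
    ultimately show "emeasure (distr (dirichlet_distribution \<alpha> \<Otimes>\<^sub>M gamma_law) borel snd) A = emeasure gamma_law A"
      using A by (subst emeasure_distr) (simp_all only: D.emeasure_space_1 mult_1 sets_distr measurable_snd, simp_all)
  qed simp
  finally show ?thesis .
qed

lemma integral_dirichlet_part:
  fixes f :: "real ^ 'k::{finite,linorder} \<Rightarrow> 'b::{banach,second_countable_topology}"
  assumes "f \<in> borel_measurable borel"
  shows "(\<integral>x. f (dirichlet_part x) \<partial>mg_distribution \<alpha> \<beta>) = (\<integral>w. f w \<partial>dirichlet_distribution \<alpha>)"
    and "integrable (mg_distribution \<alpha> \<beta>) (\<lambda>x. f (dirichlet_part x)) \<longleftrightarrow> integrable (dirichlet_distribution \<alpha>) f"
  using assms unfolding distr_dirichlet_part[symmetric]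
  by (simp_all add: integral_distr integrable_distr_eq)

lemma integral_last:
  fixes f :: "real \<Rightarrow> real"
  assumes "f \<in> borel_measurable borel"
  shows "(\<integral>x. f (x $ last_ix) \<partial>mg_distribution \<alpha> \<beta>) = (\<integral>s. f s \<partial>gamma_law)"
    and "integrable (mg_distribution \<alpha> \<beta>) (\<lambda>x. f (x $ last_ix)) \<longleftrightarrow> integrable gamma_law f"
  using assms unfolding distr_last[symmetric]
  by (simp_all add: integral_distr integrable_distr_eq)

lemma last_moments:
  shows "integrable (mg_distribution \<alpha> \<beta>) (\<lambda>x. x $ last_ix)"
    and "(\<integral>x. x $ last_ix \<partial>mg_distribution \<alpha> \<beta>) = alpha_sum * \<beta>"
    and "integrable (mg_distribution \<alpha> \<beta>) (\<lambda>x. (x $ last_ix)\<^sup>2)"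
    and "(\<integral>x. (x $ last_ix - alpha_sum * \<beta>)\<^sup>2 \<partial>mg_distribution \<alpha> \<beta>) = alpha_sum * \<beta>\<^sup>2"
proof -
  note gm = gamma_moments[OF sum_param_pos[OF card pos] beta]
  interpret G: prob_space gamma_law by (rule prob_space_gamma[OF sum_param_pos[OF card pos] beta])
  show "integrable (mg_distribution \<alpha> \<beta>) (\<lambda>x. x $ last_ix)"
    by (rule integral_last(2)[THEN iffD2, OF _ gm(1)]) simp
  show "(\<integral>x. x $ last_ix \<partial>mg_distribution \<alpha> \<beta>) = alpha_sum * \<beta>"
    by (rule trans[OF integral_last(1) gm(2)]) simp
  show "integrable (mg_distribution \<alpha> \<beta>) (\<lambda>x. (x $ last_ix)\<^sup>2)"
    by (rule integral_last(2)[THEN iffD2, OF _ gm(3)]) simp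
  have "(\<integral>x. (x $ last_ix - alpha_sum * \<beta>)\<^sup>2 \<partial>mg_distribution \<alpha> \<beta>) = G.variance (\<lambda>s. s)"
    unfolding gm(2) by (rule integral_last(1)) simp
  also have "\<dots> = alpha_sum * (alpha_sum + 1) * \<beta>\<^sup>2 - (alpha_sum * \<beta>)\<^sup>2"
    unfolding gm(2) by (rule G.variance_eq[OF gm(1,3), unfolded gm(2,4)])
  also have "\<dots> = alpha_sum * \<beta>\<^sup>2" by (simp add: power_mult_distrib power2_eq_square algebra_simps)
  finally show "(\<integral>x. (x $ last_ix - alpha_sum * \<beta>)\<^sup>2 \<partial>mg_distribution \<alpha> \<beta>) = alpha_sum * \<beta>\<^sup>2" .
qed

text \<open>The source of the zero blocks of \<open>matrix_V\<close>.\<close>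
lemma dirichlet_part_last_uncorrelated:
  fixes f :: "real ^ 'k::{finite,linorder} \<Rightarrow> real"
  assumes f[measurable]: "f \<in> borel_measurable borel" and int: "integrable (dirichlet_distribution \<alpha>) f"
    and sq: "integrable (dirichlet_distribution \<alpha>) (\<lambda>w. (f w)\<^sup>2)"
  shows "(\<integral>x. f (dirichlet_part x) * (x $ last_ix - alpha_sum * \<beta>) \<partial>mg_distribution \<alpha> \<beta>) = 0"
proof -
  let ?M = "mg_distribution \<alpha> \<beta>" and ?D = "dirichlet_distribution \<alpha>"
  interpret M: prob_space ?M by (rule prob_space_mg[OF pos beta])
  interpret D: prob_space ?D by (rule prob_space_dirichlet[OF card pos])
  interpret G: prob_space gamma_law by (rule prob_space_gamma[OF sum_param_pos[OF card pos] beta])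
  interpret DG: pair_sigma_finite ?D gamma_law ..
  let ?h = "\<lambda>p :: (real, 'k) vec \<times> real. f (fst p) * (snd p - alpha_sum * \<beta>)"
  have [measurable]: "?h \<in> borel_measurable (borel \<Otimes>\<^sub>M borel)" by measurable
  have "integrable ?M (\<lambda>x. (x $ last_ix - alpha_sum * \<beta>)\<^sup>2)"
    using last_moments(1,3) by (simp add: power2_diff)
  moreover have "integrable ?M (\<lambda>x. (f (dirichlet_part x))\<^sup>2)"
    using integral_dirichlet_part(2)[of "\<lambda>w. (f w)\<^sup>2"] sq by simp
  ultimately have "integrable ?M (\<lambda>x. f (dirichlet_part x) * (x $ last_ix - alpha_sum * \<beta>))"
    by (intro integrable_mult_of_squares) auto
  then have "integrable (distr ?M (borel \<Otimes>\<^sub>M borel) (\<lambda>x. (dirichlet_part x, x $ last_ix))) ?h"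
    by (subst integrable_distr_eq) auto
  then have h: "integrable (?D \<Otimes>\<^sub>M gamma_law) ?h" unfolding distr_mg_polar[OF card pos beta] .
  have "(\<integral>x. f (dirichlet_part x) * (x $ last_ix - alpha_sum * \<beta>) \<partial>?M)
      = (\<integral>p. ?h p \<partial>distr ?M (borel \<Otimes>\<^sub>M borel) (\<lambda>x. (dirichlet_part x, x $ last_ix)))"
    by (subst integral_distr) auto
  also have "\<dots> = (\<integral>w. \<integral>s. ?h (w, s) \<partial>gamma_law \<partial>?D)"
    unfolding distr_mg_polar[OF card pos beta] by (rule DG.integral_fst'[OF h, symmetric])
  also have "\<dots> = (\<integral>w. f w * ((\<integral>s. s \<partial>gamma_law) - alpha_sum * \<beta>) \<partial>?D)"
    using gamma_moments(1)[OF sum_param_pos[OF card pos] beta] G.prob_space by simp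
  also have "\<dots> = 0" using gamma_moments(2)[OF sum_param_pos[OF card pos] beta] by simp
  finally show ?thesis .
qed

context
  fixes hD :: "real ^ 'k::{finite,linorder} \<Rightarrow> real ^ 'm::finite"
  assumes hD[measurable]: "hD \<in> borel_measurable borel"
    and hD_int: "integrable (dirichlet_distribution \<alpha>) hD"
begin

lemma measurable_mg_h: "mg_h hD \<in> borel_measurable borel"
proof (rule borel_measurable_vecI)
  show "(\<lambda>x. mg_h hD x $ i) \<in> borel_measurable borel" for i
    by (cases i) (simp_all add: mg_h_def)
qed

lemma integrable_mg_h: "integrable (mg_distribution \<alpha> \<beta>) (mg_h hD)"
proof (rule integrable_vecI)
  have "integrable (mg_distribution \<alpha> \<beta>) (\<lambda>x. hD (dirichlet_part x))"
    using integral_dirichlet_part(2)[OF hD] hD_int by (rule iffD2)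
  then have "integrable (mg_distribution \<alpha> \<beta>) (\<lambda>x. hD (dirichlet_part x) $ i)" for i
    by (rule integrable_bounded_linear[OF bounded_linear_vec_nth])
  then show "integrable (mg_distribution \<alpha> \<beta>) (\<lambda>x. mg_h hD x $ i)" for i
    using last_moments(1) by (cases i) (simp_all add: mg_h_def)
qed

lemma integral_mg_h:
  "(\<integral>x. mg_h hD x \<partial>mg_distribution \<alpha> \<beta>) = append_vec (dirichlet_mean hD \<alpha>) (vec (alpha_sum * \<beta>))"
proof (rule vec_sum_eqI)
  have "(\<integral>x. hD (dirichlet_part x) $ i \<partial>mg_distribution \<alpha> \<beta>) = dirichlet_mean hD \<alpha> $ i" for i
    using integral_dirichlet_part(1)[of "\<lambda>w. hD w $ i"] integral_vec_nth[OF hD_int, of i]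
    by (simp add: dirichlet_mean_def)
  then show "(\<integral>x. mg_h hD x \<partial>mg_distribution \<alpha> \<beta>) $ Inl i
      = append_vec (dirichlet_mean hD \<alpha>) (vec (alpha_sum * \<beta>)) $ Inl i" for i
    by (simp add: integral_vec_nth[OF integrable_mg_h]) (simp add: mg_h_def)
  show "(\<integral>x. mg_h hD x \<partial>mg_distribution \<alpha> \<beta>) $ Inr j
      = append_vec (dirichlet_mean hD \<alpha>) (vec (alpha_sum * \<beta>)) $ Inr j" for j :: 1
    by (simp add: integral_vec_nth[OF integrable_mg_h]) (simp add: mg_h_def last_moments)
qed

lemma mg_g_at_mean:
  assumes "gD (dirichlet_mean hD \<alpha>) = \<alpha>"
  shows "mg_g gD (\<integral>x. mg_h hD x \<partial>mg_distribution \<alpha> \<beta>) = mg_param \<alpha> \<beta>"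
  using assms sum_param_pos[OF card pos] unfolding integral_mg_h by (simp add: mg_g_def)

lemma covariance_mg_h:
  assumes sq: "\<And>i. integrable (dirichlet_distribution \<alpha>) (\<lambda>w. (hD w $ i)\<^sup>2)"
  shows "covariance_matrix (mg_distribution \<alpha> \<beta>) (mg_h hD)
    = matrix_V \<alpha> \<beta> (covariance_matrix (dirichlet_distribution \<alpha>) hD)"
proof -
  let ?M = "mg_distribution \<alpha> \<beta>" and ?D = "dirichlet_distribution \<alpha>"
  let ?m = "dirichlet_mean hD \<alpha>"
  interpret D: prob_space ?D by (rule prob_space_dirichlet[OF card pos])
  have hDi: "integrable ?D (\<lambda>w. hD w $ i)" for i
    using hD_int by (rule integrable_bounded_linear[OF bounded_linear_vec_nth])
  have DD: "(\<integral>x. (hD (dirichlet_part x) $ i - ?m $ i) * (hD (dirichlet_part x) $ j - ?m $ j) \<partial>?M)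
      = covariance_matrix ?D hD $ i $ j" for i j
    using integral_dirichlet_part(1)[of "\<lambda>w. (hD w $ i - ?m $ i) * (hD w $ j - ?m $ j)"]
    by (simp add: covariance_matrix_def dirichlet_mean_def)
  have DL: "(\<integral>x. (hD (dirichlet_part x) $ i - ?m $ i) * (x $ last_ix - alpha_sum * \<beta>) \<partial>?M) = 0" for i
    using dirichlet_part_last_uncorrelated[of "\<lambda>w. hD w $ i - ?m $ i"] hDi sq by (simp add: power2_diff)
  then have LD: "(\<integral>x. (x $ last_ix - alpha_sum * \<beta>) * (hD (dirichlet_part x) $ i - ?m $ i) \<partial>?M) = 0" for i
    by (simp add: mult.commute)
  have LL: "(\<integral>x. (x $ last_ix - alpha_sum * \<beta>) * (x $ last_ix - alpha_sum * \<beta>) \<partial>?M) = alpha_sum * \<beta>\<^sup>2"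
    using last_moments(4) by (simp add: power2_eq_square)
  have "covariance_matrix ?M (mg_h hD) $ a $ b = matrix_V \<alpha> \<beta> (covariance_matrix ?D hD) $ a $ b" for a b
    unfolding covariance_matrix_def[of ?M] integral_mg_h
    by (cases a; cases b) (simp_all add: mg_h_def matrix_V_def block_matrix_def mat_def DD DL LD LL num1_eq_iff)
  then show ?thesis by (simp add: vec_eq_iff)
qed

end

text \<open>
  The lower row of \<open>matrix_G\<close> is the quotient rule for \<open>y \<mapsto> y\<^sub>m\<^sub>+\<^sub>1 / \<Sum>i. g\<^sub>D\<^sub>i\<close> at a point where numerator
  and denominator are \<open>\<alpha>\<^sub>0 \<beta>\<close> and \<open>\<alpha>\<^sub>0\<close>.
\<close>
lemma mg_g_derivative:
  fixes gD :: "real ^ 'm::finite \<Rightarrow> real ^ 'k::{finite,linorder}"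
  assumes der: "(gD has_derivative (\<lambda>v. J *v v)) (at m)" and val: "gD m = \<alpha>"
  shows "(mg_g gD has_derivative (\<lambda>v. matrix_G \<alpha> \<beta> J *v v)) (at (append_vec m (vec (alpha_sum * \<beta>))))"
proof (rule has_derivative_vecI)
  let ?e = "append_vec m (vec (alpha_sum * \<beta>)) :: (real, 'm + 1) vec"
  have lin: "bounded_linear (left_vec :: (real, 'm + 1) vec \<Rightarrow> (real, 'm) vec)"
    by (intro linear_linear[THEN iffD2] linearI) (simp_all add: left_vec_def vec_eq_iff)
  have left: "((\<lambda>y. gD (left_vec y)) has_derivative (\<lambda>v. J *v left_vec v)) (at ?e)"
    using has_derivative_compose[OF bounded_linear_imp_has_derivative[OF lin], of gD "\<lambda>v. J *v v" ?e UNIV] der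
    by simp
  have comp: "((\<lambda>y. gD (left_vec y) $ i) has_derivative (\<lambda>v. (J *v left_vec v) $ i)) (at ?e)" for i
    by (rule bounded_linear.has_derivative[OF bounded_linear_vec_nth left])
  have right: "((\<lambda>y. right_vec y $ 1) has_derivative (\<lambda>v. right_vec v $ 1)) (at ?e)"
    unfolding right_vec_def by (simp add: bounded_linear_imp_has_derivative bounded_linear_vec_nth)
  have sum: "((\<lambda>y. \<Sum>i\<in>UNIV. gD (left_vec y) $ i) has_derivative (\<lambda>v. \<Sum>i\<in>UNIV. (J *v left_vec v) $ i)) (at ?e)"
    by (rule has_derivative_sum) (rule comp)
  have tot: "alpha_sum \<noteq> 0" using sum_param_pos[OF card pos] by simp
  fix a :: "'k + 1"
  show "((\<lambda>y. mg_g gD y $ a) has_derivative (\<lambda>v. (matrix_G \<alpha> \<beta> J *v v) $ a)) (at ?e)"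
  proof (cases a)
    case (Inl i)
    have "(matrix_G \<alpha> \<beta> J *v v) $ Inl i = (J *v left_vec v) $ i" for v
      by (simp add: matrix_vector_mult_def matrix_G_def Let_def block_matrix_def UNIV_Plus_UNIV[symmetric] sum.Plus left_vec_def)
    then show ?thesis using comp[of i] by (simp add: Inl mg_g_def mg_param_def)
  next
    case (Inr j)
    have "(matrix_G \<alpha> \<beta> J *v v) $ Inr j
        = right_vec v $ 1 / alpha_sum - \<beta> / alpha_sum * (\<Sum>i\<in>UNIV. (J *v left_vec v) $ i)" for v
    proof -
      have "(\<Sum>i\<in>UNIV. (J *v left_vec v) $ i) = (\<Sum>q\<in>UNIV. (\<Sum>i\<in>UNIV. J $ i $ q) * v $ Inl q)"
        by (simp add: matrix_vector_mult_def left_vec_def sum_distrib_right) (rule sum.swap)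
      then show ?thesis
        by (simp add: matrix_vector_mult_def matrix_G_def Let_def block_matrix_def UNIV_Plus_UNIV[symmetric] sum.Plus
            right_vec_def matrix_matrix_mult_def mat_def sum_distrib_left sum_negf mult_ac)
    qed
    moreover have "((\<lambda>y. (right_vec y $ 1) / (\<Sum>i\<in>UNIV. gD (left_vec y) $ i)) has_derivative
        (\<lambda>v. right_vec v $ 1 / alpha_sum - \<beta> / alpha_sum * (\<Sum>i\<in>UNIV. (J *v left_vec v) $ i))) (at ?e)"
      by (rule has_derivative_eq_rhs[OF has_derivative_divide[OF right sum]])
        (use tot in \<open>auto simp: val fun_eq_iff field_simps\<close>)
    ultimately show ?thesis by (simp add: Inr mg_g_def mg_param_def)
  qed
qed

end

text \<open>
  It suffices that \<open>g\<^sub>D\<close> is a left inverse of the Dirichlet moment map: then \<open>mg_g g\<^sub>D\<close> is one of the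
  Multivariate Gamma moment map, which is therefore injective.
\<close>
lemma moment_type_estimator_mg:
  fixes hD :: "real ^ 'k::{finite,linorder} \<Rightarrow> real ^ 'm::finite"
  assumes card: "2 \<le> CARD('k)" and hD: "hD \<in> borel_measurable borel"
    and int: "\<And>\<alpha>. (\<And>i. 0 < \<alpha> $ i) \<Longrightarrow> integrable (dirichlet_distribution \<alpha>) hD"
    and inv: "\<And>\<alpha>. (\<And>i. 0 < \<alpha> $ i) \<Longrightarrow> gD (dirichlet_mean hD \<alpha>) = \<alpha>"
    and T: "\<And>N x. T N x = mg_g gD (sample_mean N (\<lambda>n. mg_h hD (x n)))"
  shows "moment_type_estimator mg_family mg_support mg_param_space (mg_h hD) (mg_g gD) T"
proof -
  let ?e = "\<lambda>\<theta>. \<integral>x. mg_h hD x \<partial>mg_family \<theta>"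
  have left_inverse: "mg_g gD (?e \<theta>) = \<theta>" if "\<theta> \<in> mg_param_space" for \<theta>
    using that
  proof (cases \<theta> rule: mg_param_cases)
    case (1 \<alpha> \<beta>)
    then show ?thesis using mg_g_at_mean[where gD=gD, OF card 1(2,3) hD int[OF 1(2)] inv[OF 1(2)]] by (simp add: mg_family_mg_param)
  qed
  have "integrable (mg_family \<theta>) (mg_h hD)" if "\<theta> \<in> mg_param_space" for \<theta>
    using that
  proof (cases \<theta> rule: mg_param_cases)
    case (1 \<alpha> \<beta>)
    then show ?thesis using integrable_mg_h[OF card 1(2,3) hD int[OF 1(2)]] by (simp add: mg_family_mg_param)
  qed
  moreover have inj: "inj_on ?e mg_param_space" by (rule inj_on_inverseI[of _ "mg_g gD"]) (rule left_inverse)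
  ultimately show ?thesis unfolding moment_type_estimator_def
    by (auto simp: T left_inverse the_inv_into_f_f[OF inj])
qed

lemma has_asymptotic_covariance_mg:
  fixes hD :: "real ^ 'k::{finite,linorder} \<Rightarrow> real ^ 'm::finite" and M :: "'a measure"
    and X :: "nat \<Rightarrow> 'a \<Rightarrow> real ^ 'k::{finite,linorder}"
  assumes card: "2 \<le> CARD('k)" and pos: "\<And>i. 0 < \<alpha> $ i" and beta: "0 < \<beta>"
    and M: "prob_space M" and indep: "prob_space.indep_vars M (\<lambda>_. borel) X {1..}"
    and law: "\<And>n. n \<ge> 1 \<Longrightarrow> distributed M lborel (X n) (\<lambda>x. ennreal (mg_density \<alpha> \<beta> x))"
    and hD: "hD \<in> borel_measurable borel" and regular: "dirichlet_regular hD gD \<alpha>"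
    and inv: "gD (dirichlet_mean hD \<alpha>) = \<alpha>"
    and gD: "gD \<in> borel_measurable borel"
    and T: "\<And>N x. T N x = mg_g gD (sample_mean N (\<lambda>n. mg_h hD (x n)))"
  shows "has_asymptotic_covariance M (\<lambda>N \<omega>. T N (\<lambda>n. X n \<omega>)) mg_param_space (mg_param \<alpha> \<beta>)
    (dirichlet_based_covariance hD gD \<alpha> \<beta>)"
proof -
  interpret prob_space M by fact
  let ?P = "distr (mg_distribution \<alpha> \<beta>) borel (mg_h hD)"
  let ?m = "dirichlet_mean hD \<alpha>" and ?J = "jacobian gD (at (dirichlet_mean hD \<alpha>))"
  have int: "integrable (dirichlet_distribution \<alpha>) hD"
    and sq: "\<And>i. integrable (dirichlet_distribution \<alpha>) (\<lambda>w. (hD w $ i)\<^sup>2)"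
    and diff: "gD differentiable (at ?m)"
    using regular by (auto simp: dirichlet_regular_def)
  have [measurable]: "mg_h hD \<in> borel_measurable borel" by (rule measurable_mg_h[OF card pos beta hD int])
  have gD' [measurable]: "(\<lambda>y :: (real, 'm + 1) vec. gD (left_vec y)) \<in> borel_measurable borel"
  proof -
    have "(left_vec :: (real, 'm + 1) vec \<Rightarrow> (real, 'm) vec) \<in> borel_measurable borel"
      by (rule borel_measurable_vecI) (simp add: left_vec_def)
    then show ?thesis using gD by (rule measurable_compose)
  qed
  have [measurable]: "mg_g gD \<in> borel_measurable borel"
  proof (rule borel_measurable_vecI)
    show "(\<lambda>y. mg_g gD y $ a) \<in> borel_measurable borel" for a
      by (cases a) (simp_all add: mg_g_def mg_param_def right_vec_def)
  qed
  interpret iid_sample M "\<lambda>n \<omega>. mg_h hD (X n \<omega>)" ?P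
  proof
    show "indep_vars (\<lambda>_. borel) (\<lambda>n \<omega>. mg_h hD (X n \<omega>)) {1..}"
      by (rule indep_vars_compose2[OF indep]) simp
    show "distr M borel (\<lambda>\<omega>. mg_h hD (X n \<omega>)) = ?P" if "n \<ge> 1" for n
    proof -
      have X: "X n \<in> measurable M lborel" "distr M lborel (X n) = mg_distribution \<alpha> \<beta>"
        using law[OF that] by (simp_all add: distributed_def mg_distribution_def)
      show ?thesis unfolding X(2)[symmetric] using X(1) by (subst distr_distr) (auto simp: comp_def)
    qed
    have "integrable (mg_distribution \<alpha> \<beta>) (\<lambda>x. (mg_h hD x $ i)\<^sup>2)" for i
    proof (cases i)
      case (Inl a)
      then show ?thesis
        using integral_dirichlet_part(2)[OF card pos beta, of "\<lambda>w. (hD w $ a)\<^sup>2"] sq[of a] hD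
        by (simp add: mg_h_def)
    next
      case (Inr b)
      then show ?thesis using last_moments(3)[OF card pos beta] by (simp add: mg_h_def)
    qed
    then show "integrable ?P (\<lambda>y. (y $ i)\<^sup>2)" for i by (subst integrable_distr_eq) auto
  qed
  have mean: "mean = (\<integral>x. mg_h hD x \<partial>mg_distribution \<alpha> \<beta>)"
    unfolding mean_def by (subst integral_distr) auto
  have cov: "cov = matrix_V \<alpha> \<beta> (covariance_matrix (dirichlet_distribution \<alpha>) hD)"
  proof -
    have "cov = covariance_matrix (mg_distribution \<alpha> \<beta>) (mg_h hD)"
      by (simp add: cov_def covariance_matrix_def integral_distr)
    also have "\<dots> = matrix_V \<alpha> \<beta> (covariance_matrix (dirichlet_distribution \<alpha>) hD)"
      by (rule covariance_mg_h[OF card pos beta hD int sq])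
    finally show ?thesis .
  qed
  have gmean: "mg_g gD mean = mg_param \<alpha> \<beta>"
    unfolding mean by (rule mg_g_at_mean[where gD=gD, OF card pos beta hD int inv])
  have der_gD: "(gD has_derivative (\<lambda>v. ?J *v v)) (at ?m)" using diff jacobian_works by blast
  have der: "(mg_g gD has_derivative (\<lambda>v. matrix_G \<alpha> \<beta> ?J *v v)) (at mean)"
    unfolding mean integral_mg_h[OF card pos beta hD int] by (rule mg_g_derivative[OF card pos beta der_gD inv])
  have "open (mg_param_space :: (real, 'k + 1) vec set)"
  proof -
    have eq: "mg_param_space = (\<Inter>i. {\<theta> :: (real, 'k + 1) vec. 0 < \<theta> $ i})" by (auto simp: mg_param_space_def)
    show ?thesis unfolding eq by (intro open_INT ballI open_Collect_less continuous_intros finite)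
  qed
  moreover have "mg_param \<alpha> \<beta> \<in> mg_param_space"
  proof -
    have "0 < mg_param \<alpha> \<beta> $ i" for i using pos beta by (cases i) (simp_all add: mg_param_def)
    then show ?thesis by (simp add: mg_param_space_def)
  qed
  ultimately have "has_asymptotic_covariance M (\<lambda>N \<omega>. T N (\<lambda>n. X n \<omega>)) mg_param_space (mg_g gD mean)
      (matrix_G \<alpha> \<beta> ?J ** cov ** transpose (matrix_G \<alpha> \<beta> ?J))"
    by (intro delta_method[OF der]) (auto simp: T gmean)
  then show ?thesis by (simp add: gmean cov dirichlet_based_covariance_def Let_def)
qed

section \<open>The two Dirichlet-based estimators\<close>

lemma sample_mean_vec_nth: "sample_mean N f $ i = sample_mean N (\<lambda>n. f n $ i)"
  by (simp add: sample_mean_def)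

text \<open>
  The identity holds for all \<open>N\<close> and all \<open>x\<close>, even for \<open>N = 0\<close> and outside the support, because both sides
  divide by the same expressions and thus agree where a denominator vanishes.
\<close>
lemma dirichlet_me_eq: "dirichlet_me N x = mg_g me_gD (sample_mean N (\<lambda>n. mg_h me_hD (x n)))"
proof -
  have left: "left_vec (sample_mean N (\<lambda>n. mg_h me_hD (x n))) $ Inl i = sample_mean N (\<lambda>n. dirichlet_part (x n) $ i)"
    "left_vec (sample_mean N (\<lambda>n. mg_h me_hD (x n))) $ Inr i = sample_mean N (\<lambda>n. (dirichlet_part (x n) $ i)\<^sup>2)" for i
    by (simp_all add: left_vec_def sample_mean_vec_nth mg_h_def me_hD_def)
  have "right_vec (sample_mean N (\<lambda>n. mg_h me_hD (x n))) $ 1 = sample_mean N (\<lambda>n. x n $ last_ix)"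
    by (simp add: right_vec_def sample_mean_vec_nth mg_h_def)
  moreover have "me_gD (left_vec (sample_mean N (\<lambda>n. mg_h me_hD (x n)))) = me_alpha N (\<lambda>n. dirichlet_part (x n))"
    by (simp add: me_gD_def me_alpha_def left)
  ultimately show ?thesis by (simp add: dirichlet_me_def mg_g_def Let_def)
qed

lemma dirichlet_same_eq: "dirichlet_same N x = mg_g same_gD (sample_mean N (\<lambda>n. mg_h same_hD (x n)))"
proof -
  have left: "left_vec (sample_mean N (\<lambda>n. mg_h same_hD (x n))) $ Inl i = sample_mean N (\<lambda>n. dirichlet_part (x n) $ i)"
    "left_vec (sample_mean N (\<lambda>n. mg_h same_hD (x n))) $ Inr (Inl i) = sample_mean N (\<lambda>n. ln (dirichlet_part (x n) $ i))"
    "left_vec (sample_mean N (\<lambda>n. mg_h same_hD (x n))) $ Inr (Inr i)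
      = sample_mean N (\<lambda>n. dirichlet_part (x n) $ i * ln (dirichlet_part (x n) $ i))" for i
    by (simp_all add: left_vec_def sample_mean_vec_nth mg_h_def same_hD_def)
  have "right_vec (sample_mean N (\<lambda>n. mg_h same_hD (x n))) $ 1 = sample_mean N (\<lambda>n. x n $ last_ix)"
    by (simp add: right_vec_def sample_mean_vec_nth mg_h_def)
  moreover have "same_gD (left_vec (sample_mean N (\<lambda>n. mg_h same_hD (x n)))) = same_alpha N (\<lambda>n. dirichlet_part (x n))"
    by (simp add: same_gD_def same_alpha_def left)
  ultimately show ?thesis by (simp add: dirichlet_same_def mg_g_def Let_def)
qed

lemma measurable_me_hD: "me_hD \<in> borel_measurable borel"
proof (rule borel_measurable_vecI)
  show "(\<lambda>w. me_hD w $ a) \<in> borel_measurable borel" for a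
    by (cases a) (simp_all add: me_hD_def)
qed

lemma measurable_same_hD: "same_hD \<in> borel_measurable borel"
proof (rule borel_measurable_vecI)
  fix a :: "'a + 'a + 'a"
  show "(\<lambda>w :: (real, 'a) vec. same_hD w $ a) \<in> borel_measurable borel"
  proof (cases a)
    case (Inr b)
    then show ?thesis by (cases b) (simp_all add: same_hD_def)
  qed (simp add: same_hD_def)
qed

lemma measurable_me_gD: "me_gD \<in> borel_measurable borel"
  by (rule borel_measurable_vecI) (simp add: me_gD_def)

lemma measurable_same_gD: "same_gD \<in> borel_measurable borel"
  by (rule borel_measurable_vecI) (simp add: same_gD_def)

context
  fixes \<alpha> :: "real ^ 'k::{finite,linorder}"
  assumes card: "2 \<le> CARD('k)" and pos: "\<And>i. 0 < \<alpha> $ i"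
begin

lemma square_integrable_me_hD: "integrable (dirichlet_distribution \<alpha>) (\<lambda>w. (me_hD w $ a)\<^sup>2)"
proof (cases a)
  case (Inl i)
  then show ?thesis using integrable_dirichlet_power[OF card pos, of i 2] by (simp add: me_hD_def)
next
  case (Inr i)
  then show ?thesis using integrable_dirichlet_power[OF card pos, of i 4] by (simp add: me_hD_def)
qed

lemma square_integrable_same_hD: "integrable (dirichlet_distribution \<alpha>) (\<lambda>w. (same_hD w $ a)\<^sup>2)"
proof (cases a)
  case (Inl i)
  then show ?thesis using integrable_dirichlet_power[OF card pos, of i 2] by (simp add: same_hD_def)
next
  case (Inr b)
  then show ?thesis
    using integrable_dirichlet_ln_square[OF card pos] integrable_dirichlet_mult_ln_square[OF card pos]
    by (cases b) (simp_all add: same_hD_def)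
qed

lemma integrable_of_square_entries:
  fixes hD :: "real ^ 'k::{finite,linorder} \<Rightarrow> real ^ 'm::finite"
  assumes [measurable]: "hD \<in> borel_measurable borel"
    and "\<And>a. integrable (dirichlet_distribution \<alpha>) (\<lambda>w. (hD w $ a)\<^sup>2)"
  shows "integrable (dirichlet_distribution \<alpha>) hD"
proof (rule integrable_vecI)
  interpret prob_space "dirichlet_distribution \<alpha>" by (rule prob_space_dirichlet[OF card pos])
  show "integrable (dirichlet_distribution \<alpha>) (\<lambda>w. hD w $ a)" for a
    by (rule integrable_of_square[OF _ assms(2)]) simp
qed

lemma integrable_me_hD: "integrable (dirichlet_distribution \<alpha>) me_hD"
  by (rule integrable_of_square_entries[OF measurable_me_hD square_integrable_me_hD])

lemma integrable_same_hD: "integrable (dirichlet_distribution \<alpha>) same_hD"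
  by (rule integrable_of_square_entries[OF measurable_same_hD square_integrable_same_hD])

lemma me_mean:
  defines "A \<equiv> \<Sum>i\<in>UNIV. \<alpha> $ i"
  shows "dirichlet_mean me_hD \<alpha> $ Inl i = \<alpha> $ i / A"
    and "dirichlet_mean me_hD \<alpha> $ Inr i = \<alpha> $ i * (\<alpha> $ i + 1) / (A * (A + 1))"
  using integral_vec_nth[OF integrable_me_hD, of "Inl i"] integral_vec_nth[OF integrable_me_hD, of "Inr i"]
    dirichlet_mean_entry[OF card pos, of i] dirichlet_second_moment[OF card pos, of i]
  by (simp_all add: dirichlet_mean_def me_hD_def A_def)

text \<open>
  The variance \<open>p (1 - p) / (\<alpha>\<^sub>0 + 1)\<close> of \<open>W\<^sub>i\<close>, where \<open>p = \<alpha>\<^sub>i / \<alpha>\<^sub>0\<close>, and the difference \<open>E(W\<^sub>i) - E(W\<^sub>i\<^sup>2)\<close>,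
  which is \<open>\<alpha>\<^sub>0\<close> times as large.
\<close>
lemma me_denominator:
  defines "A \<equiv> \<Sum>i\<in>UNIV. \<alpha> $ i"
  shows "dirichlet_mean me_hD \<alpha> $ Inr i - (dirichlet_mean me_hD \<alpha> $ Inl i)\<^sup>2
      = \<alpha> $ i * (A - \<alpha> $ i) / (A\<^sup>2 * (A + 1))"
    and "dirichlet_mean me_hD \<alpha> $ Inl i - dirichlet_mean me_hD \<alpha> $ Inr i
      = \<alpha> $ i * (A - \<alpha> $ i) / (A * (A + 1))"
proof -
  have A: "0 < A" using sum_param_pos[OF card pos] by (simp add: A_def)
  then have "A \<noteq> 0" "A + 1 \<noteq> 0" by auto
  then show "dirichlet_mean me_hD \<alpha> $ Inr i - (dirichlet_mean me_hD \<alpha> $ Inl i)\<^sup>2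
      = \<alpha> $ i * (A - \<alpha> $ i) / (A\<^sup>2 * (A + 1))"
    and "dirichlet_mean me_hD \<alpha> $ Inl i - dirichlet_mean me_hD \<alpha> $ Inr i
      = \<alpha> $ i * (A - \<alpha> $ i) / (A * (A + 1))"
    unfolding me_mean A_def[symmetric] by (simp_all add: divide_simps) (simp_all add: power2_eq_square algebra_simps)
qed

lemma me_denominator_nonzero:
  "dirichlet_mean me_hD \<alpha> $ Inr i - (dirichlet_mean me_hD \<alpha> $ Inl i)\<^sup>2 \<noteq> 0"
  using sum_param_gt[OF card pos, of i] sum_param_pos[OF card pos] pos[of i] unfolding me_denominator by simp

lemma me_gD_mean: "me_gD (dirichlet_mean me_hD \<alpha>) = \<alpha>"
proof -
  define A where "A = (\<Sum>i\<in>UNIV. \<alpha> $ i)"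
  have "me_gD (dirichlet_mean me_hD \<alpha>) $ i = \<alpha> $ i" for i
  proof -
    have "0 < A" "0 < A - \<alpha> $ i" "0 < \<alpha> $ i"
      using sum_param_gt[OF card pos, of i] sum_param_pos[OF card pos] pos[of i] by (simp_all add: A_def)
    then have "A \<noteq> 0" "A + 1 \<noteq> 0" "A - \<alpha> $ i \<noteq> 0" "\<alpha> $ i \<noteq> 0" by auto
    then show ?thesis
      unfolding me_gD_def vec_lambda_beta me_denominator unfolding me_mean(1) A_def[symmetric]
      by (simp add: divide_simps power2_eq_square)
  qed
  then show ?thesis by (simp add: vec_eq_iff)
qed

lemma me_gD_differentiable: "me_gD differentiable (at (dirichlet_mean me_hD \<alpha>))"
  by (rule differentiable_vecI)
    (use me_denominator_nonzero in \<open>simp add: me_gD_def differentiable_vec_nth\<close>)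

lemma same_mean:
  "dirichlet_mean same_hD \<alpha> $ Inl i = (\<integral>w. w $ i \<partial>dirichlet_distribution \<alpha>)"
  "dirichlet_mean same_hD \<alpha> $ Inr (Inl i) = (\<integral>w. ln (w $ i) \<partial>dirichlet_distribution \<alpha>)"
  "dirichlet_mean same_hD \<alpha> $ Inr (Inr i) = (\<integral>w. w $ i * ln (w $ i) \<partial>dirichlet_distribution \<alpha>)"
  by (simp_all add: dirichlet_mean_def integral_vec_nth[OF integrable_same_hD]) (simp_all add: same_hD_def)

lemma same_denominator:
  "(\<Sum>j\<in>UNIV. dirichlet_mean same_hD \<alpha> $ Inr (Inr j)
      - dirichlet_mean same_hD \<alpha> $ Inl j * dirichlet_mean same_hD \<alpha> $ Inr (Inl j))
    = (real CARD('k) - 1) / (\<Sum>i\<in>UNIV. \<alpha> $ i)"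
proof -
  define A where "A = (\<Sum>i\<in>UNIV. \<alpha> $ i)"
  have "A \<noteq> 0" using sum_param_pos[OF card pos] by (simp add: A_def)
  then have "(\<Sum>j\<in>UNIV. (1 - \<alpha> $ j / A) / A) = (real CARD('k) - 1) / A"
    by (simp add: sum_divide_distrib[symmetric] sum_subtractf A_def[symmetric])
  then show ?thesis unfolding same_mean dirichlet_covariance_ln[OF card pos] A_def .
qed

lemma same_denominator_nonzero: "(real CARD('k) - 1) / (\<Sum>i\<in>UNIV. \<alpha> $ i) \<noteq> 0"
  using card sum_param_pos[OF card pos] by simp

lemma same_gD_mean: "same_gD (dirichlet_mean same_hD \<alpha>) = \<alpha>"
proof -
  have "same_gD (dirichlet_mean same_hD \<alpha>) $ i = \<alpha> $ i" for i
    using same_denominator_nonzero unfolding same_gD_def vec_lambda_beta same_denominator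
    by (simp add: same_mean dirichlet_mean_entry[OF card pos])
  then show ?thesis by (simp add: vec_eq_iff)
qed

lemma same_gD_differentiable: "same_gD differentiable (at (dirichlet_mean same_hD \<alpha>))"
  by (rule differentiable_vecI)
    (use same_denominator same_denominator_nonzero in
      \<open>simp add: same_gD_def differentiable_vec_nth differentiable_sum\<close>)

end

theorem corollary4p10:
  fixes \<alpha> :: "real ^ 'k::{finite,linorder}" and \<beta> :: real
    and M :: "'a measure" and X :: "nat \<Rightarrow> 'a \<Rightarrow> real ^ 'k::{finite,linorder}"
  assumes "CARD('k) \<ge> 2"
    and "\<And>i. 0 < \<alpha> $ i" and "0 < \<beta>"
    and "prob_space M"
    and "prob_space.indep_vars M (\<lambda>_. borel) X {1..}"
    and "\<And>n. n \<ge> 1 \<Longrightarrow> distributed M lborel (X n) (\<lambda>x. ennreal (mg_density \<alpha> \<beta> x))"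
  shows
    "moment_type_estimator mg_family (mg_support :: (real ^ 'k::{finite,linorder}) set) mg_param_space
        (mg_h me_hD) (mg_g me_gD) dirichlet_me
     \<and> moment_type_estimator mg_family (mg_support :: (real ^ 'k::{finite,linorder}) set) mg_param_space
        (mg_h same_hD) (mg_g same_gD) dirichlet_same
     \<and> dirichlet_regular me_hD me_gD \<alpha>
     \<and> has_asymptotic_covariance M (\<lambda>N \<omega>. dirichlet_me N (\<lambda>n. X n \<omega>))
        mg_param_space (mg_param \<alpha> \<beta>) (dirichlet_based_covariance me_hD me_gD \<alpha> \<beta>)
     \<and> dirichlet_regular same_hD same_gD \<alpha>
     \<and> has_asymptotic_covariance M (\<lambda>N \<omega>. dirichlet_same N (\<lambda>n. X n \<omega>))
        mg_param_space (mg_param \<alpha> \<beta>) (dirichlet_based_covariance same_hD same_gD \<alpha> \<beta>)"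
proof -
  note card = assms(1) and pos = assms(2)
  have regular_me: "dirichlet_regular me_hD me_gD \<alpha>"
    unfolding dirichlet_regular_def
    using integrable_me_hD[OF card pos] square_integrable_me_hD[OF card pos] me_gD_differentiable[OF card pos]
    by blast
  have regular_same: "dirichlet_regular same_hD same_gD \<alpha>"
    unfolding dirichlet_regular_def
    using integrable_same_hD[OF card pos] square_integrable_same_hD[OF card pos] same_gD_differentiable[OF card pos]
    by blast
  show ?thesis
  proof (intro conjI)
    show "moment_type_estimator mg_family (mg_support :: (real, 'k) vec set) mg_param_space
        (mg_h me_hD) (mg_g me_gD) dirichlet_me"
      by (rule moment_type_estimator_mg[OF card measurable_me_hD integrable_me_hD[OF card]
            me_gD_mean[OF card] dirichlet_me_eq])
    show "moment_type_estimator mg_family (mg_support :: (real, 'k) vec set) mg_param_space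
        (mg_h same_hD) (mg_g same_gD) dirichlet_same"
      by (rule moment_type_estimator_mg[OF card measurable_same_hD integrable_same_hD[OF card]
            same_gD_mean[OF card] dirichlet_same_eq])
    show "has_asymptotic_covariance M (\<lambda>N \<omega>. dirichlet_me N (\<lambda>n. X n \<omega>))
        mg_param_space (mg_param \<alpha> \<beta>) (dirichlet_based_covariance me_hD me_gD \<alpha> \<beta>)"
      by (rule has_asymptotic_covariance_mg[OF assms measurable_me_hD regular_me
            me_gD_mean[OF card pos] measurable_me_gD dirichlet_me_eq])
    show "has_asymptotic_covariance M (\<lambda>N \<omega>. dirichlet_same N (\<lambda>n. X n \<omega>))
        mg_param_space (mg_param \<alpha> \<beta>) (dirichlet_based_covariance same_hD same_gD \<alpha> \<beta>)"
      by (rule has_asymptotic_covariance_mg[OF assms measurable_same_hD regular_same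
            same_gD_mean[OF card pos] measurable_same_gD dirichlet_same_eq])
  qed (fact regular_me regular_same)+
qed

end
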